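(* Let $s,L>0$ be fixed, let $B^{(1)},\dots,B^{(m)}>0$ be communication constraints, and assume $\log_2 n\le m=O(n^{\frac{2s}{1+2s}}/\log^2 n)$ ($m$ and the $B^{(i)}$ may depend on $n$). Let the sequence $\delta_n=o(1)$ be defined as the solution of $$\delta_n=\min\Big\{\frac{m}{n\log_2 n},\ \frac{m}{n\sum_{i=1}^m\big[(\log_2(n)\,\delta_n^{\frac{1}{1+2s}}B^{(i)})\wedge 1\big]}\Big\}.$$ Then in the distributed random design regression model $$\inf_{\hat f\in\mathcal F_{dist}(B^{(1)},\dots,B^{(m)};B^s_{\infty,\infty}(L))}\ \sup_{f_0\in B^s_{\infty,\infty}(L)}\mathbb E_{f_0,T}\|\hat f-f_0\|_\infty\ \gtrsim\ \Big(\frac{n}{\log n}\Big)^{-\frac{s}{1+2s}}\vee\ \delta_n^{\frac{s}{1+2s}} .$$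
   Context: Model. The total sample size is $n$ and there are $m=m_n$ local machines with $n/m\in\mathbb N$. Machine $i\in\{1,\dots,m\}$ observes pairs $(T^{(i)}_\ell,X^{(i)}_\ell)$, $\ell=1,\dots,n/m$, with $X^{(i)}_\ell=f_0(T^{(i)}_\ell)+\sigma\varepsilon^{(i)}_\ell$, where the $T^{(i)}_\ell$ are iid uniform on $(0,1)$, the $\varepsilon^{(i)}_\ell$ are iid $N(0,1)$, independent of the design, $\sigma>0$ is fixed and $f_0\in L_2[0,1]$ is unknown and common to all machines. $\mathbb E_{f_0,T}$ is expectation under the joint law of all data. Distributed estimators. Machine $i$ sends to a central machine a finite binary string $Y^{(i)}$ which is a measurable function of its local data; $l(Y)$ denotes the length of a string $Y$. For $\mathcal F\subset L_2[0,1]$, $\mathcal F_{dist}(B^{(1)},\dots,B^{(m)};\mathcal F)$ is the class of estimators $\hat f$ that are measurable functions of $(Y^{(1)},\dots,Y^{(m)})$ for such strings satisfying $\mathbb E_{f_0,T}[l(Y^{(i)})]\le B^{(i)}$ for all $f_0\in\mathcal F$ and all $i$. Besov balls. $\psi_{jk}$ ($j\ge 0$, $0\le k\le 2^j-1$) is a Cohen–Daubechies–Vial compactly supported orthonormal wavelet basis of $L_2[0,1]$ with $N>s$ vanishing moments (coarsest-level scaling functions included in the indexing), $f_{jk}=\langle f,\psi_{jk}\rangle$, $\|f\|_{B^s_{\infty,\infty}}=\sup_{j,k}2^{j(s+1/2)}|f_{jk}|$ and $B^s_{\infty,\infty}(L)=\{f\in L_2[0,1]:\|f\|_{B^s_{\infty,\infty}}<L\}$.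 Notation. $a\wedge b=\min(a,b)$, $a\vee b=\max(a,b)$. For positive sequences, $a_n\lesssim b_n$ (equivalently $b_n\gtrsim a_n$) means $a_n\le Cb_n$ for all sufficiently large $n$ with a constant $C>0$ not depending on $n$ (it may depend on fixed quantities such as $s,L,\sigma$, the wavelet basis and the implied constant in the condition on $m$). *)

theory Defs
  imports "HOL-Probability.Probability"
begin

section \<open>Cohen--Daubechies--Vial wavelet bases of \<open>L\<^sub>2[0,1]\<close>\<close>

text \<open>Elements of \<open>L\<^sub>2[0,1]\<close> are represented by Borel functions on the real line, of which only the
  restriction to the unit interval is ever used.\<close>

definition L2_unit :: "(real \<Rightarrow> real) set" where
  "L2_unit = {f \<in> borel_measurable borel. set_integrable lborel {0..1} (\<lambda>x. (f x)\<^sup>2)}"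

definition inner_on :: "real set \<Rightarrow> (real \<Rightarrow> real) \<Rightarrow> (real \<Rightarrow> real) \<Rightarrow> real" where
  "inner_on A f g = set_lebesgue_integral lborel A (\<lambda>x. f x * g x)"

text \<open>Daubechies father \<open>\<phi>\<close> and mother \<open>\<psi>\<close> with \<open>N\<close> vanishing moments, filter \<open>h\<close> of the minimal
  length \<open>2 N\<close>, normalised so that both are supported in \<open>[1 - N, N]\<close>. The equations hold pointwise:
  for \<open>N = 1\<close> this is the Haar pair (with half-open intervals), for \<open>N \<ge> 2\<close> the continuous
  representatives.\<close>

definition daubechies_pair ::
    "nat \<Rightarrow> (int \<Rightarrow> real) \<Rightarrow> (real \<Rightarrow> real) \<Rightarrow> (real \<Rightarrow> real) \<Rightarrow> bool" where
  "daubechies_pair N h \<phi> \<psi> \<longleftrightarrow>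
     N \<ge> 1 \<and>
     \<phi> \<in> borel_measurable borel \<and> bounded (range \<phi>) \<and>
     (\<forall>x. x \<notin> {1 - real N..real N} \<longrightarrow> \<phi> x = 0) \<and>
     integral\<^sup>L lborel \<phi> = 1 \<and>
     (\<forall>m::int. inner_on UNIV \<phi> (\<lambda>x. \<phi> (x - of_int m)) = (if m = 0 then 1 else 0)) \<and>
     (\<forall>x. \<phi> x = sqrt 2 * (\<Sum>l\<in>{1 - int N..int N}. h l * \<phi> (2 * x - of_int l))) \<and>
     (\<forall>x. \<psi> x = sqrt 2 *
        (\<Sum>l\<in>{1 - int N..int N}. (if even l then 1 else - 1) * h (1 - l) * \<phi> (2 * x - of_int l))) \<and>
     (\<forall>p<N. inner_on UNIV (\<lambda>x. x ^ p) \<psi> = 0)"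

text \<open>Boundary functions of the construction on the half-line \<open>[0,\<infinity>)\<close>. On the half-line the translates
  \<open>\<phi> (x - l)\<close> with \<open>l \<ge> N\<close> are kept. The remaining ones are replaced by \<open>N\<close> combinations that
  restore the polynomials of degree less than \<open>N\<close>.\<close>

definition edge_generator :: "nat \<Rightarrow> (real \<Rightarrow> real) \<Rightarrow> nat \<Rightarrow> real \<Rightarrow> real" where
  "edge_generator N \<phi> k x =
     indicator {0..} x * (\<Sum>l\<in>{k..2 * N - 2}. real (l choose k) * \<phi> (x + real l - real N + 1))"

text \<open>The functions \<open>\<phi>E k\<close> (\<open>k < N\<close>) orthonormalise the generators, and the \<open>\<psi>E k\<close> (\<open>k < N\<close>) form an
  orthonormal basis of the part of the detail space not covered by the translates \<open>\<psi> (x - m)\<close>,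
  \<open>m \<ge> N\<close>.\<close>

definition edge_functions ::
    "nat \<Rightarrow> (real \<Rightarrow> real) \<Rightarrow> (real \<Rightarrow> real) \<Rightarrow> (nat \<Rightarrow> real \<Rightarrow> real) \<Rightarrow> (nat \<Rightarrow> real \<Rightarrow> real) \<Rightarrow> bool" where
  "edge_functions N \<phi> \<psi> \<phi>E \<psi>E \<longleftrightarrow>
     (\<forall>k<N. \<exists>a. \<forall>x. \<phi>E k x = (\<Sum>l<N. a l * edge_generator N \<phi> l x)) \<and>
     (\<forall>k<N. \<forall>l<N. inner_on {0..} (\<phi>E k) (\<phi>E l) = (if k = l then 1 else 0)) \<and>
     (\<forall>k<N. \<exists>b c. \<forall>x. \<psi>E k x =
        (\<Sum>l<N. b l * \<phi>E l (2 * x)) + (\<Sum>l\<in>{N..3 * N - 2}. c l * \<phi> (2 * x - real l))) \<and>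
     (\<forall>k<N. \<forall>l<N. inner_on {0..} (\<psi>E k) (\<psi>E l) = (if k = l then 1 else 0)) \<and>
     (\<forall>k<N. \<forall>l<N. inner_on {0..} (\<psi>E k) (\<phi>E l) = 0) \<and>
     (\<forall>k<N. \<forall>m\<ge>N. inner_on {0..} (\<psi>E k) (\<lambda>x. \<phi> (x - real m)) = 0 \<and>
                    inner_on {0..} (\<psi>E k) (\<lambda>x. \<psi> (x - real m)) = 0)"

text \<open>The \<open>k\<close>-th function of level \<open>j\<close> on the unit interval (\<open>k < 2 ^ j\<close>): \<open>N\<close> left boundary functions,
  interior translates, \<open>N\<close> right boundary functions (which live on the half-line after
  \<open>x \<mapsto> 1 - x\<close>).\<close>

definition interval_level ::
    "nat \<Rightarrow> (real \<Rightarrow> real) \<Rightarrow> (nat \<Rightarrow> real \<Rightarrow> real) \<Rightarrow> (nat \<Rightarrow> real \<Rightarrow> real) \<Rightarrow> nat \<Rightarrow> nat \<Rightarrow> real \<Rightarrow> real" where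
  "interval_level N f fL fR j k x = sqrt (2 ^ j) *
     (if k < N then fL k (2 ^ j * x)
      else if k < 2 ^ j - N then f (2 ^ j * x - real k)
      else fR (2 ^ j - 1 - k) (2 ^ j * (1 - x)))"

datatype cdv_index = Scaling nat | Wavelet nat nat

definition cdv_indices :: "nat \<Rightarrow> cdv_index set" where
  "cdv_indices j0 = {Scaling k | k. k < 2 ^ j0} \<union> {Wavelet j k | j k. j0 \<le> j \<and> k < 2 ^ j}"

fun level :: "nat \<Rightarrow> cdv_index \<Rightarrow> nat" where
  "level j0 (Scaling k) = j0"
| "level j0 (Wavelet j k) = j"

text \<open>The three last conjuncts (orthonormality, completeness and vanishing moments) are the properties
  Cohen, Daubechies and Vial prove for their construction; they are part of what is meant by such
  a basis. The coarsest level has to satisfy \<open>2 N \<le> 2 ^ j0\<close> for the two boundaries to be separated.\<close>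

definition cdv_basis :: "nat \<Rightarrow> nat \<Rightarrow> (cdv_index \<Rightarrow> real \<Rightarrow> real) \<Rightarrow> bool" where
  "cdv_basis N j0 w \<longleftrightarrow>
     2 * N \<le> 2 ^ j0 \<and>
     (\<exists>h \<phi> \<psi> \<phi>L \<psi>L \<phi>R \<psi>R.
        daubechies_pair N h \<phi> \<psi> \<and>
        edge_functions N \<phi> \<psi> \<phi>L \<psi>L \<and>
        edge_functions N (\<lambda>x. \<phi> (1 - x)) (\<lambda>x. \<psi> (1 - x)) \<phi>R \<psi>R \<and>
        (\<forall>k<2 ^ j0. w (Scaling k) = interval_level N \<phi> \<phi>L \<phi>R j0 k) \<and>
        (\<forall>j\<ge>j0. \<forall>k<2 ^ j. w (Wavelet j k) = interval_level N \<psi> \<psi>L \<psi>R j k)) \<and>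
     (\<forall>a\<in>cdv_indices j0. \<forall>b\<in>cdv_indices j0. inner_on {0..1} (w a) (w b) = (if a = b then 1 else 0)) \<and>
     (\<forall>f\<in>L2_unit. (\<forall>a\<in>cdv_indices j0. inner_on {0..1} f (w a) = 0) \<longrightarrow>
        (AE x in lborel. x \<in> {0..1} \<longrightarrow> f x = 0)) \<and>
     (\<forall>j\<ge>j0. \<forall>k<2 ^ j. \<forall>p<N. inner_on {0..1} (\<lambda>x. x ^ p) (w (Wavelet j k)) = 0)"


section \<open>Besov balls and the supremum norm\<close>

definition besov_norm :: "nat \<Rightarrow> (cdv_index \<Rightarrow> real \<Rightarrow> real) \<Rightarrow> real \<Rightarrow> (real \<Rightarrow> real) \<Rightarrow> ennreal" where
  "besov_norm j0 w s f =
     (SUP a\<in>cdv_indices j0. ennreal (2 powr (real (level j0 a) * (s + 1 / 2)) * \<bar>inner_on {0..1} f (w a)\<bar>))"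

definition besov_ball :: "nat \<Rightarrow> (cdv_index \<Rightarrow> real \<Rightarrow> real) \<Rightarrow> real \<Rightarrow> real \<Rightarrow> (real \<Rightarrow> real) set" where
  "besov_ball j0 w s L = {f \<in> L2_unit. besov_norm j0 w s f < ennreal L}"

text \<open>Elements of \<open>L\<^sub>2[0,1]\<close> are classes modulo null sets, so the supremum norm is the essential one.\<close>

definition sup_norm :: "(real \<Rightarrow> real) \<Rightarrow> ennreal" where
  "sup_norm f = esssup (restrict_space lborel {0..1}) (\<lambda>x. ennreal \<bar>f x\<bar>)"


section \<open>The distributed regression model\<close>

definition obs_law :: "real \<Rightarrow> (real \<Rightarrow> real) \<Rightarrow> (real \<times> real) measure" where
  "obs_law \<sigma> f = distr (uniform_measure lborel {0<..<1} \<Otimes>\<^sub>M density lborel std_normal_density) borel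
     (\<lambda>(t, e). (t, f t + \<sigma> * e))"

definition local_law :: "real \<Rightarrow> nat \<Rightarrow> nat \<Rightarrow> (real \<Rightarrow> real) \<Rightarrow> (nat \<Rightarrow> real \<times> real) measure" where
  "local_law \<sigma> n m f = PiM {1..n div m} (\<lambda>_. obs_law \<sigma> f)"

definition data_law :: "real \<Rightarrow> nat \<Rightarrow> nat \<Rightarrow> (real \<Rightarrow> real) \<Rightarrow> (nat \<Rightarrow> nat \<Rightarrow> real \<times> real) measure" where
  "data_law \<sigma> n m f = PiM {1..m} (\<lambda>_. local_law \<sigma> n m f)"

text \<open>Estimators are functions of the data \<open>\<omega>\<close>, where \<open>\<omega> i\<close> is the local sample of machine \<open>i\<close>. No measurability
  is asked of the aggregation map \<open>g\<close>: the tuple of strings ranges over a countable discrete space.\<close>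

definition dist_estimators ::
    "real \<Rightarrow> nat \<Rightarrow> nat \<Rightarrow> (nat \<Rightarrow> real) \<Rightarrow> (real \<Rightarrow> real) set \<Rightarrow>
     ((nat \<Rightarrow> nat \<Rightarrow> real \<times> real) \<Rightarrow> real \<Rightarrow> real) set" where
  "dist_estimators \<sigma> n m B F =
     {fhat. \<exists>(Y :: nat \<Rightarrow> (nat \<Rightarrow> real \<times> real) \<Rightarrow> bool list) g.
        (\<forall>i\<in>{1..m}. Y i \<in> PiM {1..n div m} (\<lambda>_. borel) \<rightarrow>\<^sub>M count_space UNIV) \<and>
        (\<forall>f\<in>F. \<forall>i\<in>{1..m}.
           (\<integral>\<^sup>+ \<omega>. ennreal (real (length (Y i (\<omega> i)))) \<partial>data_law \<sigma> n m f) \<le> ennreal (B i)) \<and>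
        (\<forall>y. g y \<in> L2_unit) \<and>
        fhat = (\<lambda>\<omega>. g (\<lambda>i\<in>{1..m}. Y i (\<omega> i)))}"

definition minimax_risk :: "real \<Rightarrow> nat \<Rightarrow> nat \<Rightarrow> (nat \<Rightarrow> real) \<Rightarrow> (real \<Rightarrow> real) set \<Rightarrow> ennreal" where
  "minimax_risk \<sigma> n m B F =
     (INF fhat\<in>dist_estimators \<sigma> n m B F.
        SUP f\<in>F. \<integral>\<^sup>+ \<omega>. sup_norm (\<lambda>x. fhat \<omega> x - f x) \<partial>data_law \<sigma> n m f)"

text \<open>The right-hand side is nonincreasing in \<open>\<delta>\<close>, so there is exactly one positive solution. Positivity is
  required because \<open>\<delta> = 0\<close> is a spurious solution under the convention \<open>x / 0 = 0\<close>.\<close>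

definition delta_solution :: "real \<Rightarrow> nat \<Rightarrow> nat \<Rightarrow> (nat \<Rightarrow> real) \<Rightarrow> real \<Rightarrow> bool" where
  "delta_solution s n m B \<delta> \<longleftrightarrow> \<delta> > 0 \<and>
     \<delta> = min (real m / (real n * log 2 (real n)))
             (real m / (real n *
                (\<Sum>i=1..m. min (log 2 (real n) * \<delta> powr (1 / (1 + 2 * s)) * B i) 1)))"

end

theory Submission
  imports Defs "HOL-Real_Asymp.Real_Asymp"
begin

text \<open>The hypotheses are \<open>Q \<approx> 2\<^sup>j \<approx> \<Delta>\<close> to the power \<open>- 1 / (1 + 2 s)\<close> multiples of interior wavelets of
  one level \<open>j\<close> with disjoint supports, where \<open>\<Delta>\<close> is \<open>ln n / n\<close> or \<open>\<delta>\<close>; their sup-norm distance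
  is of the order \<open>\<Delta>\<close> to the power \<open>s / (1 + 2 s)\<close>. A second moment
  bound replaces Fano's inequality: it suffices that, for at least half of the hypotheses, the product over the
  machines of \<open>1 + \<chi>\<^sup>2\<close> (message law under the hypothesis against message law under \<open>f = 0\<close>) is at
  most \<open>Q / 32\<close>. For \<open>\<Delta> = ln n / n\<close> this follows from the \<open>\<chi>\<^sup>2\<close> divergence of the full data. For
  \<open>\<Delta> = \<delta>\<close> the divergences of one machine are summed over the hypotheses. Given the design, the
  likelihood ratios, truncated at \<open>e\<close>, are Lipschitz functions of the Gaussian noise, so their linear
  combinations are sub-Gaussian. A string \<open>z\<close> of probability \<open>p\<close> can then contribute only
  \<open>p ln (1 / p)\<close>, hence the sum over the strings is bounded by an entropy, and so by
  \<open>ln n\<close> times the expected length. Markov's inequality selects the hypotheses.\<close>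

section \<open>Exponential moments of Lipschitz functions of Gaussian noise\<close>

text \<open>The equation for \<open>\<delta>\<close> is an information balance. For bumps of squared
  norm of order \<open>\<delta>\<close>, a machine with d = n/m points that sends everything has
  chi-square information of order D = d * \<open>\<delta>\<close> about each of the Q hypotheses, Q
  * D in total, while a message of expected length B supports only about D * B * log n in total. As
  1/Q is about \<open>\<delta>\<close> to the power 1/(1+2s), machine i contributes at most of order
  Q * D times its summand in the equation, and the second argument of the minimum says that D times
  the sum of these summands is at most 1. The first argument gives D \<le> 1/log n, so that the
  truncation error, of order exp(- const/D), is at most 1/n. Truncation is forced because a
  likelihood ratio is log-normal given the design and has no exponential moment. The random design
  adds a second obstacle: a bump may catch too many points. This is improbable once the mean number
  of points per bump dominates log n, which the upper bound on m supplies. Disjoint supports remove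
  the cross terms, so that all hypotheses share one sub-Gaussian constant that does not grow with
  Q.\<close>

definition gauss :: "real measure" where
  "gauss = density lborel std_normal_density"

lemma sets_gauss [measurable_cong, simp]: "sets gauss = sets borel"
  by (simp add: gauss_def)

lemma space_gauss [simp]: "space gauss = UNIV"
  by (simp add: gauss_def)

lemma prob_space_gauss: "prob_space gauss"
  unfolding gauss_def by (rule prob_space_normal_density) simp

text \<open>One-dimensional Cameron-Martin formula. With \<open>f = 1\<close> it yields the Gaussian
  exponential moments, and with \<open>a = f t / \<sigma>\<close> the likelihood ratio of one
  observation.\<close>

lemma nn_integral_gauss_shift:
  assumes [measurable]: "f \<in> borel_measurable borel"
  shows "(\<integral>\<^sup>+e. f (e + a) \<partial>gauss) = (\<integral>\<^sup>+e. ennreal (exp (a * e - a\<^sup>2 / 2)) * f e \<partial>gauss)"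
proof -
  have *: "std_normal_density (e - a) = std_normal_density e * exp (a * e - a\<^sup>2 / 2)" for e
    by (simp add: std_normal_density_def exp_add[symmetric] power2_eq_square field_simps)
  have "(\<integral>\<^sup>+e. f (e + a) \<partial>gauss) = (\<integral>\<^sup>+e. std_normal_density e * f (e + a) \<partial>lborel)"
    unfolding gauss_def by (subst nn_integral_density) auto
  also have "\<dots> = (\<integral>\<^sup>+e. std_normal_density (e - a) * f e \<partial>lborel)"
    by (subst nn_integral_real_affine[where t = "- a" and c = 1]) (auto simp: algebra_simps)
  also have "\<dots> = (\<integral>\<^sup>+e. std_normal_density e * (ennreal (exp (a * e - a\<^sup>2 / 2)) * f e) \<partial>lborel)"
    by (simp add: * ennreal_mult mult.assoc)
  also have "\<dots> = (\<integral>\<^sup>+e. ennreal (exp (a * e - a\<^sup>2 / 2)) * f e \<partial>gauss)"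
    unfolding gauss_def by (subst nn_integral_density) auto
  finally show ?thesis .
qed

lemma nn_integral_gauss_exp: "(\<integral>\<^sup>+e. ennreal (exp (c * e)) \<partial>gauss) = ennreal (exp (c\<^sup>2 / 2))"
proof -
  interpret prob_space gauss by (rule prob_space_gauss)
  have "(\<integral>\<^sup>+e. ennreal (exp (c * e)) \<partial>gauss)
      = (\<integral>\<^sup>+e. ennreal (exp (c\<^sup>2 / 2)) * (ennreal (exp (c * e - c\<^sup>2 / 2)) * 1) \<partial>gauss)"
    by (simp add: ennreal_mult[symmetric] exp_add[symmetric])
  also have "\<dots> = ennreal (exp (c\<^sup>2 / 2)) * (\<integral>\<^sup>+e. ennreal (exp (c * e - c\<^sup>2 / 2)) * 1 \<partial>gauss)"
    by (rule nn_integral_cmult) measurable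
  also have "(\<integral>\<^sup>+e. ennreal (exp (c * e - c\<^sup>2 / 2)) * 1 \<partial>gauss) = 1"
    by (subst nn_integral_gauss_shift[symmetric]) (auto simp: emeasure_space_1[simplified])
  finally show ?thesis by simp
qed

lemma has_bochner_integral_gauss_exp:
  "has_bochner_integral gauss (\<lambda>e. exp (c * e)) (exp (c\<^sup>2 / 2))"
  by (rule has_bochner_integral_nn_integral) (auto simp: nn_integral_gauss_exp)

text \<open>Symmetrisation with an independent copy: \<open>F x - F y\<close> is dominated by
  \<open>c * (x - y)\<close>, and \<open>cosh (c * (x - y))\<close> has mean
  \<open>exp (c\<^sup>2)\<close> because \<open>x - y\<close> has variance 2. Jensen's inequality
  turns the resulting bound on \<open>p * q\<close> into one on \<open>p\<close>. The sharp exponent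
  would be \<open>c\<^sup>2 / 2\<close>; the lost factor only affects constants.\<close>

lemma lipschitz_exp_gauss:
  fixes F :: "real \<Rightarrow> real"
  assumes [measurable]: "F \<in> borel_measurable borel" and bd: "\<And>x. \<bar>F x\<bar> \<le> b"
    and lip: "\<And>x y. \<bar>F x - F y\<bar> \<le> c * \<bar>x - y\<bar>"
  shows "(\<integral>x. exp (F x) \<partial>gauss) \<le> exp ((\<integral>x. F x \<partial>gauss) + c\<^sup>2)"
proof -
  interpret prob_space gauss by (rule prob_space_gauss)
  have int_exp: "integrable gauss (\<lambda>x. exp (c * x))" for c
    using has_bochner_integral_gauss_exp by (auto simp: has_bochner_integral_iff)
  have int_exp': "(\<integral>x. exp (c * x) \<partial>gauss) = exp (c\<^sup>2 / 2)" for c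
    using has_bochner_integral_gauss_exp by (auto simp: has_bochner_integral_iff)
  have iF: "integrable gauss F"
    by (rule integrable_const_bound[where B = b]) (auto simp: bd)
  have ub: "F x \<le> b" "- F x \<le> b" for x using bd[of x] by auto
  have iE: "integrable gauss (\<lambda>x. exp (F x))"
    by (rule integrable_const_bound[where B = "exp b"]) (auto simp: ub)
  have iE': "integrable gauss (\<lambda>x. exp (- F x))"
    by (rule integrable_const_bound[where B = "exp b"]) (auto simp: ub)
  define p where "p = (\<integral>x. exp (F x) \<partial>gauss)"
  define q where "q = (\<integral>x. exp (- F x) \<partial>gauss)"
  define u where "u = (\<integral>x. F x \<partial>gauss)"
  \<comment> \<open>Twice the comparison of the two \<open>cosh\<close> values, written as products
    so that \<open>x\<close> and \<open>y\<close> integrate separately.\<close>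
  have pt: "exp (F x) * exp (- F y) + exp (- F x) * exp (F y)
      \<le> exp (c * x) * exp (- c * y) + exp (- c * x) * exp (c * y)" for x y
  proof -
    have "cosh (F x - F y) \<le> cosh (c * (x - y))"
    proof -
      have "cosh \<bar>F x - F y\<bar> \<le> cosh \<bar>c * (x - y)\<bar>"
      proof (subst cosh_real_nonneg_le_iff)
        have "c * \<bar>x - y\<bar> \<le> \<bar>c * (x - y)\<bar>" by (simp add: abs_mult mult_right_mono)
        with lip[of x y] show "\<bar>F x - F y\<bar> \<le> \<bar>c * (x - y)\<bar>" by linarith
      qed auto
      then show ?thesis by simp
    qed
    then show ?thesis
      unfolding cosh_def exp_add[symmetric] by (simp add: algebra_simps)
  qed
  have 1: "exp (F x) * q + exp (- F x) * p \<le> exp (c * x) * exp (c\<^sup>2 / 2) + exp (- c * x) * exp (c\<^sup>2 / 2)" for x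
  proof -
    have "(\<integral>y. exp (F x) * exp (- F y) + exp (- F x) * exp (F y) \<partial>gauss)
      \<le> (\<integral>y. exp (c * x) * exp (- c * y) + exp (- c * x) * exp (c * y) \<partial>gauss)"
      by (rule integral_mono) (use pt iE iE' int_exp[of c] int_exp[of "- c"] in auto)
    then show ?thesis
      using iE iE' int_exp[of c] int_exp[of "- c"] int_exp'[of c] int_exp'[of "- c"]
      by (simp add: p_def q_def)
  qed
  have "(\<integral>x. exp (F x) * q + exp (- F x) * p \<partial>gauss)
     \<le> (\<integral>x. exp (c * x) * exp (c\<^sup>2 / 2) + exp (- c * x) * exp (c\<^sup>2 / 2) \<partial>gauss)"
    by (rule integral_mono) (use 1 iE iE' int_exp[of c] int_exp[of "- c"] in auto)
  then have "p * q + q * p \<le> exp (c\<^sup>2 / 2) * exp (c\<^sup>2 / 2) + exp (c\<^sup>2 / 2) * exp (c\<^sup>2 / 2)"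
    using iE iE' int_exp[of c] int_exp[of "- c"] int_exp'[of c] int_exp'[of "- c"]
    by (simp add: p_def q_def)
  then have pq: "p * q \<le> exp (c\<^sup>2)" by (simp add: exp_add[symmetric] mult.commute)
  \<comment> \<open>Jensen: the tangent of \<open>exp\<close> at \<open>- u\<close> lies below
    \<open>exp (- F x)\<close>, and \<open>u - F x\<close> has mean zero.\<close>
  have "(\<integral>x. exp (- u) * (1 + (u - F x)) \<partial>gauss) \<le> q"
    unfolding q_def
  proof (rule integral_mono)
    fix x
    have "exp (- u) * (1 + (u - F x)) \<le> exp (- u) * exp (u - F x)"
      by (intro mult_left_mono exp_ge_add_one_self) auto
    then show "exp (- u) * (1 + (u - F x)) \<le> exp (- F x)" by (simp add: exp_add[symmetric])
  qed (use iF iE' in auto)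
  then have q: "exp (- u) \<le> q" using iF by (simp add: u_def prob_space[simplified])
  have "p \<ge> 0" unfolding p_def by simp
  then have "p * exp (- u) \<le> exp (c\<^sup>2)" using pq mult_left_mono[OF q] by (meson order_trans)
  then have "p * exp (- u) * exp u \<le> exp (c\<^sup>2) * exp u" by (rule mult_right_mono) simp
  then show ?thesis
    by (simp add: p_def u_def mult.assoc exp_add[symmetric] add.commute)
qed

lemma product_sigma_finite_gauss: "product_sigma_finite (\<lambda>_. gauss)"
  by (intro product_sigma_finite.intro prob_space_imp_sigma_finite prob_space_gauss)

text \<open>Tensorisation by induction on the coordinates: the one-dimensional bound integrates out
  \<open>i\<close> at the cost \<open>(c i)\<^sup>2\<close>, and the conditional mean
  \<open>H\<close> inherits the bound \<open>b\<close> and the constants of the other coordinates.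
  The conditions are confined to \<open>extensional I\<close>, the space of the product
  measure.\<close>

lemma lipschitz_exp_gauss_PiM:
  fixes F :: "('i \<Rightarrow> real) \<Rightarrow> real"
  assumes "finite I" and "F \<in> borel_measurable (PiM I (\<lambda>_. gauss))"
    and "\<And>x. x \<in> extensional I \<Longrightarrow> \<bar>F x\<bar> \<le> b"
    and "\<And>x i r t. x \<in> extensional I \<Longrightarrow> i \<in> I \<Longrightarrow> \<bar>F (x(i := r)) - F (x(i := t))\<bar> \<le> c i * \<bar>r - t\<bar>"
  shows "(\<integral>x. exp (F x) \<partial>PiM I (\<lambda>_. gauss))
    \<le> exp ((\<integral>x. F x \<partial>PiM I (\<lambda>_. gauss)) + (\<Sum>i\<in>I. (c i)\<^sup>2))"
  using assms
proof (induction I arbitrary: F rule: finite_induct)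
  case empty
  show ?case by (simp add: PiM_empty lebesgue_integral_count_space_finite)
next
  case (insert i I)
  note [measurable] = insert.prems(1)
  interpret g: prob_space gauss by (rule prob_space_gauss)
  interpret product_sigma_finite "\<lambda>_. gauss" by (rule product_sigma_finite_gauss)
  let ?P = "PiM I (\<lambda>_. gauss)"
  interpret P: prob_space ?P
    by (rule prob_space_PiM) (rule prob_space_gauss)
  interpret P': prob_space "PiM (insert i I) (\<lambda>_. gauss)"
    by (rule prob_space_PiM) (rule prob_space_gauss)
  have sp: "space ?P = extensional I" by (simp add: space_PiM PiE_def)
  have sp': "space (PiM (insert i I) (\<lambda>_. gauss)) = extensional (insert i I)"
    by (simp add: space_PiM PiE_def)
  have upd: "x(i := y) \<in> extensional (insert i I)" if "x \<in> extensional I" for x y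
    using that by (auto simp: extensional_def)
  have ub: "F x \<le> b" if "x \<in> extensional (insert i I)" for x
    using insert.prems(2)[OF that] by auto
  have m1 [measurable]: "(\<lambda>(x, y). F (x(i := y))) \<in> borel_measurable (?P \<Otimes>\<^sub>M gauss)"
    by measurable
  have m2 [measurable]: "(\<lambda>y. F (x(i := y))) \<in> borel_measurable gauss" if "x \<in> extensional I" for x
    using measurable_compose[OF measurable_Pair1'[of x ?P gauss] m1] that sp by simp
  have i2: "integrable gauss (\<lambda>y. F (x(i := y)))" if "x \<in> extensional I" for x
    by (rule g.integrable_const_bound[where B = b]) (use that insert.prems(2) upd in \<open>auto intro!: AE_I2\<close>)
  define H where "H x = (\<integral>y. F (x(i := y)) \<partial>gauss)" for x
  have mH [measurable]: "H \<in> borel_measurable ?P"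
    unfolding H_def by (rule g.borel_measurable_lebesgue_integral) (use m1 in simp)
  have H_bound: "\<bar>H x\<bar> \<le> b" if "x \<in> extensional I" for x
  proof -
    have "\<bar>H x\<bar> \<le> (\<integral>y. \<bar>F (x(i := y))\<bar> \<partial>gauss)"
      unfolding H_def by (rule integral_abs_bound)
    also have "\<dots> \<le> (\<integral>y. b \<partial>gauss)"
      by (rule integral_mono) (use i2[OF that] that upd insert.prems(2) in auto)
    finally show ?thesis by (simp add: g.prob_space[simplified])
  qed
  have H_lip: "\<bar>H (x(k := r)) - H (x(k := t))\<bar> \<le> c k * \<bar>r - t\<bar>"
    if x: "x \<in> extensional I" and k: "k \<in> I" for x k r t
  proof -
    have e: "x(k := r) \<in> extensional I" for r using x k by (auto simp: extensional_def)
    have ne: "i \<noteq> k" using insert.hyps(2) k by auto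
    have "\<bar>H (x(k := r)) - H (x(k := t))\<bar> = \<bar>\<integral>y. F (x(k := r, i := y)) - F (x(k := t, i := y)) \<partial>gauss\<bar>"
      unfolding H_def by (subst Bochner_Integration.integral_diff) (use i2[OF e] in auto)
    also have "\<dots> \<le> (\<integral>y. \<bar>F (x(k := r, i := y)) - F (x(k := t, i := y))\<bar> \<partial>gauss)"
      by (rule integral_abs_bound)
    also have "\<dots> \<le> (\<integral>y. c k * \<bar>r - t\<bar> \<partial>gauss)"
    proof (rule integral_mono)
      fix y
      show "\<bar>F (x(k := r, i := y)) - F (x(k := t, i := y))\<bar> \<le> c k * \<bar>r - t\<bar>"
        unfolding fun_upd_twist[OF ne[symmetric]]
          using insert.prems(3)[OF upd[OF x, of y], of k r t] k by blast
    qed (use i2[OF e] in auto)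
    finally show ?thesis by (simp add: g.prob_space[simplified])
  qed
  have iF: "integrable (PiM (insert i I) (\<lambda>_. gauss)) F"
    by (rule P'.integrable_const_bound[where B = b]) (use insert.prems(2) in \<open>auto simp: sp' intro!: AE_I2\<close>)
  have iE: "integrable (PiM (insert i I) (\<lambda>_. gauss)) (\<lambda>x. exp (F x))"
    by (rule P'.integrable_const_bound[where B = "exp b"]) (use ub in \<open>auto simp: sp' intro!: AE_I2\<close>)
  have iH: "integrable ?P (\<lambda>x. exp (H x))"
    by (rule P.integrable_const_bound[where B = "exp b"]) (use H_bound in \<open>auto simp: sp abs_le_iff intro!: AE_I2\<close>)
  have "(\<integral>x. exp (F x) \<partial>PiM (insert i I) (\<lambda>_. gauss)) = (\<integral>x. (\<integral>y. exp (F (x(i := y))) \<partial>gauss) \<partial>?P)"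
    by (rule product_integral_insert[OF insert.hyps iE])
  also have "\<dots> \<le> (\<integral>x. exp ((c i)\<^sup>2) * exp (H x) \<partial>?P)"
  proof (rule integral_mono_AE')
    show "AE x in ?P. (\<integral>y. exp (F (x(i := y))) \<partial>gauss) \<le> exp ((c i)\<^sup>2) * exp (H x)"
    proof (rule AE_I2)
      fix x assume "x \<in> space ?P"
      then have x: "x \<in> extensional I" by (simp add: sp)
      have "(\<integral>y. exp (F (x(i := y))) \<partial>gauss) \<le> exp (H x + (c i)\<^sup>2)"
        unfolding H_def
      proof (rule lipschitz_exp_gauss)
        show "(\<lambda>y. F (x(i := y))) \<in> borel_measurable borel" using m2[OF x] by simp
        show "\<bar>F (x(i := y))\<bar> \<le> b" for y using insert.prems(2) upd x by auto
        show "\<bar>F (x(i := y)) - F (x(i := z))\<bar> \<le> c i * \<bar>y - z\<bar>" for y z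
          using insert.prems(3)[OF upd[OF x, of y] insertI1, of y z, unfolded fun_upd_upd] .
      qed
      then show "(\<integral>y. exp (F (x(i := y))) \<partial>gauss) \<le> exp ((c i)\<^sup>2) * exp (H x)"
        by (simp add: exp_add mult.commute)
    qed
  qed (use iH in auto)
  also have "\<dots> = exp ((c i)\<^sup>2) * (\<integral>x. exp (H x) \<partial>?P)" by simp
  also have "\<dots> \<le> exp ((c i)\<^sup>2) * exp ((\<integral>x. H x \<partial>?P) + (\<Sum>i\<in>I. (c i)\<^sup>2))"
    by (intro mult_left_mono insert.IH mH H_bound H_lip) auto
  also have "(\<integral>x. H x \<partial>?P) = (\<integral>x. F x \<partial>PiM (insert i I) (\<lambda>_. gauss))"
    unfolding H_def by (rule product_integral_insert[OF insert.hyps iF, symmetric])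
  finally show ?case using insert.hyps by (simp add: exp_add[symmetric] algebra_simps)
qed

section \<open>The chi-square information in a binary message\<close>

text \<open>Tonelli with the counting measure: for fixed \<open>x\<close> only
  \<open>z = Y x\<close> contributes. Countability of the values makes the integrand jointly
  measurable.\<close>

lemma nn_integral_count_space_fibres:
  fixes Y :: "'a \<Rightarrow> 'b :: countable" and c :: "'b \<Rightarrow> ennreal"
  assumes "sigma_finite_measure M" and [measurable]: "Y \<in> M \<rightarrow>\<^sub>M count_space UNIV"
    and [measurable]: "h \<in> borel_measurable M"
  shows "(\<integral>\<^sup>+z. c z * (\<integral>\<^sup>+x. h x * indicator (Y -` {z}) x \<partial>M) \<partial>count_space UNIV)
    = (\<integral>\<^sup>+x. c (Y x) * h x \<partial>M)"
proof -
  interpret M: sigma_finite_measure M by fact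
  interpret C: sigma_finite_measure "count_space (UNIV :: 'b set)"
    by (rule sigma_finite_measure_count_space)
  interpret pair_sigma_finite "count_space (UNIV :: 'b set)" M ..
  have m1: "(\<lambda>x. c z * (h x * indicator (Y -` {z}) x)) \<in> borel_measurable M" for z
  proof -
    have "(\<lambda>x. c z * (h x * indicator {z} (Y x))) \<in> borel_measurable M" by measurable
    then show ?thesis by (simp add: indicator_def vimage_def)
  qed
  have m: "(\<lambda>(z, x). c z * (h x * indicator (Y -` {z}) x)) \<in> borel_measurable (count_space UNIV \<Otimes>\<^sub>M M)"
    by (rule measurable_pair_measure_countable1) (use m1 in auto)
  have "(\<integral>\<^sup>+z. c z * (\<integral>\<^sup>+x. h x * indicator (Y -` {z}) x \<partial>M) \<partial>count_space UNIV)
      = (\<integral>\<^sup>+z. (\<integral>\<^sup>+x. c z * (h x * indicator (Y -` {z}) x) \<partial>M) \<partial>count_space UNIV)"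
  proof (intro nn_integral_cong nn_integral_cmult[symmetric])
    fix z :: 'b
    have "(\<lambda>x. h x * indicator {z} (Y x)) \<in> borel_measurable M" by measurable
    then show "(\<lambda>x. h x * indicator (Y -` {z}) x) \<in> borel_measurable M"
      by (simp add: indicator_def vimage_def)
  qed
  also have "\<dots> = (\<integral>\<^sup>+x. (\<integral>\<^sup>+z. c z * (h x * indicator (Y -` {z}) x) \<partial>count_space UNIV) \<partial>M)"
    using Fubini[OF m] by simp
  also have "\<dots> = (\<integral>\<^sup>+x. (\<integral>\<^sup>+z. (c (Y x) * h x) * indicator {Y x} z \<partial>count_space UNIV) \<partial>M)"
    by (intro nn_integral_cong) (auto simp: indicator_def vimage_def)
  also have "\<dots> = (\<integral>\<^sup>+x. c (Y x) * h x \<partial>M)"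
    by (subst nn_integral_cmult_indicator) auto
  finally show ?thesis .
qed

text \<open>There are \<open>2 ^ l\<close> strings of length \<open>l\<close>, so this length
  carries mass \<open>2 ^ l / 4 ^ l\<close>, and the geometric series from 1 sums to 1. Up to the
  factor \<open>1 / \<nu>\<close> these are the weights of the nonempty strings in the entropy
  bound.\<close>

lemma nn_integral_binary_strings:
  "(\<integral>\<^sup>+z. ennreal (if z = [] then 0 else (1 / 4) ^ length z) \<partial>count_space (UNIV :: bool list set)) = 1"
proof -
  let ?c = "\<lambda>l::nat. ennreal (if l = 0 then 0 else (1 / 4) ^ l)"
  have "(\<integral>\<^sup>+z. ennreal (if z = [] then 0 else (1 / 4) ^ length z) \<partial>count_space (UNIV :: bool list set))
      = (\<integral>\<^sup>+z. ?c (length z) * 1 \<partial>count_space (UNIV :: bool list set))"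
    by (intro nn_integral_cong) auto
  also have "\<dots> = (\<integral>\<^sup>+l. ?c l * (\<integral>\<^sup>+z. 1 * indicator (length -` {l}) z \<partial>count_space (UNIV :: bool list set)) \<partial>count_space UNIV)"
    by (rule nn_integral_count_space_fibres[symmetric]) (auto intro: sigma_finite_measure_count_space)
  also have "\<dots> = (\<integral>\<^sup>+l. ennreal (if l = 0 then 0 else (1 / 2) ^ l) \<partial>count_space UNIV)"
  proof (rule nn_integral_cong)
    fix l :: nat
    have "length -` {l} = {xs. set xs \<subseteq> (UNIV :: bool set) \<and> length xs = l}" by auto
    then have "card (length -` {l} :: bool list set) = 2 ^ l" "finite (length -` {l} :: bool list set)"
      using card_lists_length_eq[of "UNIV :: bool set" l] finite_lists_length_eq[of "UNIV :: bool set" l]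
      by simp_all
    then have "(\<integral>\<^sup>+z. 1 * indicator (length -` {l}) z \<partial>count_space (UNIV :: bool list set)) = ennreal (2 ^ l)"
      by (simp add: emeasure_count_space_finite ennreal_of_nat_eq_real_of_nat)
    then show "?c l * (\<integral>\<^sup>+z. 1 * indicator (length -` {l}) z \<partial>count_space (UNIV :: bool list set))
      = ennreal (if l = 0 then 0 else (1 / 2) ^ l)"
      by (auto simp: ennreal_mult[symmetric] power_mult_distrib[symmetric])
  qed
  also have "\<dots> = (\<Sum>l. ennreal (if l = 0 then 0 else (1 / 2) ^ l))"
    by (rule nn_integral_count_space_nat)
  also have "\<dots> = 1"
  proof -
    have "(\<lambda>l. if Suc l = 0 then 0 else (1 / 2) ^ Suc l :: real) sums 1"
      using power_half_series by simp
    then have "(\<lambda>l. if l = 0 then 0 else (1 / 2) ^ l :: real) sums 1"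
      using sums_Suc_iff[of "\<lambda>l. if l = 0 then 0 else (1 / 2) ^ l :: real" 1] by simp
    then show ?thesis
      by (subst suminf_ennreal2) (auto simp: sums_iff)
  qed
  finally show ?thesis .
qed

context prob_space
begin

text \<open>The integral over \<open>E\<close> of \<open>(R - t)\<^sup>2\<close>, with
  \<open>t\<close> the mean of \<open>R\<close> on \<open>E\<close>, is nonnegative. A null event is
  covered by \<open>x / 0 = 0\<close>.\<close>

lemma cauchy_schwarz_event:
  assumes E [measurable]: "E \<in> events" and [measurable]: "R \<in> borel_measurable M"
    and iR: "integrable M (\<lambda>x. (R x)\<^sup>2)"
  shows "(\<integral>x. R x * indicator E x \<partial>M)\<^sup>2 / prob E \<le> (\<integral>x. (R x)\<^sup>2 * indicator E x \<partial>M)"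
proof (cases "prob E = 0")
  case False
  have iR1: "integrable M R" by (rule square_integrable_imp_integrable) (use iR in auto)
  define D where "D = (\<integral>x. R x * indicator E x \<partial>M)"
  define t where "t = D / prob E"
  have i1: "integrable M (\<lambda>x. R x * indicator E x)"
    using iR1 E by (rule integrable_real_mult_indicator[rotated])
  have i2: "integrable M (\<lambda>x. (R x)\<^sup>2 * indicator E x)"
    using iR E by (rule integrable_real_mult_indicator[rotated])
  have "0 \<le> (\<integral>x. (R x - t)\<^sup>2 * indicator E x \<partial>M)" by simp
  also have "\<dots> = (\<integral>x. (R x)\<^sup>2 * indicator E x - 2 * t * (R x * indicator E x) + t\<^sup>2 * indicator E x \<partial>M)"
    by (intro Bochner_Integration.integral_cong) (auto simp: power2_eq_square algebra_simps)
  also have "\<dots> = (\<integral>x. (R x)\<^sup>2 * indicator E x \<partial>M) - 2 * t * D + t\<^sup>2 * prob E"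
    using i1 i2 by (simp add: D_def integrable_real_indicator less_top[symmetric])
  finally show ?thesis
    using False unfolding D_def[symmetric] by (simp add: t_def power2_eq_square)
qed simp

text \<open>A Gibbs-type inequality: a joint sub-Gaussian bound with constant \<open>A\<close>
  limits how far conditioning on \<open>E\<close> can move all the means at once. The choice
  \<open>q = prob E\<close> would give \<open>4 * A * prob E * ln (1 / prob E)\<close>;
  \<open>q\<close> is left free because it is later replaced by explicit weights whose sum over the
  strings is under control.\<close>

lemma entropic_event_bound:
  fixes U :: "'k \<Rightarrow> 'a \<Rightarrow> real"
  assumes E [measurable]: "E \<in> events" and fin: "finite S" and "A > 0" "q > 0"
    and iU: "\<And>k. k \<in> S \<Longrightarrow> integrable M (U k)"
    and imgf: "\<And>c. integrable M (\<lambda>x. exp (\<Sum>k\<in>S. c k * U k x))"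
    and mgf: "\<And>c. (\<integral>x. exp (\<Sum>k\<in>S. c k * U k x) \<partial>M) \<le> exp (A * (\<Sum>k\<in>S. (c k)\<^sup>2))"
  shows "(\<Sum>k\<in>S. (\<integral>x. U k x * indicator E x \<partial>M)\<^sup>2 / prob E) \<le> 4 * A * (q - prob E + prob E * ln (1 / q))"
proof (cases "prob E = 0")
  case True
  then show ?thesis using assms(3,4) by simp
next
  case False
  define p where "p = prob E"
  have p: "p > 0" using False by (simp add: p_def zero_less_measure_iff)
  define D where "D k = (\<integral>x. U k x * indicator E x \<partial>M)" for k
  define a where "a k = D k / p" for k
  define T where "T = (\<Sum>k\<in>S. (a k)\<^sup>2)"
  have iUE: "integrable M (\<lambda>x. U k x * indicator E x)" if "k \<in> S" for k
    using iU[OF that] E by (rule integrable_real_mult_indicator[rotated])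
  \<comment> \<open>The coefficients \<open>a k / (2 * A)\<close> maximise the gain
    \<open>c k * a k\<close> minus the price \<open>A * (c k)\<^sup>2\<close>. The constant
    \<open>C\<close> is chosen so that \<open>exp C\<close> times the moment bound is exactly
    \<open>q\<close>.\<close>
  let ?x = "\<lambda>x. (\<Sum>k\<in>S. a k / (2 * A) * U k x)"
  define C where "C = - T / (4 * A) + ln q"
  have "(\<integral>x. indicator E x * (1 + C) + (\<Sum>k\<in>S. a k / (2 * A) * (U k x * indicator E x)) \<partial>M)
     \<le> (\<integral>x. exp C * exp (?x x) \<partial>M)"
  proof (rule integral_mono)
    show "integrable M (\<lambda>x. exp C * exp (?x x))"
      using imgf[of "\<lambda>k. a k / (2 * A)"] by (rule integrable_mult_right)
    show "integrable M (\<lambda>x. indicator E x * (1 + C) + (\<Sum>k\<in>S. a k / (2 * A) * (U k x * indicator E x)))"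
      using iUE E by (intro Bochner_Integration.integrable_add Bochner_Integration.integrable_sum
          integrable_mult_left integrable_mult_right integrable_real_indicator) (auto simp: less_top[symmetric])
    fix x
    have "indicator E x * (1 + C) + (\<Sum>k\<in>S. a k / (2 * A) * (U k x * indicator E x))
       = indicator E x * (1 + (C + ?x x))"
      by (auto simp: indicator_def)
    also have "\<dots> \<le> exp (C + ?x x)"
      using exp_ge_add_one_self[of "C + ?x x"] by (auto simp: indicator_def)
    finally show "indicator E x * (1 + C) + (\<Sum>k\<in>S. a k / (2 * A) * (U k x * indicator E x))
      \<le> exp C * exp (?x x)" by (simp add: exp_add)
  qed
  also have "\<dots> \<le> exp C * exp (A * (\<Sum>k\<in>S. (a k / (2 * A))\<^sup>2))"
    using mgf[of "\<lambda>k. a k / (2 * A)"] by simp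
  also have "A * (\<Sum>k\<in>S. (a k / (2 * A))\<^sup>2) = T / (4 * A)"
    using \<open>A > 0\<close> by (simp add: T_def power_divide sum_divide_distrib[symmetric] power2_eq_square field_simps)
  also have "exp C * exp (T / (4 * A)) = q"
    using \<open>q > 0\<close> by (simp add: C_def exp_add exp_diff exp_minus field_simps)
  also have "(\<integral>x. indicator E x * (1 + C) + (\<Sum>k\<in>S. a k / (2 * A) * (U k x * indicator E x)) \<partial>M)
     = p * (1 + C) + (\<Sum>k\<in>S. a k / (2 * A) * D k)"
  proof -
    have "integrable M (indicator E :: 'a \<Rightarrow> real)"
      by (simp add: integrable_real_indicator less_top[symmetric])
    then show ?thesis
      using iUE by (subst Bochner_Integration.integral_add) (auto simp: p_def D_def)
  qed
  also have "(\<Sum>k\<in>S. a k / (2 * A) * D k) = p * T / (2 * A)"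
  proof -
    have "a k / (2 * A) * D k = p / (2 * A) * (a k)\<^sup>2" for k
      using p by (simp add: a_def power2_eq_square)
    then have "(\<Sum>k\<in>S. a k / (2 * A) * D k) = p / (2 * A) * T"
      unfolding T_def sum_distrib_left by (rule sum.cong[OF refl])
    then show ?thesis by simp
  qed
  finally have "p * T / (4 * A) \<le> q - p - p * ln q"
    by (simp add: C_def algebra_simps) 
  then have "p * T \<le> 4 * A * (q - p - p * ln q)"
    using \<open>A > 0\<close> by (simp add: pos_divide_le_eq mult.commute)
  moreover have "p * T = (\<Sum>k\<in>S. (D k)\<^sup>2 / p)"
    using p by (simp add: T_def a_def sum_distrib_left power2_eq_square)
  ultimately show ?thesis using \<open>q > 0\<close> by (simp add: D_def p_def ln_div)
qed

end

text \<open>If the fibre of \<open>z\<close> is a null set, then the numerator vanishes and \<open>0 / 0 = 0\<close> is the right value.\<close>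

definition chi_term :: "'a measure \<Rightarrow> ('a \<Rightarrow> 'b) \<Rightarrow> ('a \<Rightarrow> real) \<Rightarrow> 'b \<Rightarrow> real" where
  "chi_term M Y X z =
     (\<integral>x. X x * indicator (Y -` {z} \<inter> space M) x \<partial>M)\<^sup>2 / measure M (Y -` {z} \<inter> space M)"

definition chi :: "'a measure \<Rightarrow> ('a \<Rightarrow> 'b) \<Rightarrow> ('a \<Rightarrow> real) \<Rightarrow> ennreal" where
  "chi M Y X = (\<integral>\<^sup>+z. ennreal (chi_term M Y X z) \<partial>count_space UNIV)"

context prob_space
begin

lemma nn_integral_fibres:
  fixes Y :: "'a \<Rightarrow> 'b :: countable" and c :: "'b \<Rightarrow> ennreal"
  assumes [measurable]: "Y \<in> M \<rightarrow>\<^sub>M count_space UNIV" and [measurable]: "h \<in> borel_measurable M"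
  shows "(\<integral>\<^sup>+z. c z * (\<integral>\<^sup>+x. h x * indicator (Y -` {z} \<inter> space M) x \<partial>M) \<partial>count_space UNIV)
    = (\<integral>\<^sup>+x. c (Y x) * h x \<partial>M)"
proof -
  have "(\<integral>\<^sup>+x. h x * indicator (Y -` {z} \<inter> space M) x \<partial>M) = (\<integral>\<^sup>+x. h x * indicator (Y -` {z}) x \<partial>M)" for z
    by (intro nn_integral_cong) (simp add: indicator_def)
  then show ?thesis
    using nn_integral_count_space_fibres[OF sigma_finite_measure_axioms assms] by simp
qed

lemma nn_integral_fibres_prob:
  fixes Y :: "'a \<Rightarrow> 'b :: countable" and c :: "'b \<Rightarrow> ennreal"
  assumes [measurable]: "Y \<in> M \<rightarrow>\<^sub>M count_space UNIV"
  shows "(\<integral>\<^sup>+z. c z * ennreal (prob (Y -` {z} \<inter> space M)) \<partial>count_space UNIV) = (\<integral>\<^sup>+x. c (Y x) \<partial>M)"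
proof -
  have "(\<integral>\<^sup>+x. 1 * indicator (Y -` {z} \<inter> space M) x \<partial>M) = ennreal (prob (Y -` {z} \<inter> space M))" for z
    by (simp add: emeasure_eq_measure)
  then show ?thesis
    using nn_integral_fibres[OF assms, of "\<lambda>_. 1" c] by simp
qed

lemma nn_integral_fibres_square:
  fixes Y :: "'a \<Rightarrow> 'b :: countable"
  assumes Y [measurable]: "Y \<in> M \<rightarrow>\<^sub>M count_space UNIV" and [measurable]: "X \<in> borel_measurable M"
    and iX: "integrable M (\<lambda>x. (X x)\<^sup>2)"
  shows "(\<integral>\<^sup>+z. ennreal (\<integral>x. (X x)\<^sup>2 * indicator (Y -` {z} \<inter> space M) x \<partial>M) \<partial>count_space UNIV)
    = ennreal (\<integral>x. (X x)\<^sup>2 \<partial>M)"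
proof -
  have E: "Y -` {z} \<inter> space M \<in> events" for z by measurable
  have "ennreal (\<integral>x. (X x)\<^sup>2 * indicator (Y -` {z} \<inter> space M) x \<partial>M)
      = 1 * (\<integral>\<^sup>+x. ennreal ((X x)\<^sup>2) * indicator (Y -` {z} \<inter> space M) x \<partial>M)" for z
  proof -
    have "integrable M (\<lambda>x. (X x)\<^sup>2 * indicator (Y -` {z} \<inter> space M) x)"
      using iX E by (rule integrable_real_mult_indicator[rotated])
    then show ?thesis
      by (subst nn_integral_eq_integral[symmetric]) (auto intro!: nn_integral_cong simp: indicator_def)
  qed
  then have "(\<integral>\<^sup>+z. ennreal (\<integral>x. (X x)\<^sup>2 * indicator (Y -` {z} \<inter> space M) x \<partial>M) \<partial>count_space UNIV)
      = (\<integral>\<^sup>+x. 1 * ennreal ((X x)\<^sup>2) \<partial>M)"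
    using nn_integral_fibres[OF Y, of "\<lambda>x. ennreal ((X x)\<^sup>2)" "\<lambda>_. 1"] by simp
  then show ?thesis using iX by (simp add: nn_integral_eq_integral)
qed

text \<open>Data processing: a message carries at most the divergence of the full sample.
  Cauchy-Schwarz is applied on every fibre of \<open>Y\<close>, and the fibres partition the
  space.\<close>

lemma chi_le_second_moment:
  fixes Y :: "'a \<Rightarrow> 'b :: countable"
  assumes Y [measurable]: "Y \<in> M \<rightarrow>\<^sub>M count_space UNIV" and [measurable]: "X \<in> borel_measurable M"
    and iX: "integrable M (\<lambda>x. (X x)\<^sup>2)"
  shows "chi M Y X \<le> ennreal (\<integral>x. (X x)\<^sup>2 \<partial>M)"
  unfolding nn_integral_fibres_square[OF assms, symmetric] chi_def chi_term_def
  by (intro nn_integral_mono ennreal_leI cauchy_schwarz_event iX) auto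

text \<open>The part \<open>U\<close> is controlled by entropy and \<open>R\<close> by its second
  moment; \<open>(a + b)\<^sup>2 \<le> 2 * a\<^sup>2 + 2 * b\<^sup>2\<close> separates them, whence
  8 = 2 * 4 and the final factor 2. The bracket bounds the sum over the strings of
  \<open>q - p + p * ln (1 / q)\<close>: at most \<open>b\<close> from the empty string,
  \<open>1 / \<nu>\<close> from the total weight of the others, and
  \<open>(2 + ln \<nu>) * b\<close> from the expected length.\<close>

lemma sum_chi_binary_message:
  fixes Y :: "'a \<Rightarrow> bool list" and U R :: "'k \<Rightarrow> 'a \<Rightarrow> real"
  assumes Y [measurable]: "Y \<in> M \<rightarrow>\<^sub>M count_space UNIV"
    and len: "(\<integral>\<^sup>+x. ennreal (real (length (Y x))) \<partial>M) \<le> ennreal b"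
    and fin: "finite S" and A: "A > 0" and \<nu>: "\<nu> \<ge> 1" and b: "b \<ge> 0"
    and iU: "\<And>k. k \<in> S \<Longrightarrow> integrable M (U k)"
    and imgf: "\<And>c. integrable M (\<lambda>x. exp (\<Sum>k\<in>S. c k * U k x))"
    and mgf: "\<And>c. (\<integral>x. exp (\<Sum>k\<in>S. c k * U k x) \<partial>M) \<le> exp (A * (\<Sum>k\<in>S. (c k)\<^sup>2))"
    and mR: "\<And>k. k \<in> S \<Longrightarrow> R k \<in> borel_measurable M"
    and iR: "\<And>k. k \<in> S \<Longrightarrow> integrable M (\<lambda>x. (R k x)\<^sup>2)"
    and R: "\<And>k. k \<in> S \<Longrightarrow> (\<integral>x. (R k x)\<^sup>2 \<partial>M) \<le> \<epsilon>"
  shows "(\<Sum>k\<in>S. chi M Y (\<lambda>x. U k x + R k x))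
    \<le> ennreal (8 * A * ((3 + ln \<nu>) * b + 1 / \<nu>) + 2 * real (card S) * \<epsilon>)"
proof -
  let ?E = "\<lambda>z. Y -` {z} \<inter> space M"
  have E: "?E z \<in> events" for z by measurable
  define p where "p z = prob (?E z)" for z
  have p0: "p z \<ge> 0" for z by (simp add: p_def)
  \<comment> \<open>Weights of total mass at most \<open>1 + 1 / \<nu>\<close>. The weight \<open>1\<close> of the empty string keeps the bound
    linear in \<open>b\<close> for \<open>b < 1\<close>, at the price of the term \<open>ln \<nu>\<close> for the other strings.\<close>
  define q :: "bool list \<Rightarrow> real" where "q z = (if z = [] then 1 else (1 / 4) ^ length z / \<nu>)" for z
  have q0: "q z > 0" for z using \<nu> by (simp add: q_def)
  define v where "v z = (\<Sum>k\<in>S. \<integral>x. (R k x)\<^sup>2 * indicator (?E z) x \<partial>M)" for z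
  have v0: "v z \<ge> 0" for z unfolding v_def by (intro sum_nonneg) auto
  \<comment> \<open>A majorant of \<open>q z - p z + p z * ln (1 / q z)\<close> whose three summands
    can be integrated separately.\<close>
  define w where "w z = (1 - p []) * indicator {[]} z
      + (1 / \<nu>) * (if z = [] then 0 else (1 / 4) ^ length z) + (2 + ln \<nu>) * (real (length z) * p z)" for z
  have p1: "p z \<le> 1" for z by (simp add: p_def)
  have ln\<nu>: "ln \<nu> \<ge> 0" using \<nu> by simp
  have term_bound: "(\<Sum>k\<in>S. chi_term M Y (\<lambda>x. U k x + R k x) z) \<le> 8 * A * w z + 2 * v z" for z
  proof -
    define DU where "DU k = (\<integral>x. U k x * indicator (?E z) x \<partial>M)" for k
    define DR where "DR k = (\<integral>x. R k x * indicator (?E z) x \<partial>M)" for k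
    have "chi_term M Y (\<lambda>x. U k x + R k x) z \<le> 2 * ((DU k)\<^sup>2 / p z) + 2 * (\<integral>x. (R k x)\<^sup>2 * indicator (?E z) x \<partial>M)"
      if k: "k \<in> S" for k
    proof -
      have iRk: "integrable M (R k)"
        by (rule square_integrable_imp_integrable) (use mR iR k in auto)
      have "(\<integral>x. (U k x + R k x) * indicator (?E z) x \<partial>M) = DU k + DR k"
        unfolding DU_def DR_def distrib_right
        using integrable_real_mult_indicator[OF E[of z] iU[OF k]] integrable_real_mult_indicator[OF E[of z] iRk]
        by (rule Bochner_Integration.integral_add)
      moreover have "(DU k + DR k)\<^sup>2 \<le> 2 * (DU k)\<^sup>2 + 2 * (DR k)\<^sup>2"
        using sum_squares_bound[of "DU k" "DR k"] by (simp add: power2_eq_square algebra_simps)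
      ultimately have "chi_term M Y (\<lambda>x. U k x + R k x) z \<le> (2 * (DU k)\<^sup>2 + 2 * (DR k)\<^sup>2) / p z"
        unfolding chi_term_def p_def[symmetric] using p0 by (simp add: divide_right_mono)
      also have "\<dots> = 2 * ((DU k)\<^sup>2 / p z) + 2 * ((DR k)\<^sup>2 / p z)" by (simp add: add_divide_distrib)
      also have "(DR k)\<^sup>2 / p z \<le> (\<integral>x. (R k x)\<^sup>2 * indicator (?E z) x \<partial>M)"
        unfolding DR_def p_def by (rule cauchy_schwarz_event[OF E mR[OF k] iR[OF k]])
      finally show ?thesis by simp
    qed
    then have "(\<Sum>k\<in>S. chi_term M Y (\<lambda>x. U k x + R k x) z)
      \<le> (\<Sum>k\<in>S. 2 * ((DU k)\<^sup>2 / p z) + 2 * (\<integral>x. (R k x)\<^sup>2 * indicator (?E z) x \<partial>M))"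
      by (rule sum_mono)
    also have "\<dots> = 2 * (\<Sum>k\<in>S. (DU k)\<^sup>2 / p z) + 2 * v z"
      by (simp add: v_def sum.distrib sum_distrib_left)
    also have "(\<Sum>k\<in>S. (DU k)\<^sup>2 / p z) \<le> 4 * A * (q z - p z + p z * ln (1 / q z))"
      unfolding DU_def p_def by (rule entropic_event_bound[OF E fin A q0 iU imgf mgf])
    also have "q z - p z + p z * ln (1 / q z) \<le> w z"
    proof (cases "z = []")
      case True
      then show ?thesis by (simp add: q_def w_def)
    next
      case False
      have "ln (1 / q z) = real (length z) * ln 4 + ln \<nu>"
        using False \<nu> by (simp add: q_def ln_mult ln_div ln_realpow power_divide)
      \<comment> \<open>\<open>2\<close> replaces \<open>ln 4\<close>, and \<open>ln \<nu>\<close>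
        can be charged to the length because a nonempty string has length at least 1.\<close>
      also have "\<dots> \<le> real (length z) * 2 + real (length z) * ln \<nu>"
      proof (intro add_mono mult_left_mono)
        have "ln 4 = 2 * ln (2::real)" using ln_realpow[of 2 2] by simp
        also have "\<dots> \<le> 2 * 1" by (intro mult_left_mono ln_le_minus_one[THEN order_trans]) auto
        finally show "ln 4 \<le> (2::real)" by simp
        have "length z \<ge> 1" using False by (cases z) auto
        then have "real (length z) \<ge> 1" by simp
        then show "ln \<nu> \<le> real (length z) * ln \<nu>" using mult_right_mono[of 1 "real (length z)" "ln \<nu>"] ln\<nu> by simp
      qed simp
      finally have "p z * ln (1 / q z) \<le> p z * (real (length z) * 2 + real (length z) * ln \<nu>)"
        using p0 by (rule mult_left_mono)
      then show ?thesis using False p0[of z] by (simp add: q_def w_def algebra_simps)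
    qed
    finally show ?thesis using A by simp
  qed
  have chi_term0: "chi_term M Y X z \<ge> 0" for X z by (simp add: chi_term_def)
  have w0: "w z \<ge> 0" for z using p1[of "[]"] p0[of z] \<nu> ln\<nu> by (simp add: w_def)
  have len': "(\<integral>\<^sup>+z. ennreal (real (length z) * p z) \<partial>count_space UNIV) \<le> ennreal b"
    using nn_integral_fibres_prob[OF Y, of "\<lambda>z. ennreal (real (length z))"] len
    by (simp add: p_def ennreal_mult)
  \<comment> \<open>Markov's inequality: the message is nonempty with probability at most its
    expected length.\<close>
  have p_nil: "1 - p [] \<le> b"
  proof -
    have "ennreal (1 - p []) = ennreal (prob (space M - ?E []))"
      using prob_compl[OF E[of "[]"]] by (simp add: p_def)
    also have "\<dots> = (\<integral>\<^sup>+x. indicator (space M - ?E []) x \<partial>M)"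
      by (subst nn_integral_indicator) (auto simp: emeasure_eq_measure)
    also have "\<dots> \<le> (\<integral>\<^sup>+x. ennreal (real (length (Y x))) \<partial>M)"
    proof (rule nn_integral_mono)
      fix x
      have "1 \<le> real (length (Y x))" if "Y x \<noteq> []" using that by (cases "Y x") auto
      then show "indicator (space M - ?E []) x \<le> ennreal (real (length (Y x)))"
        by (auto simp: indicator_def)
    qed
    finally have "ennreal (1 - p []) \<le> ennreal b" using len by (rule order_trans)
    then show ?thesis using ennreal_le_iff[OF b] by simp
  qed
  have "(\<Sum>k\<in>S. chi M Y (\<lambda>x. U k x + R k x))
      = (\<integral>\<^sup>+z. (\<Sum>k\<in>S. ennreal (chi_term M Y (\<lambda>x. U k x + R k x) z)) \<partial>count_space UNIV)"
    unfolding chi_def by (rule nn_integral_sum[symmetric]) simp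
  also have "\<dots> = (\<integral>\<^sup>+z. ennreal (\<Sum>k\<in>S. chi_term M Y (\<lambda>x. U k x + R k x) z) \<partial>count_space UNIV)"
    by (simp add: chi_term0)
  also have "\<dots> \<le> (\<integral>\<^sup>+z. ennreal (8 * A) * ennreal (w z) + ennreal 2 * ennreal (v z) \<partial>count_space UNIV)"
    using A w0 v0
    by (intro nn_integral_mono order_trans[OF ennreal_leI[OF term_bound]]) (simp add: ennreal_mult)
  also have "\<dots> = ennreal (8 * A) * (\<integral>\<^sup>+z. ennreal (w z) \<partial>count_space UNIV)
      + ennreal 2 * (\<integral>\<^sup>+z. ennreal (v z) \<partial>count_space UNIV)"
    by (simp add: nn_integral_add nn_integral_cmult)
  also have "(\<integral>\<^sup>+z. ennreal (w z) \<partial>count_space UNIV)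
      = (\<integral>\<^sup>+z. ennreal (1 - p []) * indicator {[]} z + ennreal (1 / \<nu>) * ennreal (if z = [] then 0 else (1 / 4) ^ length z)
          + ennreal (2 + ln \<nu>) * ennreal (real (length z) * p z) \<partial>count_space UNIV)"
  proof (intro nn_integral_cong)
    fix z :: "bool list"
    have "0 \<le> (if z = [] then 0 else (1 / 4) ^ length z :: real)" by simp
    then show "ennreal (w z) = ennreal (1 - p []) * indicator {[]} z
        + ennreal (1 / \<nu>) * ennreal (if z = [] then 0 else (1 / 4) ^ length z)
        + ennreal (2 + ln \<nu>) * ennreal (real (length z) * p z)"
      unfolding w_def using p1[of "[]"] p0[of z] \<nu> ln\<nu>
      by (simp add: ennreal_mult[symmetric] ennreal_plus[symmetric] indicator_def del: ennreal_plus)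
  qed
  also have "\<dots> = ennreal (1 - p []) + ennreal (1 / \<nu>)
       + ennreal (2 + ln \<nu>) * (\<integral>\<^sup>+z. ennreal (real (length z) * p z) \<partial>count_space UNIV)"
    by (simp add: nn_integral_add nn_integral_cmult nn_integral_binary_strings nn_integral_cmult_indicator)
  also have "\<dots> \<le> ennreal b + ennreal (1 / \<nu>) + ennreal (2 + ln \<nu>) * ennreal b"
    by (intro add_mono mult_left_mono len' ennreal_leI p_nil order_refl) auto
  also have "\<dots> = ennreal ((3 + ln \<nu>) * b + 1 / \<nu>)"
    using b \<nu> ln\<nu> by (simp add: ennreal_mult[symmetric] ennreal_plus[symmetric] algebra_simps del: ennreal_plus)
  also have "(\<integral>\<^sup>+z. ennreal (v z) \<partial>count_space UNIV) = (\<Sum>k\<in>S. ennreal (\<integral>x. (R k x)\<^sup>2 \<partial>M))"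
  proof -
    have "(\<integral>\<^sup>+z. ennreal (v z) \<partial>count_space UNIV)
       = (\<integral>\<^sup>+z. (\<Sum>k\<in>S. ennreal (\<integral>x. (R k x)\<^sup>2 * indicator (?E z) x \<partial>M)) \<partial>count_space UNIV)"
      unfolding v_def by (intro nn_integral_cong) simp
    also have "\<dots> = (\<Sum>k\<in>S. (\<integral>\<^sup>+z. ennreal (\<integral>x. (R k x)\<^sup>2 * indicator (?E z) x \<partial>M) \<partial>count_space UNIV))"
      by (rule nn_integral_sum) simp
    also have "\<dots> = (\<Sum>k\<in>S. ennreal (\<integral>x. (R k x)\<^sup>2 \<partial>M))"
      by (intro sum.cong refl nn_integral_fibres_square Y mR iR)
    finally show ?thesis .
  qed
  also have "\<dots> \<le> (\<Sum>k\<in>S. ennreal \<epsilon>)" by (intro sum_mono ennreal_leI R)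
  also have "\<dots> = ennreal (real (card S) * \<epsilon>)"
    by (simp add: ennreal_mult' ennreal_of_nat_eq_real_of_nat)
  finally have fin_bound: "(\<Sum>k\<in>S. chi M Y (\<lambda>x. U k x + R k x))
     \<le> ennreal (8 * A) * ennreal ((3 + ln \<nu>) * b + 1 / \<nu>) + ennreal 2 * ennreal (real (card S) * \<epsilon>)"
    by (simp add: add_mono mult_left_mono)
  have "real (card S) * \<epsilon> \<ge> 0"
  proof (cases "S = {}")
    case False
    then obtain k where "k \<in> S" by auto
    have "0 \<le> (\<integral>x. (R k x)\<^sup>2 \<partial>M)" by simp
    also have "\<dots> \<le> \<epsilon>" using R[OF \<open>k \<in> S\<close>] .
    finally show ?thesis by simp
  qed simp
  moreover have "(3 + ln \<nu>) * b + 1 / \<nu> \<ge> 0" using b \<nu> ln\<nu> by simp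
  ultimately have "ennreal (8 * A * ((3 + ln \<nu>) * b + 1 / \<nu>) + 2 * (real (card S) * \<epsilon>))
     = ennreal (8 * A) * ennreal ((3 + ln \<nu>) * b + 1 / \<nu>) + ennreal 2 * ennreal (real (card S) * \<epsilon>)"
    using A by (simp add: ennreal_mult)
  then show ?thesis using fin_bound by (simp add: mult.assoc)
qed

end

section \<open>Likelihood ratios in the regression model\<close>

definition unif :: "real measure" where
  "unif = uniform_measure lborel {0<..<1}"

lemma sets_unif [measurable_cong, simp]: "sets unif = sets borel"
  by (simp add: unif_def)

lemma space_unif [simp]: "space unif = UNIV"
  by (simp add: unif_def)

lemma prob_space_unif: "prob_space unif"
  unfolding unif_def by (rule prob_space_uniform_measure) auto

lemma product_sigma_finite_unif: "product_sigma_finite (\<lambda>_. unif)"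
  by (intro product_sigma_finite.intro prob_space_imp_sigma_finite prob_space_unif)

lemma obs_law_eq: "obs_law \<sigma> f = distr (unif \<Otimes>\<^sub>M gauss) borel (\<lambda>(t, e). (t, f t + \<sigma> * e))"
  by (simp add: obs_law_def unif_def gauss_def)

lemma sets_obs_law [measurable_cong, simp]: "sets (obs_law \<sigma> f) = sets borel"
  by (simp add: obs_law_def)

lemma space_obs_law [simp]: "space (obs_law \<sigma> f) = UNIV"
  by (simp add: obs_law_def)

lemma measurable_obs [measurable]:
  assumes [measurable]: "f \<in> borel_measurable borel"
  shows "(\<lambda>(t, e). (t, f t + \<sigma> * e)) \<in> unif \<Otimes>\<^sub>M gauss \<rightarrow>\<^sub>M (borel :: (real \<times> real) measure)"
  unfolding borel_prod[symmetric] by measurable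

lemma prob_space_obs_law:
  assumes [measurable]: "f \<in> borel_measurable borel"
  shows "prob_space (obs_law \<sigma> f)"
proof -
  interpret u: prob_space unif by (rule prob_space_unif)
  interpret g: prob_space gauss by (rule prob_space_gauss)
  interpret pair_prob_space unif gauss ..
  show ?thesis unfolding obs_law_eq by (rule prob_space_distr) measurable
qed

lemma nn_integral_obs_law:
  fixes g :: "real \<times> real \<Rightarrow> ennreal"
  assumes [measurable]: "f \<in> borel_measurable borel" "g \<in> borel_measurable borel"
  shows "(\<integral>\<^sup>+z. g z \<partial>obs_law \<sigma> f) = (\<integral>\<^sup>+t. (\<integral>\<^sup>+e. g (t, f t + \<sigma> * e) \<partial>gauss) \<partial>unif)"
proof -
  interpret g: prob_space gauss by (rule prob_space_gauss)
  have "(\<integral>\<^sup>+z. g z \<partial>obs_law \<sigma> f) = (\<integral>\<^sup>+z. (\<lambda>(t, e). g (t, f t + \<sigma> * e)) z \<partial>(unif \<Otimes>\<^sub>M gauss))"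
    unfolding obs_law_eq by (subst nn_integral_distr) (auto simp: split_beta')
  also have "\<dots> = (\<integral>\<^sup>+t. (\<integral>\<^sup>+e. (\<lambda>(t, e). g (t, f t + \<sigma> * e)) (t, e) \<partial>gauss) \<partial>unif)"
  proof (rule g.nn_integral_fst[symmetric])
    have "(\<lambda>x. g ((\<lambda>(t, e). (t, f t + \<sigma> * e)) x)) \<in> borel_measurable (unif \<Otimes>\<^sub>M gauss)"
      by (rule measurable_compose[OF measurable_obs]) auto
    then show "(\<lambda>(t, e). g (t, f t + \<sigma> * e)) \<in> borel_measurable (unif \<Otimes>\<^sub>M gauss)"
      by (simp add: split_beta')
  qed
  finally show ?thesis by simp
qed

text \<open>Density of the response law N(f t, sigma^2) relative to N(0, sigma^2); the design
  density cancels.\<close>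

definition obs_ratio :: "real \<Rightarrow> (real \<Rightarrow> real) \<Rightarrow> real \<times> real \<Rightarrow> real" where
  "obs_ratio \<sigma> f z = exp (f (fst z) / \<sigma> * (snd z / \<sigma>) - (f (fst z) / \<sigma>)\<^sup>2 / 2)"

lemma measurable_obs_ratio [measurable]:
  assumes [measurable]: "f \<in> borel_measurable borel"
  shows "obs_ratio \<sigma> f \<in> borel_measurable borel"
  unfolding obs_ratio_def borel_prod[symmetric] by measurable

lemma obs_law_change_of_measure:
  fixes g :: "real \<times> real \<Rightarrow> ennreal"
  assumes [measurable]: "f \<in> borel_measurable borel" "g \<in> borel_measurable borel" and \<sigma>: "\<sigma> > 0"
  shows "(\<integral>\<^sup>+z. g z \<partial>obs_law \<sigma> f) = (\<integral>\<^sup>+z. ennreal (obs_ratio \<sigma> f z) * g z \<partial>obs_law \<sigma> (\<lambda>_. 0))"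
proof -
  have "(\<integral>\<^sup>+e. g (t, f t + \<sigma> * e) \<partial>gauss)
      = (\<integral>\<^sup>+e. ennreal (obs_ratio \<sigma> f (t, 0 + \<sigma> * e)) * g (t, 0 + \<sigma> * e) \<partial>gauss)" for t
  proof -
    have [measurable]: "(\<lambda>e. g (t, \<sigma> * e)) \<in> borel_measurable borel"
    proof (rule measurable_compose[of _ _ borel g])
      show "(\<lambda>e. (t, \<sigma> * e)) \<in> borel \<rightarrow>\<^sub>M (borel :: (real \<times> real) measure)"
        unfolding borel_prod[symmetric] by measurable
    qed measurable
    have "(\<integral>\<^sup>+e. g (t, f t + \<sigma> * e) \<partial>gauss) = (\<integral>\<^sup>+e. (\<lambda>e. g (t, \<sigma> * e)) (e + f t / \<sigma>) \<partial>gauss)"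
      using \<sigma> by (simp add: distrib_left add.commute)
    also have "\<dots> = (\<integral>\<^sup>+e. ennreal (exp (f t / \<sigma> * e - (f t / \<sigma>)\<^sup>2 / 2)) * g (t, \<sigma> * e) \<partial>gauss)"
      by (rule nn_integral_gauss_shift) measurable
    finally show ?thesis using \<sigma> by (simp add: obs_ratio_def)
  qed
  then show ?thesis by (simp add: nn_integral_obs_law)
qed

lemma sets_local_law [measurable_cong]: "sets (local_law \<sigma> n m f) = sets (PiM {1..n div m} (\<lambda>_. borel))"
  unfolding local_law_def by (intro sets_PiM_cong) auto

lemma space_local_law: "space (local_law \<sigma> n m f) = space (PiM {1..n div m} (\<lambda>_. borel))"
  by (rule sets_eq_imp_space_eq) (rule sets_local_law)

lemma prob_space_local_law:
  assumes "f \<in> borel_measurable borel"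
  shows "prob_space (local_law \<sigma> n m f)"
  unfolding local_law_def by (intro prob_space_PiM prob_space_obs_law assms)

text \<open>A product law is determined on rectangles, where the measure can be changed in each
  factor separately.\<close>

lemma local_law_eq_density:
  assumes [measurable]: "f \<in> borel_measurable borel" and \<sigma>: "\<sigma> > 0"
  shows "local_law \<sigma> n m f
    = density (local_law \<sigma> n m (\<lambda>_. 0)) (\<lambda>x. \<Prod>l\<in>{1..n div m}. ennreal (obs_ratio \<sigma> f (x l)))"
    (is "_ = density ?P ?L")
proof -
  interpret F: product_sigma_finite "\<lambda>_. obs_law \<sigma> f"
    by (intro product_sigma_finite.intro prob_space_imp_sigma_finite prob_space_obs_law) measurable
  interpret Z: product_sigma_finite "\<lambda>_. obs_law \<sigma> (\<lambda>_. 0)"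
    by (intro product_sigma_finite.intro prob_space_imp_sigma_finite prob_space_obs_law) measurable
  have "density ?P ?L = PiM {1..n div m} (\<lambda>_. obs_law \<sigma> f)"
  proof (rule F.PiM_eqI)
    show "sets (density ?P ?L) = sets (PiM {1..n div m} (\<lambda>_. obs_law \<sigma> f))"
      by (simp only: sets_density local_law_def[symmetric]) (simp only: sets_local_law)
    fix A :: "nat \<Rightarrow> (real \<times> real) set"
    assume A: "\<And>i. i \<in> {1..n div m} \<Longrightarrow> A i \<in> sets (obs_law \<sigma> f)"
    then have [measurable]: "\<And>i. i \<in> {1..n div m} \<Longrightarrow> A i \<in> sets borel" by simp
    have AP: "Pi\<^sub>E {1..n div m} A \<in> sets ?P" unfolding sets_local_law by (rule sets_PiM_I_finite) auto
    have "emeasure (density ?P ?L) (Pi\<^sub>E {1..n div m} A)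
       = (\<integral>\<^sup>+x. ?L x * indicator (Pi\<^sub>E {1..n div m} A) x \<partial>?P)"
      by (rule emeasure_density[OF _ AP]) measurable
    also have "\<dots> = (\<integral>\<^sup>+x. (\<Prod>l\<in>{1..n div m}. ennreal (obs_ratio \<sigma> f (x l)) * indicator (A l) (x l)) \<partial>?P)"
    proof (rule nn_integral_cong)
      fix x assume "x \<in> space ?P"
      then have "x \<in> extensional {1..n div m}" by (simp add: space_local_law space_PiM PiE_def)
      then have "indicator (Pi\<^sub>E {1..n div m} A) x = (\<Prod>l\<in>{1..n div m}. indicator (A l) (x l) :: ennreal)"
        by (auto simp: indicator_def PiE_def Pi_def)
      then show "?L x * indicator (Pi\<^sub>E {1..n div m} A) x
         = (\<Prod>l\<in>{1..n div m}. ennreal (obs_ratio \<sigma> f (x l)) * indicator (A l) (x l))"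
        by (simp add: prod.distrib)
    qed
    also have "\<dots> = (\<Prod>l\<in>{1..n div m}. \<integral>\<^sup>+z. ennreal (obs_ratio \<sigma> f z) * indicator (A l) z \<partial>obs_law \<sigma> (\<lambda>_. 0))"
      unfolding local_law_def by (rule Z.product_nn_integral_prod) auto
    also have "\<dots> = (\<Prod>l\<in>{1..n div m}. emeasure (obs_law \<sigma> f) (A l))"
      using obs_law_change_of_measure[OF assms(1) _ \<sigma>, symmetric] A
      by (intro prod.cong refl) (simp add: borel_measurable_indicator)
    finally show "emeasure (density ?P ?L) (Pi\<^sub>E {1..n div m} A)
        = (\<Prod>l\<in>{1..n div m}. emeasure (obs_law \<sigma> f) (A l))" .
  qed simp
  then show ?thesis by (simp add: local_law_def)
qed

text \<open>Under \<open>f = 0\<close> the design and the noise of one machine are two independent product measures,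
  which makes it possible to condition on the design.\<close>

definition design_noise :: "nat \<Rightarrow> ((nat \<Rightarrow> real) \<times> (nat \<Rightarrow> real)) measure" where
  "design_noise d = PiM {1..d} (\<lambda>_. unif) \<Otimes>\<^sub>M PiM {1..d} (\<lambda>_. gauss)"

definition null_sample :: "real \<Rightarrow> nat \<Rightarrow> (nat \<Rightarrow> real) \<times> (nat \<Rightarrow> real) \<Rightarrow> nat \<Rightarrow> real \<times> real" where
  "null_sample \<sigma> d \<omega> = (\<lambda>l\<in>{1..d}. (fst \<omega> l, \<sigma> * snd \<omega> l))"

lemma sets_design_noise [measurable_cong]:
  "sets (design_noise d) = sets (PiM {1..d} (\<lambda>_. borel) \<Otimes>\<^sub>M PiM {1..d} (\<lambda>_. borel))"
  unfolding design_noise_def by (intro sets_pair_measure_cong sets_PiM_cong) auto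

lemma prob_space_design_noise: "prob_space (design_noise d)"
proof -
  interpret u: prob_space "PiM {1..d} (\<lambda>_. unif)" by (intro prob_space_PiM prob_space_unif)
  interpret g: prob_space "PiM {1..d} (\<lambda>_. gauss)" by (intro prob_space_PiM prob_space_gauss)
  interpret pair_prob_space "PiM {1..d} (\<lambda>_. unif)" "PiM {1..d} (\<lambda>_. gauss)" ..
  show ?thesis unfolding design_noise_def by unfold_locales
qed

lemma measurable_null_sample [measurable]:
  "null_sample \<sigma> d \<in> design_noise d \<rightarrow>\<^sub>M PiM {1..d} (\<lambda>_. borel)"
  unfolding null_sample_def
proof (rule measurable_restrict)
  fix l assume [measurable]: "l \<in> {1..d}"
  show "(\<lambda>\<omega>. (fst \<omega> l, \<sigma> * snd \<omega> l)) \<in> design_noise d \<rightarrow>\<^sub>M (borel :: (real \<times> real) measure)"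
    unfolding borel_prod[symmetric] by measurable
qed

text \<open>Both laws are compared on rectangles, where the indicator factorises over the sample
  points and Tonelli separates the design from the noise.\<close>

lemma local_law_null:
  "local_law \<sigma> n m (\<lambda>_. 0) = distr (design_noise (n div m)) (PiM {1..n div m} (\<lambda>_. borel)) (null_sample \<sigma> (n div m))"
proof -
  define d where "d = n div m"
  interpret gs: prob_space gauss by (rule prob_space_gauss)
  interpret Z: product_sigma_finite "\<lambda>_. obs_law \<sigma> (\<lambda>_. 0)"
    by (intro product_sigma_finite.intro prob_space_imp_sigma_finite prob_space_obs_law) measurable
  interpret u: product_sigma_finite "\<lambda>_. unif" by (rule product_sigma_finite_unif)
  interpret g: product_sigma_finite "\<lambda>_. gauss" by (rule product_sigma_finite_gauss)
  interpret gp: prob_space "PiM {1..d} (\<lambda>_. gauss)" by (intro prob_space_PiM prob_space_gauss)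
  let ?D = "distr (design_noise d) (PiM {1..d} (\<lambda>_. borel)) (null_sample \<sigma> d)"
  have "?D = PiM {1..d} (\<lambda>_. obs_law \<sigma> (\<lambda>_. 0))"
  proof (rule Z.PiM_eqI)
    show "sets ?D = sets (PiM {1..d} (\<lambda>_. obs_law \<sigma> (\<lambda>_. 0)))"
      by (simp, intro sets_PiM_cong) auto
    fix A :: "nat \<Rightarrow> (real \<times> real) set"
    assume A: "\<And>i. i \<in> {1..d} \<Longrightarrow> A i \<in> sets (obs_law \<sigma> (\<lambda>_. 0))"
    then have A' [measurable]: "\<And>i. i \<in> {1..d} \<Longrightarrow> A i \<in> sets borel" by simp
    have AP: "Pi\<^sub>E {1..d} A \<in> sets (PiM {1..d} (\<lambda>_. borel))" by (rule sets_PiM_I_finite) auto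
    have m0: "(\<lambda>(t, e). indicator (A l) (t, \<sigma> * e) :: ennreal) \<in> borel_measurable (borel \<Otimes>\<^sub>M borel)"
      if "l \<in> {1..d}" for l
    proof -
      have "(\<lambda>(t, e). (t, \<sigma> * e)) \<in> borel \<Otimes>\<^sub>M borel \<rightarrow>\<^sub>M (borel :: (real \<times> real) measure)"
        unfolding borel_prod[symmetric] by measurable
      from measurable_compose[OF this borel_measurable_indicator[OF A'[OF that]]]
      show ?thesis by (simp add: split_beta')
    qed
    have m1: "(\<lambda>e. indicator (A l) (t, \<sigma> * e) :: ennreal) \<in> borel_measurable gauss" if "l \<in> {1..d}" for l t
      using measurable_compose[OF measurable_Pair1' m0[OF that], of t] by simp
    have m2: "(\<lambda>t. \<integral>\<^sup>+e. indicator (A l) (t, \<sigma> * e) \<partial>gauss) \<in> borel_measurable unif" if "l \<in> {1..d}" for l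
      by (rule gs.borel_measurable_nn_integral) (use m0[OF that] in simp)
    have "emeasure ?D (Pi\<^sub>E {1..d} A)
       = (\<integral>\<^sup>+\<omega>. indicator (Pi\<^sub>E {1..d} A) (null_sample \<sigma> d \<omega>) \<partial>design_noise d)"
    proof -
      have "emeasure ?D (Pi\<^sub>E {1..d} A) = (\<integral>\<^sup>+x. indicator (Pi\<^sub>E {1..d} A) x \<partial>?D)"
        using AP by (subst nn_integral_indicator) auto
      also have "\<dots> = (\<integral>\<^sup>+\<omega>. indicator (Pi\<^sub>E {1..d} A) (null_sample \<sigma> d \<omega>) \<partial>design_noise d)"
        by (rule nn_integral_distr[OF measurable_null_sample]) (use AP in simp)
      finally show ?thesis .
    qed
    also have "\<dots> = (\<integral>\<^sup>+\<omega>. (\<lambda>(t, e). \<Prod>l\<in>{1..d}. indicator (A l) (t l, \<sigma> * e l)) \<omega> \<partial>design_noise d)"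
      by (intro nn_integral_cong)
        (auto simp: null_sample_def indicator_def PiE_def Pi_def split_beta')
    also have "\<dots> = (\<integral>\<^sup>+t. \<integral>\<^sup>+e. (\<lambda>(t, e). \<Prod>l\<in>{1..d}. indicator (A l) (t l, \<sigma> * e l)) (t, e)
        \<partial>PiM {1..d} (\<lambda>_. gauss) \<partial>PiM {1..d} (\<lambda>_. unif))"
      unfolding design_noise_def
    proof (rule gp.nn_integral_fst[symmetric])
      have "(\<lambda>\<omega>. \<Prod>l\<in>{1..d}. indicator (A l) (fst \<omega> l, \<sigma> * snd \<omega> l) :: ennreal)
        \<in> borel_measurable (PiM {1..d} (\<lambda>_. unif) \<Otimes>\<^sub>M PiM {1..d} (\<lambda>_. gauss))"
      proof (rule borel_measurable_prod_ennreal)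
        fix l assume l: "l \<in> {1..d}"
        have "(\<lambda>\<omega>. (fst \<omega> l, snd \<omega> l)) \<in> PiM {1..d} (\<lambda>_. unif) \<Otimes>\<^sub>M PiM {1..d} (\<lambda>_. gauss) \<rightarrow>\<^sub>M borel \<Otimes>\<^sub>M borel"
          using l by measurable
        from measurable_compose[OF this m0[OF l]]
        show "(\<lambda>\<omega>. indicator (A l) (fst \<omega> l, \<sigma> * snd \<omega> l) :: ennreal)
            \<in> borel_measurable (PiM {1..d} (\<lambda>_. unif) \<Otimes>\<^sub>M PiM {1..d} (\<lambda>_. gauss))" by simp
      qed
      then show "(\<lambda>(t, e). \<Prod>l\<in>{1..d}. indicator (A l) (t l, \<sigma> * e l) :: ennreal)
        \<in> borel_measurable (PiM {1..d} (\<lambda>_. unif) \<Otimes>\<^sub>M PiM {1..d} (\<lambda>_. gauss))" by (simp add: split_beta')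
    qed
    also have "\<dots> = (\<integral>\<^sup>+t. (\<Prod>l\<in>{1..d}. \<integral>\<^sup>+e. indicator (A l) (t l, \<sigma> * e) \<partial>gauss) \<partial>PiM {1..d} (\<lambda>_. unif))"
      unfolding prod.case by (intro nn_integral_cong g.product_nn_integral_prod m1) auto
    also have "\<dots> = (\<Prod>l\<in>{1..d}. \<integral>\<^sup>+t. \<integral>\<^sup>+e. indicator (A l) (t, \<sigma> * e) \<partial>gauss \<partial>unif)"
      by (intro u.product_nn_integral_prod m2) auto
    also have "\<dots> = (\<Prod>l\<in>{1..d}. emeasure (obs_law \<sigma> (\<lambda>_. 0)) (A l))"
    proof (intro prod.cong refl)
      fix l assume l: "l \<in> {1..d}"
      have "(\<integral>\<^sup>+z. indicator (A l) z \<partial>obs_law \<sigma> (\<lambda>_. 0))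
         = (\<integral>\<^sup>+t. \<integral>\<^sup>+e. indicator (A l) (t, 0 + \<sigma> * e) \<partial>gauss \<partial>unif)"
        by (rule nn_integral_obs_law) (use A'[OF l] in auto)
      then show "(\<integral>\<^sup>+t. \<integral>\<^sup>+e. indicator (A l) (t, \<sigma> * e) \<partial>gauss \<partial>unif) = emeasure (obs_law \<sigma> (\<lambda>_. 0)) (A l)"
        using A[OF l] by simp
    qed
    finally show "emeasure ?D (Pi\<^sub>E {1..d} A) = (\<Prod>l\<in>{1..d}. emeasure (obs_law \<sigma> (\<lambda>_. 0)) (A l))" .
  qed simp
  then show ?thesis by (simp add: local_law_def d_def)
qed

section \<open>Moments of the likelihood ratio of a local sample\<close>

definition energy :: "nat \<Rightarrow> (real \<Rightarrow> real) \<Rightarrow> (nat \<Rightarrow> real) \<Rightarrow> real" where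
  "energy d h t = (\<Sum>l\<in>{1..d}. (h (t l))\<^sup>2)"

text \<open>Here \<open>h\<close> stands for \<open>f / \<sigma>\<close> and the second component of
  \<open>\<omega>\<close> for the standardised noise under \<open>f = 0\<close>. Given the design,
  the logarithm is Gaussian with mean \<open>- energy / 2\<close> and variance
  \<open>energy\<close>.\<close>

definition lik_ratio :: "nat \<Rightarrow> (real \<Rightarrow> real) \<Rightarrow> (nat \<Rightarrow> real) \<times> (nat \<Rightarrow> real) \<Rightarrow> real" where
  "lik_ratio d h \<omega> = exp ((\<Sum>l\<in>{1..d}. h (fst \<omega> l) * snd \<omega> l) - energy d h (fst \<omega>) / 2)"

lemma measurable_energy [measurable]:
  assumes [measurable]: "h \<in> borel_measurable borel"
  shows "energy d h \<in> borel_measurable (PiM {1..d} (\<lambda>_. borel))"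
  unfolding energy_def by measurable

lemma measurable_lik_ratio [measurable]:
  assumes [measurable]: "h \<in> borel_measurable borel"
  shows "lik_ratio d h \<in> borel_measurable (design_noise d)"
  unfolding lik_ratio_def by measurable

text \<open>Transfers the law under every \<open>f\<close> to the single space
  \<open>design_noise\<close>, on which all hypotheses are compared.\<close>

lemma emeasure_local_law:
  assumes [measurable]: "f \<in> borel_measurable borel" and \<sigma>: "\<sigma> > 0"
    and A: "A \<in> sets (PiM {1..n div m} (\<lambda>_. borel))"
  shows "emeasure (local_law \<sigma> n m f) A
    = (\<integral>\<^sup>+\<omega>. ennreal (lik_ratio (n div m) (\<lambda>t. f t / \<sigma>) \<omega>) * indicator A (null_sample \<sigma> (n div m) \<omega>) \<partial>design_noise (n div m))"
proof -
  define d where "d = n div m"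
  note [measurable] = A[folded d_def]
  have [measurable]: "(\<lambda>x. \<Prod>l\<in>{1..d}. ennreal (obs_ratio \<sigma> f (x l))) \<in> borel_measurable (PiM {1..d} (\<lambda>_. borel))"
    by measurable
  have "emeasure (local_law \<sigma> n m f) A
      = (\<integral>\<^sup>+x. (\<Prod>l\<in>{1..d}. ennreal (obs_ratio \<sigma> f (x l))) * indicator A x \<partial>local_law \<sigma> n m (\<lambda>_. 0))"
    unfolding local_law_eq_density[OF assms(1) \<sigma>, of n m] d_def[symmetric]
    by (rule emeasure_density) (use A in \<open>auto simp: sets_local_law d_def\<close>)
  also have "\<dots> = (\<integral>\<^sup>+\<omega>. (\<Prod>l\<in>{1..d}. ennreal (obs_ratio \<sigma> f (null_sample \<sigma> d \<omega> l)))
      * indicator A (null_sample \<sigma> d \<omega>) \<partial>design_noise d)"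
    unfolding local_law_null d_def[symmetric] by (rule nn_integral_distr) measurable
  also have "\<dots> = (\<integral>\<^sup>+\<omega>. ennreal (lik_ratio d (\<lambda>t. f t / \<sigma>) \<omega>) * indicator A (null_sample \<sigma> d \<omega>) \<partial>design_noise d)"
  proof (intro nn_integral_cong arg_cong2[where f = "(*)"] refl)
    fix \<omega>
    have "(\<Prod>l\<in>{1..d}. ennreal (obs_ratio \<sigma> f (null_sample \<sigma> d \<omega> l)))
      = ennreal (\<Prod>l\<in>{1..d}. obs_ratio \<sigma> f (null_sample \<sigma> d \<omega> l))"
      by (rule prod_ennreal) (simp add: obs_ratio_def)
    also have "(\<Prod>l\<in>{1..d}. obs_ratio \<sigma> f (null_sample \<sigma> d \<omega> l))
      = (\<Prod>l\<in>{1..d}. exp (f (fst \<omega> l) / \<sigma> * snd \<omega> l - (f (fst \<omega> l) / \<sigma>)\<^sup>2 / 2))"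
      using \<sigma> by (intro prod.cong refl) (simp add: obs_ratio_def null_sample_def)
    also have "\<dots> = lik_ratio d (\<lambda>t. f t / \<sigma>) \<omega>"
      by (simp add: exp_sum[symmetric] lik_ratio_def energy_def sum_subtractf sum_divide_distrib)
    finally show "(\<Prod>l\<in>{1..d}. ennreal (obs_ratio \<sigma> f (null_sample \<sigma> d \<omega> l)))
      = ennreal (lik_ratio d (\<lambda>t. f t / \<sigma>) \<omega>)" .
  qed
  finally show ?thesis by (simp add: d_def)
qed

lemma nn_integral_noise_exp:
  fixes d :: nat
  shows "(\<integral>\<^sup>+e. ennreal (exp (\<Sum>l\<in>{1..d}. a l * e l)) \<partial>PiM {1..d} (\<lambda>_. gauss))
    = ennreal (exp ((\<Sum>l\<in>{1..d}. (a l)\<^sup>2) / 2))"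
proof -
  interpret g: product_sigma_finite "\<lambda>_. gauss" by (rule product_sigma_finite_gauss)
  have "(\<integral>\<^sup>+e. ennreal (exp (\<Sum>l\<in>{1..d}. a l * e l)) \<partial>PiM {1..d} (\<lambda>_. gauss))
      = (\<integral>\<^sup>+e. (\<Prod>l\<in>{1..d}. ennreal (exp (a l * e l))) \<partial>PiM {1..d} (\<lambda>_. gauss))"
    by (simp add: exp_sum prod_ennreal)
  also have "\<dots> = (\<Prod>l\<in>{1..d}. \<integral>\<^sup>+e. ennreal (exp (a l * e)) \<partial>gauss)"
    by (rule g.product_nn_integral_prod) auto
  also have "\<dots> = ennreal (exp ((\<Sum>l\<in>{1..d}. (a l)\<^sup>2) / 2))"
    by (simp add: nn_integral_gauss_exp prod_ennreal exp_sum sum_divide_distrib)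
  finally show ?thesis .
qed

text \<open>Moments of a log-normal variable. Exponent 1 gives mean one, exponent 2 the second
  moment, and exponent \<open>2 + r\<close> later controls the truncation error.\<close>

lemma nn_integral_lik_ratio_power:
  "(\<integral>\<^sup>+e. ennreal (exp (r * ln (lik_ratio d h (t, e)))) \<partial>PiM {1..d} (\<lambda>_. gauss))
    = ennreal (exp (r * (r - 1) * energy d h t / 2))"
proof -
  have "(\<integral>\<^sup>+e. ennreal (exp (r * ln (lik_ratio d h (t, e)))) \<partial>PiM {1..d} (\<lambda>_. gauss))
    = (\<integral>\<^sup>+e. ennreal (exp (- r * energy d h t / 2)) * ennreal (exp (\<Sum>l\<in>{1..d}. (r * h (t l)) * e l)) \<partial>PiM {1..d} (\<lambda>_. gauss))"
    by (simp add: lik_ratio_def ennreal_mult[symmetric] exp_add[symmetric] sum_distrib_left algebra_simps)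
  also have "\<dots> = ennreal (exp (- r * energy d h t / 2)) * ennreal (exp ((\<Sum>l\<in>{1..d}. (r * h (t l))\<^sup>2) / 2))"
    by (subst nn_integral_cmult) (measurable, simp only: nn_integral_noise_exp)
  also have "(\<Sum>l\<in>{1..d}. (r * h (t l))\<^sup>2) = r\<^sup>2 * energy d h t"
    by (simp add: energy_def power_mult_distrib sum_distrib_left)
  also have "ennreal (exp (- r * energy d h t / 2)) * ennreal (exp (r\<^sup>2 * energy d h t / 2))
      = ennreal (exp (- r * energy d h t / 2 + r\<^sup>2 * energy d h t / 2))"
    by (simp only: exp_add ennreal_mult exp_ge_zero)
  also have "- r * energy d h t / 2 + r\<^sup>2 * energy d h t / 2 = r * (r - 1) * energy d h t / 2"
    by (simp add: power2_eq_square algebra_simps)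
  finally show ?thesis .
qed

text \<open>Independence of the design points reduces this to one factor, where
  \<open>exp y \<le> 1 + 2 * y\<close> holds for \<open>0 \<le> y \<le> 1\<close>. That condition
  caps the usable \<open>r\<close> at the inverse of the squared sup-norm of
  \<open>h\<close>.\<close>

lemma nn_integral_exp_energy:
  assumes [measurable]: "h \<in> borel_measurable borel" and r: "r \<ge> 0" and hb: "\<And>x. r * (h x)\<^sup>2 \<le> 1"
    and v: "(\<integral>\<^sup>+x. ennreal ((h x)\<^sup>2) \<partial>unif) \<le> ennreal v" and "v \<ge> 0"
  shows "(\<integral>\<^sup>+t. ennreal (exp (r * energy d h t)) \<partial>PiM {1..d} (\<lambda>_. unif)) \<le> ennreal (exp (2 * r * real d * v))"
proof -
  interpret u: product_sigma_finite "\<lambda>_. unif" by (rule product_sigma_finite_unif)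
  interpret us: prob_space unif by (rule prob_space_unif)
  have "(\<integral>\<^sup>+t. ennreal (exp (r * energy d h t)) \<partial>PiM {1..d} (\<lambda>_. unif))
      = (\<integral>\<^sup>+t. (\<Prod>l\<in>{1..d}. ennreal (exp (r * (h (t l))\<^sup>2))) \<partial>PiM {1..d} (\<lambda>_. unif))"
    by (simp add: energy_def exp_sum prod_ennreal sum_distrib_left)
  also have "\<dots> = (\<Prod>l\<in>{1..d}. \<integral>\<^sup>+x. ennreal (exp (r * (h x)\<^sup>2)) \<partial>unif)"
    by (rule u.product_nn_integral_prod) auto
  also have "\<dots> \<le> (\<Prod>l\<in>{1..d}. ennreal (exp (2 * r * v)))"
  proof (intro prod_mono_ennreal)
    have "(\<integral>\<^sup>+x. ennreal (exp (r * (h x)\<^sup>2)) \<partial>unif) \<le> (\<integral>\<^sup>+x. 1 + ennreal (2 * r) * ennreal ((h x)\<^sup>2) \<partial>unif)"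
    proof (rule nn_integral_mono)
      fix x
      let ?y = "r * (h x)\<^sup>2"
      have y: "0 \<le> ?y" using r by simp
      have "exp ?y \<le> 1 + ?y + ?y\<^sup>2" using y hb by (rule exp_bound)
      also have "?y\<^sup>2 \<le> ?y" using y hb[of x] by (simp add: power2_eq_square mult_left_le)
      finally have "exp ?y \<le> 1 + 2 * r * (h x)\<^sup>2" by simp
      then have "ennreal (exp ?y) \<le> ennreal (1 + 2 * r * (h x)\<^sup>2)" by (rule ennreal_leI)
      also have "\<dots> = 1 + ennreal (2 * r) * ennreal ((h x)\<^sup>2)"
        using r by (subst ennreal_plus) (auto simp: ennreal_mult')
      finally show "ennreal (exp ?y) \<le> 1 + ennreal (2 * r) * ennreal ((h x)\<^sup>2)" .
    qed
    also have "\<dots> = 1 + ennreal (2 * r) * (\<integral>\<^sup>+x. ennreal ((h x)\<^sup>2) \<partial>unif)"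
      by (subst nn_integral_add) (auto simp: nn_integral_cmult us.emeasure_space_1[simplified])
    also have "\<dots> \<le> 1 + ennreal (2 * r) * ennreal v"
      by (intro add_left_mono mult_left_mono v) auto
    also have "\<dots> = ennreal (1 + 2 * r * v)"
      using r \<open>v \<ge> 0\<close> by (subst ennreal_plus) (auto simp: ennreal_mult')
    also have "\<dots> \<le> ennreal (exp (2 * r * v))" by (intro ennreal_leI exp_ge_add_one_self)
    finally show "(\<integral>\<^sup>+x. ennreal (exp (r * (h x)\<^sup>2)) \<partial>unif) \<le> ennreal (exp (2 * r * v))" .
  qed
  also have "\<dots> = ennreal (exp (2 * r * real d * v))"
    by (simp add: ennreal_power exp_of_nat_mult[symmetric] mult_ac)
  finally show ?thesis .
qed

declare One_nat_def [simp del]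

lemma nn_integral_design_noise:
  assumes [measurable]: "g \<in> borel_measurable (design_noise d)"
  shows "(\<integral>\<^sup>+\<omega>. g \<omega> \<partial>design_noise d)
    = (\<integral>\<^sup>+t. \<integral>\<^sup>+e. g (t, e) \<partial>PiM {1..d} (\<lambda>_. gauss) \<partial>PiM {1..d} (\<lambda>_. unif))"
proof -
  interpret g: prob_space "PiM {1..d} (\<lambda>_. gauss)" by (intro prob_space_PiM prob_space_gauss)
  show ?thesis
    using assms unfolding design_noise_def by (rule g.nn_integral_fst[symmetric])
qed

lemma lik_ratio_pos: "lik_ratio d h \<omega> > 0"
  by (simp add: lik_ratio_def)

lemma nn_integral_lik_ratio:
  "(\<integral>\<^sup>+e. ennreal (lik_ratio d h (t, e)) \<partial>PiM {1..d} (\<lambda>_. gauss)) = 1"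
  using nn_integral_lik_ratio_power[where r = 1 and d = d and h = h and t = t] by (simp add: lik_ratio_pos)

lemma measurable_noise_section:
  assumes "g \<in> borel_measurable (design_noise d)" and "t \<in> space (PiM {1..d} (\<lambda>_. unif))"
  shows "(\<lambda>e. g (t, e)) \<in> borel_measurable (PiM {1..d} (\<lambda>_. gauss))"
  using measurable_compose[OF measurable_Pair1'[OF assms(2)] assms(1)[unfolded design_noise_def]] .

text \<open>Given the design, the second moment is the exponential of the energy, which
  \<open>nn_integral_exp_energy\<close> averages with \<open>r = 1\<close>; the \<open>- 1\<close>
  comes from the unit mean of the ratio.\<close>

lemma lik_ratio_second_moment:
  assumes [measurable]: "h \<in> borel_measurable borel" and hb: "\<And>x. (h x)\<^sup>2 \<le> 1"
    and v: "(\<integral>\<^sup>+x. ennreal ((h x)\<^sup>2) \<partial>unif) \<le> ennreal v" and "v \<ge> 0"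
  shows "integrable (design_noise d) (\<lambda>\<omega>. (lik_ratio d h \<omega> - 1)\<^sup>2)"
    and "(\<integral>\<omega>. (lik_ratio d h \<omega> - 1)\<^sup>2 \<partial>design_noise d) \<le> exp (2 * real d * v) - 1"
proof -
  interpret P: prob_space "design_noise d" by (rule prob_space_design_noise)
  interpret u: prob_space "PiM {1..d} (\<lambda>_. unif)" by (intro prob_space_PiM prob_space_unif)
  have eq: "exp (2 * ln (lik_ratio d h \<omega>)) = (lik_ratio d h \<omega>)\<^sup>2" for \<omega>
    using lik_ratio_pos[of d h \<omega>] by (simp add: exp_double)
  have "(\<integral>\<^sup>+\<omega>. ennreal ((lik_ratio d h \<omega>)\<^sup>2) \<partial>design_noise d)
     = (\<integral>\<^sup>+t. \<integral>\<^sup>+e. ennreal ((lik_ratio d h (t, e))\<^sup>2) \<partial>PiM {1..d} (\<lambda>_. gauss) \<partial>PiM {1..d} (\<lambda>_. unif))"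
    by (rule nn_integral_design_noise) measurable
  also have "\<dots> = (\<integral>\<^sup>+t. ennreal (exp (1 * energy d h t)) \<partial>PiM {1..d} (\<lambda>_. unif))"
    using nn_integral_lik_ratio_power[where r = 2 and d = d and h = h] by (simp add: eq)
  also have "\<dots> \<le> ennreal (exp (2 * 1 * real d * v))"
    by (rule nn_integral_exp_energy) (use assms in auto)
  finally have L2: "(\<integral>\<^sup>+\<omega>. ennreal ((lik_ratio d h \<omega>)\<^sup>2) \<partial>design_noise d) \<le> ennreal (exp (2 * real d * v))"
    by simp
  have iL2: "integrable (design_noise d) (\<lambda>\<omega>. (lik_ratio d h \<omega>)\<^sup>2)"
    by (rule integrableI_bounded) (use L2 in \<open>auto intro: le_less_trans\<close>)
  have L1: "(\<integral>\<^sup>+\<omega>. ennreal (lik_ratio d h \<omega>) \<partial>design_noise d) = 1"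
    by (subst nn_integral_design_noise) (simp_all add: nn_integral_lik_ratio u.emeasure_space_1)
  have iL: "integrable (design_noise d) (lik_ratio d h)"
    by (rule integrableI_bounded) (use L1 lik_ratio_pos in \<open>auto simp: less_imp_le\<close>)
  have eL: "(\<integral>\<omega>. lik_ratio d h \<omega> \<partial>design_noise d) = 1"
    by (subst integral_eq_nn_integral) (auto simp: L1 lik_ratio_pos less_imp_le)
  have sq: "(lik_ratio d h \<omega> - 1)\<^sup>2 = (lik_ratio d h \<omega>)\<^sup>2 - 2 * lik_ratio d h \<omega> + 1" for \<omega>
    by (simp add: power2_eq_square algebra_simps)
  show "integrable (design_noise d) (\<lambda>\<omega>. (lik_ratio d h \<omega> - 1)\<^sup>2)"
    unfolding sq using iL2 iL by auto
  have "(\<integral>\<omega>. (lik_ratio d h \<omega>)\<^sup>2 \<partial>design_noise d) \<le> exp (2 * real d * v)"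
    using L2 iL2 by (simp add: nn_integral_eq_integral)
  then show "(\<integral>\<omega>. (lik_ratio d h \<omega> - 1)\<^sup>2 \<partial>design_noise d) \<le> exp (2 * real d * v) - 1"
    unfolding sq using iL2 iL eL by (simp add: P.prob_space)
qed

section \<open>Splitting into a sub-Gaussian part and a small remainder\<close>

text \<open>The likelihood ratio is truncated at \<open>e\<close>, which turns it into a Lipschitz function of the noise,
  and designs that put too many points on the support of \<open>h\<close> are discarded.\<close>

definition trunc_ratio :: "nat \<Rightarrow> (real \<Rightarrow> real) \<Rightarrow> (nat \<Rightarrow> real) \<times> (nat \<Rightarrow> real) \<Rightarrow> real" where
  "trunc_ratio d h \<omega> = min (lik_ratio d h \<omega>) (exp 1)"

definition main_part :: "nat \<Rightarrow> real \<Rightarrow> (real \<Rightarrow> real) \<Rightarrow> (nat \<Rightarrow> real) \<times> (nat \<Rightarrow> real) \<Rightarrow> real" where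
  "main_part d \<tau> h \<omega> = (if energy d h (fst \<omega>) \<le> \<tau>
     then trunc_ratio d h \<omega> - (\<integral>e. trunc_ratio d h (fst \<omega>, e) \<partial>PiM {1..d} (\<lambda>_. gauss)) else 0)"

definition rest_part :: "nat \<Rightarrow> real \<Rightarrow> (real \<Rightarrow> real) \<Rightarrow> (nat \<Rightarrow> real) \<times> (nat \<Rightarrow> real) \<Rightarrow> real" where
  "rest_part d \<tau> h \<omega> = lik_ratio d h \<omega> - 1 - main_part d \<tau> h \<omega>"

lemma trunc_ratio_bounds: "0 \<le> trunc_ratio d h \<omega>" "trunc_ratio d h \<omega> \<le> exp 1"
  using lik_ratio_pos[of d h \<omega>] by (auto simp: trunc_ratio_def)

lemma measurable_trunc_ratio [measurable]:
  assumes [measurable]: "h \<in> borel_measurable borel"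
  shows "trunc_ratio d h \<in> borel_measurable (design_noise d)"
  unfolding trunc_ratio_def by measurable

lemma measurable_trunc_mean [measurable]:
  assumes [measurable]: "h \<in> borel_measurable borel"
  shows "(\<lambda>t. \<integral>e. trunc_ratio d h (t, e) \<partial>PiM {1..d} (\<lambda>_. gauss)) \<in> borel_measurable (PiM {1..d} (\<lambda>_. borel))"
proof -
  interpret g: prob_space "PiM {1..d} (\<lambda>_. gauss)" by (intro prob_space_PiM prob_space_gauss)
  have "trunc_ratio d h \<in> borel_measurable (PiM {1..d} (\<lambda>_. unif) \<Otimes>\<^sub>M PiM {1..d} (\<lambda>_. gauss))"
    using measurable_trunc_ratio[OF assms, of d] by (simp add: design_noise_def)
  then have "(\<lambda>t. \<integral>e. trunc_ratio d h (t, e) \<partial>PiM {1..d} (\<lambda>_. gauss)) \<in> borel_measurable (PiM {1..d} (\<lambda>_. unif))"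
    by (intro g.borel_measurable_lebesgue_integral) (simp add: split_beta')
  moreover have "sets (PiM {1..d} (\<lambda>_. unif)) = sets (PiM {1..d} (\<lambda>_. borel))" by (intro sets_PiM_cong) auto
  ultimately show ?thesis by (simp cong: measurable_cong_sets)
qed

lemma measurable_main_part [measurable]:
  assumes [measurable]: "h \<in> borel_measurable borel"
  shows "main_part d \<tau> h \<in> borel_measurable (design_noise d)"
  unfolding main_part_def by measurable

lemma measurable_rest_part [measurable]:
  assumes [measurable]: "h \<in> borel_measurable borel"
  shows "rest_part d \<tau> h \<in> borel_measurable (design_noise d)"
  unfolding rest_part_def by measurable

lemma trunc_mean_bounds:
  "0 \<le> (\<integral>e. trunc_ratio d h (t, e) \<partial>PiM {1..d} (\<lambda>_. gauss))"
  "(\<integral>e. trunc_ratio d h (t, e) \<partial>PiM {1..d} (\<lambda>_. gauss)) \<le> exp 1"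
proof -
  interpret g: prob_space "PiM {1..d} (\<lambda>_. gauss)" by (intro prob_space_PiM prob_space_gauss)
  show "0 \<le> (\<integral>e. trunc_ratio d h (t, e) \<partial>PiM {1..d} (\<lambda>_. gauss))"
    by (simp add: trunc_ratio_bounds)
  have "(\<integral>e. trunc_ratio d h (t, e) \<partial>PiM {1..d} (\<lambda>_. gauss)) \<le> (\<integral>e. exp 1 \<partial>PiM {1..d} (\<lambda>_. gauss))"
    by (rule integral_mono') (auto simp: trunc_ratio_bounds)
  then show "(\<integral>e. trunc_ratio d h (t, e) \<partial>PiM {1..d} (\<lambda>_. gauss)) \<le> exp 1"
    by (simp add: g.prob_space)
qed

lemma main_part_bound: "\<bar>main_part d \<tau> h \<omega>\<bar> \<le> exp 1"
  using trunc_ratio_bounds[of d h \<omega>] trunc_mean_bounds[where d = d and h = h and t = "fst \<omega>"]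
  by (auto simp: main_part_def)

text \<open>Truncation of the ratio at \<open>exp 1\<close> is truncation of its logarithm at 1, and
  up to there \<open>exp\<close> has slope at most \<open>exp 1\<close>.\<close>

lemma exp_min_lipschitz: "\<bar>min (exp x) (exp 1) - min (exp y) (exp 1)\<bar> \<le> exp 1 * \<bar>x - y\<bar>" for x y :: real
proof -
  have *: "min (exp x) (exp 1) - min (exp y) (exp 1) \<le> exp 1 * (x - y)" if "y \<le> x" for x y :: real
  proof (cases "y \<le> 1")
    case True
    define z where "z = min x 1"
    have z: "y \<le> z" "z \<le> x" "z \<le> 1" "min (exp x) (exp 1) = exp z"
      using that True by (auto simp: z_def min_def)
    have "exp z - exp y = exp z * (1 - exp (y - z))" by (simp add: algebra_simps exp_diff)
    also have "\<dots> \<le> exp z * (z - y)"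
    proof (rule mult_left_mono)
      show "1 - exp (y - z) \<le> z - y" using exp_ge_add_one_self[of "y - z"] by linarith
    qed simp
    also have "\<dots> \<le> exp 1 * (x - y)" using z by (intro mult_mono) auto
    finally show ?thesis using z True by (simp add: min_def)
  next
    case False
    then show ?thesis using that by (simp add: min_def)
  qed
  show ?thesis
  proof (cases "y \<le> x")
    case True
    then have "min (exp y) (exp 1) \<le> min (exp x) (exp 1)" by (auto simp: min_def)
    with *[OF True] True show ?thesis by simp
  next
    case False
    then have "min (exp x) (exp 1) \<le> min (exp y) (exp 1)" by (auto simp: min_def)
    with *[of x y] False show ?thesis by simp
  qed
qed

text \<open>Given the design, the sum is a centred Lipschitz function of the noise, so the squared
  Lipschitz constants bound its exponential moment. At any design point at most one
  \<open>h k\<close> is nonzero, hence the constants square without cross terms and add up to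
  energies, each at most \<open>\<tau>\<close> for the hypotheses that are kept. Centring by the
  conditional mean, not by the overall mean, is what matches this bound.\<close>

lemma main_part_mgf:
  assumes fin: "finite S" and [measurable]: "\<And>k. k \<in> S \<Longrightarrow> h k \<in> borel_measurable borel" and "\<tau> \<ge> 0"
    and disj: "\<And>k k' x. k \<in> S \<Longrightarrow> k' \<in> S \<Longrightarrow> k \<noteq> k' \<Longrightarrow> h k x = 0 \<or> h k' x = 0"
  shows "integrable (design_noise d) (\<lambda>\<omega>. exp (\<Sum>k\<in>S. c k * main_part d \<tau> (h k) \<omega>))"
    and "(\<integral>\<omega>. exp (\<Sum>k\<in>S. c k * main_part d \<tau> (h k) \<omega>) \<partial>design_noise d)
      \<le> exp ((exp 1)\<^sup>2 * \<tau> * (\<Sum>k\<in>S. (c k)\<^sup>2))"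
proof -
  interpret P: prob_space "design_noise d" by (rule prob_space_design_noise)
  interpret g: prob_space "PiM {1..d} (\<lambda>_. gauss)" by (intro prob_space_PiM prob_space_gauss)
  interpret u: prob_space "PiM {1..d} (\<lambda>_. unif)" by (intro prob_space_PiM prob_space_unif)
  interpret PP: pair_prob_space "PiM {1..d} (\<lambda>_. unif)" "PiM {1..d} (\<lambda>_. gauss)" ..
  let ?F = "\<lambda>\<omega>. exp (\<Sum>k\<in>S. c k * main_part d \<tau> (h k) \<omega>)"
  have cbound: "\<bar>\<Sum>k\<in>S'. c k * a k\<bar> \<le> (\<Sum>k\<in>S. \<bar>c k\<bar> * exp 1)" if "S' \<subseteq> S" "\<And>k. \<bar>a k\<bar> \<le> exp 1" for S' a
  proof -
    have "\<bar>\<Sum>k\<in>S'. c k * a k\<bar> \<le> (\<Sum>k\<in>S'. \<bar>c k * a k\<bar>)" by (rule sum_abs)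
    also have "\<dots> \<le> (\<Sum>k\<in>S'. \<bar>c k\<bar> * exp 1)"
      using that(2) by (intro sum_mono) (simp add: abs_mult mult_left_mono)
    also have "\<dots> \<le> (\<Sum>k\<in>S. \<bar>c k\<bar> * exp 1)" using fin that(1) by (intro sum_mono2) auto
    finally show ?thesis .
  qed
  show iF: "integrable (design_noise d) ?F"
  proof (rule P.integrable_const_bound[where B = "exp (\<Sum>k\<in>S. \<bar>c k\<bar> * exp 1)"])
    show "AE \<omega> in design_noise d. norm (?F \<omega>) \<le> exp (\<Sum>k\<in>S. \<bar>c k\<bar> * exp 1)"
      using cbound[OF order_refl main_part_bound] by (auto intro!: AE_I2 simp: abs_le_iff)
  qed measurable
  have inner: "(\<integral>e. ?F (t, e) \<partial>PiM {1..d} (\<lambda>_. gauss)) \<le> exp ((exp 1)\<^sup>2 * \<tau> * (\<Sum>k\<in>S. (c k)\<^sup>2))"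
    if t: "t \<in> space (PiM {1..d} (\<lambda>_. unif))" for t
  proof -
    \<comment> \<open>The hypotheses for which this design is good; the main part of the others is
      0.\<close>
    define S' where "S' = {k \<in> S. energy d (h k) t \<le> \<tau>}"
    have S': "S' \<subseteq> S" "finite S'" using fin by (auto simp: S'_def)
    define F where "F e = (\<Sum>k\<in>S'. c k * trunc_ratio d (h k) (t, e))" for e
    define H where "H = (\<Sum>k\<in>S'. c k * (\<integral>e. trunc_ratio d (h k) (t, e) \<partial>PiM {1..d} (\<lambda>_. gauss)))"
    have mV: "(\<lambda>e. trunc_ratio d (h k) (t, e)) \<in> borel_measurable (PiM {1..d} (\<lambda>_. gauss))" if "k \<in> S'" for k
      by (rule measurable_noise_section[OF _ t]) (use that S' in \<open>auto intro!: measurable_trunc_ratio assms(2)\<close>)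
    have iV: "integrable (PiM {1..d} (\<lambda>_. gauss)) (\<lambda>e. trunc_ratio d (h k) (t, e))" if "k \<in> S'" for k
      by (rule g.integrable_const_bound[where B = "exp 1"])
        (use mV that in \<open>auto intro!: AE_I2 simp: trunc_ratio_bounds\<close>)
    have "(\<Sum>k\<in>S. c k * main_part d \<tau> (h k) (t, e)) = F e - H" for e
    proof -
      have "(\<Sum>k\<in>S. c k * main_part d \<tau> (h k) (t, e)) = (\<Sum>k\<in>S'. c k * main_part d \<tau> (h k) (t, e))"
        using fin by (intro sum.mono_neutral_right) (auto simp: S'_def main_part_def)
      also have "\<dots> = F e - H"
        unfolding F_def H_def sum_subtractf[symmetric]
        by (intro sum.cong refl) (auto simp: S'_def main_part_def algebra_simps)
      finally show ?thesis .
    qed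
    then have "(\<integral>e. ?F (t, e) \<partial>PiM {1..d} (\<lambda>_. gauss)) = (\<integral>e. exp (F e) \<partial>PiM {1..d} (\<lambda>_. gauss)) / exp H"
      by (simp add: exp_diff)
    also have "(\<integral>e. exp (F e) \<partial>PiM {1..d} (\<lambda>_. gauss))
      \<le> exp ((\<integral>e. F e \<partial>PiM {1..d} (\<lambda>_. gauss)) + (\<Sum>l\<in>{1..d}. (exp 1 * (\<Sum>k\<in>S'. \<bar>c k\<bar> * \<bar>h k (t l)\<bar>))\<^sup>2))"
    proof (rule lipschitz_exp_gauss_PiM[where b = "\<Sum>k\<in>S. \<bar>c k\<bar> * exp 1"])
      show "F \<in> borel_measurable (PiM {1..d} (\<lambda>_. gauss))"
        unfolding F_def by (intro borel_measurable_sum borel_measurable_times mV) auto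
      show "\<bar>F x\<bar> \<le> (\<Sum>k\<in>S. \<bar>c k\<bar> * exp 1)" for x
        unfolding F_def by (rule cbound[OF S'(1)]) (simp add: trunc_ratio_bounds)
      fix x :: "nat \<Rightarrow> real" and i r s assume i: "i \<in> {1..d}"
      have "\<bar>F (x(i := r)) - F (x(i := s))\<bar>
          = \<bar>\<Sum>k\<in>S'. c k * (trunc_ratio d (h k) (t, x(i := r)) - trunc_ratio d (h k) (t, x(i := s)))\<bar>"
        by (simp add: F_def sum_subtractf[symmetric] right_diff_distrib)
      also have "\<dots> \<le> (\<Sum>k\<in>S'. \<bar>c k * (trunc_ratio d (h k) (t, x(i := r)) - trunc_ratio d (h k) (t, x(i := s)))\<bar>)"
        by (rule sum_abs)
      also have "\<dots> \<le> (\<Sum>k\<in>S'. \<bar>c k\<bar> * (exp 1 * (\<bar>h k (t i)\<bar> * \<bar>r - s\<bar>)))"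
      proof (rule sum_mono)
        fix k
        have *: "(\<Sum>l\<in>{1..d}. h k (t l) * (x(i := r)) l) = (\<Sum>l\<in>{1..d} - {i}. h k (t l) * x l) + h k (t i) * r" for r
          using i by (subst sum.remove[of _ i]) (auto intro!: sum.cong)
        have "\<bar>trunc_ratio d (h k) (t, x(i := r)) - trunc_ratio d (h k) (t, x(i := s))\<bar>
           \<le> exp 1 * \<bar>((\<Sum>l\<in>{1..d}. h k (t l) * (x(i := r)) l) - energy d (h k) t / 2)
               - ((\<Sum>l\<in>{1..d}. h k (t l) * (x(i := s)) l) - energy d (h k) t / 2)\<bar>"
          unfolding trunc_ratio_def lik_ratio_def fst_conv snd_conv by (rule exp_min_lipschitz)
        also have "\<dots> = exp 1 * (\<bar>h k (t i)\<bar> * \<bar>r - s\<bar>)"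
          unfolding * by (simp add: abs_mult[symmetric] right_diff_distrib)
        finally show "\<bar>c k * (trunc_ratio d (h k) (t, x(i := r)) - trunc_ratio d (h k) (t, x(i := s)))\<bar>
            \<le> \<bar>c k\<bar> * (exp 1 * (\<bar>h k (t i)\<bar> * \<bar>r - s\<bar>))"
          by (simp add: abs_mult mult_left_mono)
      qed
      also have "\<dots> = exp 1 * (\<Sum>k\<in>S'. \<bar>c k\<bar> * \<bar>h k (t i)\<bar>) * \<bar>r - s\<bar>"
        by (simp add: sum_distrib_left sum_distrib_right mult_ac)
      finally show "\<bar>F (x(i := r)) - F (x(i := s))\<bar> \<le> exp 1 * (\<Sum>k\<in>S'. \<bar>c k\<bar> * \<bar>h k (t i)\<bar>) * \<bar>r - s\<bar>" .
    qed simp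
    also have "(\<integral>e. F e \<partial>PiM {1..d} (\<lambda>_. gauss)) = H"
      unfolding F_def H_def using iV by (subst Bochner_Integration.integral_sum) auto
    also have "(\<Sum>l\<in>{1..d}. (exp 1 * (\<Sum>k\<in>S'. \<bar>c k\<bar> * \<bar>h k (t l)\<bar>))\<^sup>2)
       = (exp 1)\<^sup>2 * (\<Sum>l\<in>{1..d}. \<Sum>k\<in>S'. (c k)\<^sup>2 * (h k (t l))\<^sup>2)"
    proof -
      have sq: "(\<Sum>k\<in>S'. \<bar>c k\<bar> * \<bar>h k x\<bar>)\<^sup>2 = (\<Sum>k\<in>S'. (c k)\<^sup>2 * (h k x)\<^sup>2)" for x
      proof (cases "\<exists>k\<in>S'. h k x \<noteq> 0")
        case True
        then obtain k where k: "k \<in> S'" "h k x \<noteq> 0" by auto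
        have z: "h k' x = 0" if "k' \<in> S' - {k}" for k' using disj[of k k' x] k that S' by auto
        have "(\<Sum>k\<in>S'. \<bar>c k\<bar> * \<bar>h k x\<bar>) = \<bar>c k\<bar> * \<bar>h k x\<bar>"
          using S' k z by (subst sum.remove[of _ k]) auto
        moreover have "(\<Sum>k\<in>S'. (c k)\<^sup>2 * (h k x)\<^sup>2) = (c k)\<^sup>2 * (h k x)\<^sup>2"
          using S' k z by (subst sum.remove[of _ k]) auto
        ultimately show ?thesis by (simp add: power_mult_distrib)
      qed auto
      show ?thesis by (simp only: power_mult_distrib sq sum_distrib_left[symmetric])
    qed
    also have "(\<Sum>l\<in>{1..d}. \<Sum>k\<in>S'. (c k)\<^sup>2 * (h k (t l))\<^sup>2) = (\<Sum>k\<in>S'. (c k)\<^sup>2 * energy d (h k) t)"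
      by (subst sum.swap) (simp add: energy_def sum_distrib_left)
    finally have "(\<integral>e. ?F (t, e) \<partial>PiM {1..d} (\<lambda>_. gauss))
        \<le> exp (H + (exp 1)\<^sup>2 * (\<Sum>k\<in>S'. (c k)\<^sup>2 * energy d (h k) t)) / exp H"
      by (simp add: divide_right_mono)
    also have "\<dots> = exp ((exp 1)\<^sup>2 * (\<Sum>k\<in>S'. (c k)\<^sup>2 * energy d (h k) t))"
      by (simp add: exp_add)
    also have "(\<Sum>k\<in>S'. (c k)\<^sup>2 * energy d (h k) t) \<le> (\<Sum>k\<in>S'. (c k)\<^sup>2 * \<tau>)"
      by (intro sum_mono mult_left_mono) (auto simp: S'_def)
    also have "\<dots> \<le> (\<Sum>k\<in>S. (c k)\<^sup>2 * \<tau>)"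
      using \<open>\<tau> \<ge> 0\<close> fin S' by (intro sum_mono2) auto
    also have "\<dots> = \<tau> * (\<Sum>k\<in>S. (c k)\<^sup>2)" by (simp add: sum_distrib_left mult.commute)
    finally show ?thesis by (simp add: mult.assoc)
  qed
  have iF': "integrable (PiM {1..d} (\<lambda>_. unif) \<Otimes>\<^sub>M PiM {1..d} (\<lambda>_. gauss)) ?F"
    using iF by (simp add: design_noise_def)
  have "(\<integral>\<omega>. ?F \<omega> \<partial>design_noise d)
      = (\<integral>t. \<integral>e. ?F (t, e) \<partial>PiM {1..d} (\<lambda>_. gauss) \<partial>PiM {1..d} (\<lambda>_. unif))"
    unfolding design_noise_def by (rule PP.integral_fst'[OF iF', symmetric])
  also have "\<dots> \<le> (\<integral>t. exp ((exp 1)\<^sup>2 * \<tau> * (\<Sum>k\<in>S. (c k)\<^sup>2)) \<partial>PiM {1..d} (\<lambda>_. unif))"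
    by (rule integral_mono) (use inner PP.integrable_fst'[OF iF'] in auto)
  finally show "(\<integral>\<omega>. ?F \<omega> \<partial>design_noise d) \<le> exp ((exp 1)\<^sup>2 * \<tau> * (\<Sum>k\<in>S. (c k)\<^sup>2))"
    by (simp add: u.prob_space)
qed

text \<open>The two summands of \<open>\<epsilon>\<close> belong to the two sources of error. For a
  good design only the region where the ratio \<open>L\<close> exceeds \<open>exp 1\<close> counts,
  and there \<open>L\<^sup>2 \<le> exp (- r) * L powr (2 + r)\<close>. For a bad design the full
  second moment is paid, and a Chernoff bound with exponent \<open>r'\<close> makes its average over
  such designs small.\<close>

lemma rest_part_second_moment:
  fixes d :: nat
  assumes [measurable]: "h \<in> borel_measurable borel" and r: "r \<ge> 0" and \<tau>: "\<tau> \<ge> 0"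
    and r': "r' \<ge> 1" and hb: "\<And>x. r' * (h x)\<^sup>2 \<le> 1"
    and v: "(\<integral>\<^sup>+x. ennreal ((h x)\<^sup>2) \<partial>unif) \<le> ennreal v" and "v \<ge> 0"
  defines "\<epsilon> \<equiv> exp ((2 + r) * (1 + r) * \<tau> / 2 - r) + exp (2 * r' * real d * v - (r' - 1) * \<tau>)"
  shows "integrable (design_noise d) (\<lambda>\<omega>. (rest_part d \<tau> h \<omega>)\<^sup>2)"
    and "(\<integral>\<omega>. (rest_part d \<tau> h \<omega>)\<^sup>2 \<partial>design_noise d) \<le> \<epsilon>"
proof -
  let ?G = "PiM {1..d} (\<lambda>_. gauss)"
  let ?U = "PiM {1..d} (\<lambda>_. unif)"
  interpret P: prob_space "design_noise d" by (rule prob_space_design_noise)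
  interpret g: prob_space ?G by (intro prob_space_PiM prob_space_gauss)
  interpret u: prob_space ?U by (intro prob_space_PiM prob_space_unif)
  have [measurable_cong]: "sets ?U = sets (PiM {1..d} (\<lambda>_. borel))" by (intro sets_PiM_cong) auto
  have inner: "(\<integral>\<^sup>+e. ennreal ((rest_part d \<tau> h (t, e))\<^sup>2) \<partial>?G)
      \<le> ennreal (exp ((2 + r) * (1 + r) * \<tau> / 2 - r)) + ennreal (exp (- (r' - 1) * \<tau>)) * ennreal (exp (r' * energy d h t))"
    (is "_ \<le> ?a + ?b t") if t: "t \<in> space ?U" for t
  proof -
    let ?L = "\<lambda>e. lik_ratio d h (t, e)"
    have [measurable]: "?L \<in> borel_measurable ?G"
      by (rule measurable_noise_section[OF _ t]) measurable
    have iL: "integrable ?G ?L"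
      by (rule integrableI_bounded) (auto simp: nn_integral_lik_ratio lik_ratio_pos less_imp_le)
    have eL: "(\<integral>e. ?L e \<partial>?G) = 1"
      by (subst integral_eq_nn_integral) (auto simp: nn_integral_lik_ratio lik_ratio_pos less_imp_le)
    have pw: "exp (a * ln (?L e)) = ?L e powr a" for a e
      using lik_ratio_pos[of d h "(t, e)"] by (simp add: powr_def)
    have L2: "(\<integral>\<^sup>+e. ennreal ((?L e)\<^sup>2) \<partial>?G) = ennreal (exp (energy d h t))"
    proof -
      have "(?L e)\<^sup>2 = exp (2 * ln (?L e))" for e
        using lik_ratio_pos[of d h "(t, e)"] by (simp add: exp_double)
      then show ?thesis using nn_integral_lik_ratio_power[where r = 2 and d = d and h = h and t = t] by simp
    qed
    have iL2: "integrable ?G (\<lambda>e. (?L e)\<^sup>2)"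
      by (rule integrableI_bounded) (auto simp: L2)
    have var: "(\<integral>e. (X e - (\<integral>e. X e \<partial>?G))\<^sup>2 \<partial>?G) \<le> (\<integral>e. (X e)\<^sup>2 \<partial>?G)"
      "integrable ?G (\<lambda>e. (X e - c)\<^sup>2)"
      if [measurable]: "X \<in> borel_measurable ?G" and i2: "integrable ?G (\<lambda>e. (X e)\<^sup>2)" for X :: "(nat \<Rightarrow> real) \<Rightarrow> real" and c
    proof -
      have i1: "integrable ?G X" using that by (rule g.square_integrable_imp_integrable)
      show "(\<integral>e. (X e - (\<integral>e. X e \<partial>?G))\<^sup>2 \<partial>?G) \<le> (\<integral>e. (X e)\<^sup>2 \<partial>?G)"
        using g.variance_eq[OF i1 i2] by simp
      show "integrable ?G (\<lambda>e. (X e - c)\<^sup>2)" using i1 i2 by (simp add: power2_diff)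
    qed
    show ?thesis
    proof (cases "energy d h t \<le> \<tau>")
      case True
      let ?X = "\<lambda>e. ?L e - trunc_ratio d h (t, e)"
      have [measurable]: "(\<lambda>e. trunc_ratio d h (t, e)) \<in> borel_measurable ?G"
        unfolding trunc_ratio_def by measurable
      have iV: "integrable ?G (\<lambda>e. trunc_ratio d h (t, e))"
        by (rule g.integrable_const_bound[where B = "exp 1"])
          (auto intro!: AE_I2 simp: trunc_ratio_bounds)
      have X: "(?X e)\<^sup>2 \<le> (?L e)\<^sup>2" for e
        using lik_ratio_pos[of d h "(t, e)"] by (intro power_mono) (auto simp: trunc_ratio_def)
      have iX2: "integrable ?G (\<lambda>e. (?X e)\<^sup>2)"
        by (rule Bochner_Integration.integrable_bound[OF iL2]) (use X in \<open>auto intro!: AE_I2\<close>)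
      have eX: "(\<integral>e. ?X e \<partial>?G) = 1 - (\<integral>e. trunc_ratio d h (t, e) \<partial>?G)"
        using iL iV eL by simp
      \<comment> \<open>The ratio has conditional mean 1, so the remainder is the truncation error
        \<open>?X\<close> minus its own mean, and its variance is at most the second moment of
        \<open>?X\<close>.\<close>
      have rest: "rest_part d \<tau> h (t, e) = ?X e - (\<integral>e. ?X e \<partial>?G)" for e
        unfolding eX using True by (simp add: rest_part_def main_part_def)
      have "(\<integral>\<^sup>+e. ennreal ((rest_part d \<tau> h (t, e))\<^sup>2) \<partial>?G) = ennreal (\<integral>e. (?X e - (\<integral>e. ?X e \<partial>?G))\<^sup>2 \<partial>?G)"
        unfolding rest using iX2 by (intro nn_integral_eq_integral var) auto
      also have "\<dots> \<le> ennreal (\<integral>e. (?X e)\<^sup>2 \<partial>?G)"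
        using iX2 by (intro ennreal_leI var) auto
      also have "\<dots> = (\<integral>\<^sup>+e. ennreal ((?X e)\<^sup>2) \<partial>?G)"
        using iX2 by (intro nn_integral_eq_integral[symmetric]) auto
      also have "\<dots> \<le> (\<integral>\<^sup>+e. ennreal (exp (- r)) * ennreal (exp ((2 + r) * ln (?L e))) \<partial>?G)"
      proof (rule nn_integral_mono)
        fix e
        have "(?X e)\<^sup>2 \<le> exp (- r) * exp ((2 + r) * ln (?L e))"
        proof (cases "?L e \<le> exp 1")
          case True
          then show ?thesis by (simp add: trunc_ratio_def)
        next
          case False
          then have "1 \<le> ln (?L e)" using ln_le_cancel_iff[of "exp 1" "?L e"] lik_ratio_pos[of d h "(t, e)"] by simp
          then have "r * 1 \<le> r * ln (?L e)" using r by (rule mult_left_mono)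
          then have le: "2 * ln (?L e) \<le> - r + (2 + r) * ln (?L e)" by (simp add: algebra_simps)
          have "(?X e)\<^sup>2 \<le> (?L e)\<^sup>2" by (rule X)
          also have "\<dots> = exp (2 * ln (?L e))"
            using lik_ratio_pos[of d h "(t, e)"] by (simp add: exp_double)
          also have "\<dots> \<le> exp (- r + (2 + r) * ln (?L e))" using le by (simp only: exp_le_cancel_iff)
          also have "\<dots> = exp (- r) * exp ((2 + r) * ln (?L e))" by (simp only: exp_add)
          finally show ?thesis .
        qed
        then show "ennreal ((?X e)\<^sup>2) \<le> ennreal (exp (- r)) * ennreal (exp ((2 + r) * ln (?L e)))"
          by (simp add: ennreal_mult[symmetric] ennreal_leI)
      qed
      also have "\<dots> = ennreal (exp (- r)) * ennreal (exp ((2 + r) * (2 + r - 1) * energy d h t / 2))"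
        by (subst nn_integral_cmult) (auto simp: nn_integral_lik_ratio_power[where r = "2 + r"])
      also have "\<dots> = ennreal (exp ((2 + r) * (1 + r) * energy d h t / 2 - r))"
        by (simp add: ennreal_mult[symmetric] exp_add[symmetric] algebra_simps)
      also have "\<dots> \<le> ?a"
        using True r by (intro ennreal_leI) (simp add: mult_left_mono divide_right_mono)
      also have "\<dots> \<le> ?a + ?b t" by simp
      finally show ?thesis .
    next
      case False
      then have rest: "rest_part d \<tau> h (t, e) = ?L e - (\<integral>e. ?L e \<partial>?G)" for e
        by (simp add: rest_part_def main_part_def eL)
      have "(\<integral>\<^sup>+e. ennreal ((rest_part d \<tau> h (t, e))\<^sup>2) \<partial>?G) = ennreal (\<integral>e. (?L e - (\<integral>e. ?L e \<partial>?G))\<^sup>2 \<partial>?G)"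
        unfolding rest using iL2 by (intro nn_integral_eq_integral var) auto
      also have "\<dots> \<le> ennreal (\<integral>e. (?L e)\<^sup>2 \<partial>?G)"
        using iL2 by (intro ennreal_leI var) auto
      also have "\<dots> = ennreal (exp (energy d h t))"
        using iL2 L2 by (subst nn_integral_eq_integral[symmetric]) auto
      \<comment> \<open>Chernoff: here the energy exceeds \<open>\<tau>\<close>, so
        \<open>(r' - 1) * (energy d h t - \<tau>)\<close> may be added to the exponent.\<close>
      also have "\<dots> \<le> ennreal (exp (- (r' - 1) * \<tau> + r' * energy d h t))"
      proof (intro ennreal_leI)
        have "(r' - 1) * \<tau> \<le> (r' - 1) * energy d h t" using False r' by (intro mult_left_mono) auto
        then show "exp (energy d h t) \<le> exp (- (r' - 1) * \<tau> + r' * energy d h t)" by (simp add: algebra_simps)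
      qed
      also have "\<dots> = ?b t" by (simp only: exp_add ennreal_mult exp_ge_zero)
      also have "\<dots> \<le> ?a + ?b t" by simp
      finally show ?thesis .
    qed
  qed
  have "(\<integral>\<^sup>+\<omega>. ennreal ((rest_part d \<tau> h \<omega>)\<^sup>2) \<partial>design_noise d)
      = (\<integral>\<^sup>+t. \<integral>\<^sup>+e. ennreal ((rest_part d \<tau> h (t, e))\<^sup>2) \<partial>?G \<partial>?U)"
    by (rule nn_integral_design_noise) measurable
  also have "\<dots> \<le> (\<integral>\<^sup>+t. ennreal (exp ((2 + r) * (1 + r) * \<tau> / 2 - r))
      + ennreal (exp (- (r' - 1) * \<tau>)) * ennreal (exp (r' * energy d h t)) \<partial>?U)"
    by (rule nn_integral_mono) (rule inner)
  also have "\<dots> = ennreal (exp ((2 + r) * (1 + r) * \<tau> / 2 - r))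
      + ennreal (exp (- (r' - 1) * \<tau>)) * (\<integral>\<^sup>+t. ennreal (exp (r' * energy d h t)) \<partial>?U)"
    by (subst nn_integral_add) (auto simp: nn_integral_cmult u.emeasure_space_1)
  also have "\<dots> \<le> ennreal (exp ((2 + r) * (1 + r) * \<tau> / 2 - r))
      + ennreal (exp (- (r' - 1) * \<tau>)) * ennreal (exp (2 * r' * real d * v))"
    by (intro add_left_mono mult_left_mono nn_integral_exp_energy) (use assms in auto)
  also have "\<dots> = ennreal \<epsilon>"
    unfolding \<epsilon>_def by (simp add: ennreal_mult[symmetric] exp_add[symmetric] algebra_simps)
  finally have R2: "(\<integral>\<^sup>+\<omega>. ennreal ((rest_part d \<tau> h \<omega>)\<^sup>2) \<partial>design_noise d) \<le> ennreal \<epsilon>" .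
  show i: "integrable (design_noise d) (\<lambda>\<omega>. (rest_part d \<tau> h \<omega>)\<^sup>2)"
    by (rule integrableI_bounded) (use R2 in \<open>auto intro: le_less_trans\<close>)
  have "\<epsilon> \<ge> 0" by (simp add: \<epsilon>_def)
  then show "(\<integral>\<omega>. (rest_part d \<tau> h \<omega>)\<^sup>2 \<partial>design_noise d) \<le> \<epsilon>"
    using R2 i by (simp add: nn_integral_eq_integral)
qed

section \<open>Chi-square divergences of the messages of one machine\<close>

definition msg_prob :: "real \<Rightarrow> nat \<Rightarrow> nat \<Rightarrow> (real \<Rightarrow> real) \<Rightarrow> ((nat \<Rightarrow> real \<times> real) \<Rightarrow> 'b) \<Rightarrow> 'b \<Rightarrow> real" where
  "msg_prob \<sigma> n m f Y z = measure (local_law \<sigma> n m f) (Y -` {z} \<inter> space (local_law \<sigma> n m f))"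

text \<open>A string of null probability contributes \<open>x / 0 = 0\<close>; its probability under
  \<open>f\<close> vanishes as well, by \<open>msg_prob_absolutely_continuous\<close>.\<close>

definition msg_chi :: "real \<Rightarrow> nat \<Rightarrow> nat \<Rightarrow> (real \<Rightarrow> real) \<Rightarrow> ((nat \<Rightarrow> real \<times> real) \<Rightarrow> 'b) \<Rightarrow> ennreal" where
  "msg_chi \<sigma> n m f Y = (\<integral>\<^sup>+z. ennreal ((msg_prob \<sigma> n m f Y z - msg_prob \<sigma> n m (\<lambda>_. 0) Y z)\<^sup>2
      / msg_prob \<sigma> n m (\<lambda>_. 0) Y z) \<partial>count_space UNIV)"

lemma integrable_lik_ratio:
  assumes [measurable]: "h \<in> borel_measurable borel"
  shows "integrable (design_noise d) (lik_ratio d h)"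
proof -
  interpret u: prob_space "PiM {1..d} (\<lambda>_. unif)" by (intro prob_space_PiM prob_space_unif)
  have "(\<integral>\<^sup>+\<omega>. ennreal (lik_ratio d h \<omega>) \<partial>design_noise d) = 1"
    by (subst nn_integral_design_noise) (simp_all add: nn_integral_lik_ratio u.emeasure_space_1)
  then show ?thesis
    by (intro integrableI_bounded) (auto simp: lik_ratio_pos less_imp_le)
qed

context
  fixes \<sigma> :: real and n m :: nat and Y :: "(nat \<Rightarrow> real \<times> real) \<Rightarrow> 'b :: countable"
  assumes \<sigma>: "\<sigma> > 0" and Y [measurable]: "Y \<in> PiM {1..n div m} (\<lambda>_. borel) \<rightarrow>\<^sub>M count_space UNIV"
begin

private abbreviation "d \<equiv> n div m"
private abbreviation "P \<equiv> design_noise d"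
private abbreviation "Y' \<equiv> \<lambda>\<omega>. Y (null_sample \<sigma> d \<omega>)"

lemma measurable_null_message [measurable]: "Y' \<in> P \<rightarrow>\<^sub>M count_space UNIV"
  by measurable

lemma fibre_in_sets: "Y -` {z} \<inter> space (PiM {1..d} (\<lambda>_. borel)) \<in> sets (PiM {1..d} (\<lambda>_. borel))"
  by measurable

lemma msg_prob_eq_integral:
  assumes [measurable]: "f \<in> borel_measurable borel"
  shows "msg_prob \<sigma> n m f Y z
    = (\<integral>\<omega>. lik_ratio d (\<lambda>t. f t / \<sigma>) \<omega> * indicator (Y' -` {z} \<inter> space P) \<omega> \<partial>P)"
proof -
  let ?A = "Y -` {z} \<inter> space (PiM {1..d} (\<lambda>_. borel))"
  let ?L = "lik_ratio d (\<lambda>t. f t / \<sigma>)"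
  have Ez: "Y' -` {z} \<inter> space P \<in> sets P" by measurable
  have i: "integrable P (\<lambda>\<omega>. ?L \<omega> * indicator (Y' -` {z} \<inter> space P) \<omega>)"
    by (rule integrable_real_mult_indicator[OF Ez]) (rule integrable_lik_ratio, measurable)
  have "emeasure (local_law \<sigma> n m f) ?A
      = (\<integral>\<^sup>+\<omega>. ennreal (?L \<omega>) * indicator ?A (null_sample \<sigma> d \<omega>) \<partial>P)"
    by (rule emeasure_local_law[OF assms \<sigma> fibre_in_sets])
  also have "\<dots> = (\<integral>\<^sup>+\<omega>. ennreal (?L \<omega> * indicator (Y' -` {z} \<inter> space P) \<omega>) \<partial>P)"
    using measurable_space[OF measurable_null_sample, of _ d \<sigma>]
    by (intro nn_integral_cong) (auto simp: indicator_def)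
  also have "\<dots> = ennreal (\<integral>\<omega>. ?L \<omega> * indicator (Y' -` {z} \<inter> space P) \<omega> \<partial>P)"
    by (rule nn_integral_eq_integral[OF i]) (auto simp: lik_ratio_pos less_imp_le)
  finally show ?thesis
    by (simp add: msg_prob_def measure_def space_local_law lik_ratio_pos less_imp_le)
qed

lemma msg_prob_null: "msg_prob \<sigma> n m (\<lambda>_. 0) Y z = measure P (Y' -` {z} \<inter> space P)"
proof -
  interpret P: prob_space P by (rule prob_space_design_noise)
  have "lik_ratio d (\<lambda>t. 0 / \<sigma>) \<omega> = 1" for \<omega> by (simp add: lik_ratio_def energy_def)
  then show ?thesis by (subst msg_prob_eq_integral) auto
qed

lemma msg_prob_diff:
  assumes [measurable]: "f \<in> borel_measurable borel"
  shows "msg_prob \<sigma> n m f Y z - msg_prob \<sigma> n m (\<lambda>_. 0) Y z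
    = (\<integral>\<omega>. (lik_ratio d (\<lambda>t. f t / \<sigma>) \<omega> - 1) * indicator (Y' -` {z} \<inter> space P) \<omega> \<partial>P)"
proof -
  interpret P: prob_space P by (rule prob_space_design_noise)
  have Ez: "Y' -` {z} \<inter> space P \<in> sets P" by measurable
  have "integrable P (\<lambda>\<omega>. lik_ratio d (\<lambda>t. f t / \<sigma>) \<omega> * indicator (Y' -` {z} \<inter> space P) \<omega>)"
    by (rule integrable_real_mult_indicator[OF Ez]) (rule integrable_lik_ratio, measurable)
  then show ?thesis
    unfolding msg_prob_eq_integral[OF assms] msg_prob_null left_diff_distrib mult_1
    using Ez by (subst Bochner_Integration.integral_diff)
      (auto simp: integrable_real_indicator less_top[symmetric])
qed

lemma msg_chi_eq:
  assumes "f \<in> borel_measurable borel"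
  shows "msg_chi \<sigma> n m f Y = chi P Y' (\<lambda>\<omega>. lik_ratio d (\<lambda>t. f t / \<sigma>) \<omega> - 1)"
  unfolding msg_chi_def chi_def chi_term_def msg_prob_diff[OF assms] unfolding msg_prob_null ..

text \<open>Message probabilities under \<open>f\<close> are integrals of a density over the fibres,
  so null strings stay null. This is why second moments against the null law lose no mass to
  \<open>x / 0 = 0\<close>.\<close>

lemma msg_prob_absolutely_continuous:
  assumes [measurable]: "f \<in> borel_measurable borel" and "msg_prob \<sigma> n m (\<lambda>_. 0) Y z = 0"
  shows "msg_prob \<sigma> n m f Y z = 0"
proof -
  interpret P: prob_space P by (rule prob_space_design_noise)
  have "emeasure P (Y' -` {z} \<inter> space P) = 0"
    using assms(2) by (simp add: msg_prob_null P.emeasure_eq_measure)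
  then have "AE \<omega> in P. \<omega> \<notin> Y' -` {z} \<inter> space P"
    by (intro AE_not_in) (auto simp: null_sets_def)
  then have "AE \<omega> in P. lik_ratio d (\<lambda>t. f t / \<sigma>) \<omega> * indicator (Y' -` {z} \<inter> space P) \<omega> = 0"
    by eventually_elim (auto simp: indicator_def)
  then show ?thesis
    unfolding msg_prob_eq_integral[OF assms(1)] by (rule integral_eq_zero_AE)
qed

lemma msg_prob_sum:
  assumes "f \<in> borel_measurable borel"
  shows "(\<integral>\<^sup>+z. ennreal (msg_prob \<sigma> n m f Y z) \<partial>count_space UNIV) = 1"
proof -
  interpret Q: prob_space "local_law \<sigma> n m f" by (rule prob_space_local_law[OF assms])
  have "Y \<in> local_law \<sigma> n m f \<rightarrow>\<^sub>M count_space UNIV" by measurable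
  then show ?thesis
    using Q.nn_integral_fibres_prob[of Y "\<lambda>_. 1"] by (simp add: msg_prob_def Q.emeasure_space_1)
qed

lemma msg_second_moment:
  assumes f: "f \<in> borel_measurable borel"
  shows "(\<integral>\<^sup>+z. ennreal ((msg_prob \<sigma> n m f Y z)\<^sup>2 / msg_prob \<sigma> n m (\<lambda>_. 0) Y z) \<partial>count_space UNIV)
    = 1 + msg_chi \<sigma> n m f Y"
proof -
  let ?p = "msg_prob \<sigma> n m f Y" and ?q = "msg_prob \<sigma> n m (\<lambda>_. 0) Y"
  have nn: "?p z \<ge> 0" "?q z \<ge> 0" for z by (simp_all add: msg_prob_def)
  \<comment> \<open>The expansion of \<open>(p - q)\<^sup>2 / q\<close>, rearranged so that only
    nonnegative terms occur; after summation a common 1 is cancelled.\<close>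
  have "ennreal ((?p z)\<^sup>2 / ?q z) + ennreal (?q z) = 2 * ennreal (?p z) + ennreal ((?p z - ?q z)\<^sup>2 / ?q z)" for z
  proof -
    have "(?p z)\<^sup>2 / ?q z + ?q z = 2 * ?p z + (?p z - ?q z)\<^sup>2 / ?q z"
      using msg_prob_absolutely_continuous[OF f, of z]
      by (cases "?q z = 0") (auto simp: power2_eq_square field_simps)
    then have "ennreal ((?p z)\<^sup>2 / ?q z + ?q z) = ennreal (2 * ?p z + (?p z - ?q z)\<^sup>2 / ?q z)" by simp
    then show ?thesis using nn by (simp add: ennreal_mult')
  qed
  then have "(\<integral>\<^sup>+z. ennreal ((?p z)\<^sup>2 / ?q z) + ennreal (?q z) \<partial>count_space UNIV)
     = (\<integral>\<^sup>+z. 2 * ennreal (?p z) + ennreal ((?p z - ?q z)\<^sup>2 / ?q z) \<partial>count_space UNIV)"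
    by simp
  then have "(\<integral>\<^sup>+z. ennreal ((?p z)\<^sup>2 / ?q z) \<partial>count_space UNIV) + 1 = 2 + msg_chi \<sigma> n m f Y"
    using msg_prob_sum[OF f] msg_prob_sum[of "\<lambda>_. 0"]
    by (simp add: nn_integral_add nn_integral_cmult msg_chi_def)
  also have "2 + msg_chi \<sigma> n m f Y = (1 + msg_chi \<sigma> n m f Y) + 1"
    by (simp add: add.commute add.left_commute flip: one_add_one)
  finally show ?thesis by (simp add: add.commute[of _ 1] ennreal_add_left_cancel)
qed

text \<open>Valid for messages of any length, by data processing. It yields the first rate and, in
  the second, covers the machines with a large budget.\<close>

lemma msg_chi_le_energy:
  assumes [measurable]: "f \<in> borel_measurable borel" and fb: "\<And>x. (f x / \<sigma>)\<^sup>2 \<le> 1"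
    and v: "(\<integral>\<^sup>+x. ennreal ((f x / \<sigma>)\<^sup>2) \<partial>unif) \<le> ennreal v" and "v \<ge> 0"
  shows "msg_chi \<sigma> n m f Y \<le> ennreal (exp (2 * real d * v) - 1)"
proof -
  interpret P: prob_space P by (rule prob_space_design_noise)
  have [measurable]: "(\<lambda>t. f t / \<sigma>) \<in> borel_measurable borel" by measurable
  note L = lik_ratio_second_moment[OF this fb v \<open>v \<ge> 0\<close>, of d]
  have "msg_chi \<sigma> n m f Y \<le> ennreal (\<integral>\<omega>. (lik_ratio d (\<lambda>t. f t / \<sigma>) \<omega> - 1)\<^sup>2 \<partial>P)"
    unfolding msg_chi_eq[OF assms(1)] by (rule P.chi_le_second_moment[OF _ _ L(1)]) measurable
  also have "\<dots> \<le> ennreal (exp (2 * real d * v) - 1)" by (rule ennreal_leI) (rule L(2))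
  finally show ?thesis .
qed

end

text \<open>\<open>main_part\<close> takes the sub-Gaussian role with constant
  \<open>(exp 1)\<^sup>2 * \<tau>\<close>, and \<open>rest_part\<close> the role of the remainder.
  The length is measured under \<open>f = 0\<close> because the fibre probabilities in the entropy
  bound are those of the null law.\<close>

lemma sum_msg_chi_le:
  fixes f :: "'k \<Rightarrow> real \<Rightarrow> real" and Y :: "(nat \<Rightarrow> real \<times> real) \<Rightarrow> bool list"
  assumes \<sigma>: "\<sigma> > 0" and Y [measurable]: "Y \<in> PiM {1..n div m} (\<lambda>_. borel) \<rightarrow>\<^sub>M count_space UNIV"
    and fin: "finite S" and mf [measurable]: "\<And>k. k \<in> S \<Longrightarrow> f k \<in> borel_measurable borel"
    and disj: "\<And>k k' x. k \<in> S \<Longrightarrow> k' \<in> S \<Longrightarrow> k \<noteq> k' \<Longrightarrow> f k x = 0 \<or> f k' x = 0"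
    and \<tau>: "\<tau> > 0" and r: "r \<ge> 0" and r': "r' \<ge> 1" and v0: "v \<ge> 0"
    and fb: "\<And>k x. k \<in> S \<Longrightarrow> r' * (f k x / \<sigma>)\<^sup>2 \<le> 1"
    and v: "\<And>k. k \<in> S \<Longrightarrow> (\<integral>\<^sup>+x. ennreal ((f k x / \<sigma>)\<^sup>2) \<partial>unif) \<le> ennreal v"
    and len: "(\<integral>\<^sup>+x. ennreal (real (length (Y x))) \<partial>local_law \<sigma> n m (\<lambda>_. 0)) \<le> ennreal b"
    and b: "b \<ge> 0" and \<nu>: "\<nu> \<ge> 1"
  shows "(\<Sum>k\<in>S. msg_chi \<sigma> n m (f k) Y)
    \<le> ennreal (8 * ((exp 1)\<^sup>2 * \<tau>) * ((3 + ln \<nu>) * b + 1 / \<nu>) + 2 * real (card S)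
        * (exp ((2 + r) * (1 + r) * \<tau> / 2 - r) + exp (2 * r' * real (n div m) * v - (r' - 1) * \<tau>)))"
proof -
  let ?d = "n div m"
  let ?h = "\<lambda>k t. f k t / \<sigma>"
  interpret P: prob_space "design_noise ?d" by (rule prob_space_design_noise)
  have mh [measurable]: "?h k \<in> borel_measurable borel" if "k \<in> S" for k
    using mf[OF that] by measurable
  have len': "(\<integral>\<^sup>+\<omega>. ennreal (real (length (Y (null_sample \<sigma> ?d \<omega>)))) \<partial>design_noise ?d) \<le> ennreal b"
    using len unfolding local_law_null by (subst (asm) nn_integral_distr) auto
  have "(\<Sum>k\<in>S. msg_chi \<sigma> n m (f k) Y)
      = (\<Sum>k\<in>S. chi (design_noise ?d) (\<lambda>\<omega>. Y (null_sample \<sigma> ?d \<omega>))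
          (\<lambda>\<omega>. main_part ?d \<tau> (?h k) \<omega> + rest_part ?d \<tau> (?h k) \<omega>))"
    by (intro sum.cong refl) (simp add: msg_chi_eq[OF \<sigma> Y mf] rest_part_def)
  also have "\<dots> \<le> ennreal (8 * ((exp 1)\<^sup>2 * \<tau>) * ((3 + ln \<nu>) * b + 1 / \<nu>) + 2 * real (card S)
        * (exp ((2 + r) * (1 + r) * \<tau> / 2 - r) + exp (2 * r' * real ?d * v - (r' - 1) * \<tau>)))"
  proof (rule P.sum_chi_binary_message)
    show "(\<lambda>\<omega>. Y (null_sample \<sigma> ?d \<omega>)) \<in> design_noise ?d \<rightarrow>\<^sub>M count_space UNIV" by measurable
    have disj': "\<And>k k' x. k \<in> S \<Longrightarrow> k' \<in> S \<Longrightarrow> k \<noteq> k' \<Longrightarrow> ?h k x = 0 \<or> ?h k' x = 0"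
      using disj by fastforce
    show "integrable (design_noise ?d) (\<lambda>\<omega>. exp (\<Sum>k\<in>S. c k * main_part ?d \<tau> (?h k) \<omega>))" for c
      by (rule main_part_mgf(1)[OF fin mh _ disj']) (use \<tau> in auto)
    show "(\<integral>\<omega>. exp (\<Sum>k\<in>S. c k * main_part ?d \<tau> (?h k) \<omega>) \<partial>design_noise ?d)
        \<le> exp ((exp 1)\<^sup>2 * \<tau> * (\<Sum>k\<in>S. (c k)\<^sup>2))" for c
      by (rule main_part_mgf(2)[OF fin mh _ disj']) (use \<tau> in auto)
    show "integrable (design_noise ?d) (main_part ?d \<tau> (?h k))" if "k \<in> S" for k
      by (rule P.integrable_const_bound[where B = "exp 1"])
        (use measurable_main_part[OF mh[OF that]] main_part_bound in \<open>auto intro!: AE_I2\<close>)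
    show "rest_part ?d \<tau> (?h k) \<in> borel_measurable (design_noise ?d)" if "k \<in> S" for k
      by (rule measurable_rest_part[OF mh[OF that]])
    show "integrable (design_noise ?d) (\<lambda>\<omega>. (rest_part ?d \<tau> (?h k) \<omega>)\<^sup>2)" if "k \<in> S" for k
      by (rule rest_part_second_moment(1)[OF mh[OF that] r less_imp_le[OF \<tau>] r' fb[OF that] v[OF that] v0])
    show "(\<integral>\<omega>. (rest_part ?d \<tau> (?h k) \<omega>)\<^sup>2 \<partial>design_noise ?d)
      \<le> exp ((2 + r) * (1 + r) * \<tau> / 2 - r) + exp (2 * r' * real ?d * v - (r' - 1) * \<tau>)" if "k \<in> S" for k
      by (rule rest_part_second_moment(2)[OF mh[OF that] r less_imp_le[OF \<tau>] r' fb[OF that] v[OF that] v0])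
  qed (use len' fin b \<nu> \<tau> in auto)
  finally show ?thesis .
qed

section \<open>Reduction to testing\<close>

text \<open>The tuple of messages has countably many values, so its law is determined by its atoms,
  and these factorise over the machines. On this discrete space every \<open>G\<close> is
  measurable, which fits an arbitrary aggregation map.\<close>

lemma nn_integral_data_law_messages:
  fixes Y :: "nat \<Rightarrow> (nat \<Rightarrow> real \<times> real) \<Rightarrow> 'b :: countable"
  assumes f: "f \<in> borel_measurable borel"
    and Y: "\<And>i. i \<in> {1..m} \<Longrightarrow> Y i \<in> PiM {1..n div m} (\<lambda>_. borel) \<rightarrow>\<^sub>M count_space UNIV"
  shows "(\<integral>\<^sup>+\<omega>. G (\<lambda>i\<in>{1..m}. Y i (\<omega> i)) \<partial>data_law \<sigma> n m f)
    = (\<integral>\<^sup>+y. G y * (\<Prod>i\<in>{1..m}. ennreal (msg_prob \<sigma> n m f (Y i) (y i))) \<partial>count_space (PiE {1..m} (\<lambda>_. UNIV)))"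
proof -
  let ?Q = "local_law \<sigma> n m f"
  let ?C = "count_space (PiE {1..m} (\<lambda>_. UNIV :: 'b set))"
  let ?T = "\<lambda>\<omega>. \<lambda>i\<in>{1..m}. Y i (\<omega> i)"
  interpret Q: prob_space ?Q by (rule prob_space_local_law[OF f])
  interpret PQ: product_sigma_finite "\<lambda>_. ?Q"
    by (intro product_sigma_finite.intro Q.sigma_finite_measure_axioms)
  have YQ [measurable]: "Y i \<in> ?Q \<rightarrow>\<^sub>M count_space UNIV" if "i \<in> {1..m}" for i
    using Y[OF that] by (simp cong: measurable_cong_sets add: sets_local_law)
  have C: "PiM {1..m} (\<lambda>_. count_space (UNIV :: 'b set)) = ?C"
    by (rule count_space_PiM_finite) auto
  have T [measurable]: "?T \<in> data_law \<sigma> n m f \<rightarrow>\<^sub>M ?C"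
    unfolding C[symmetric] data_law_def by (rule measurable_restrict) measurable
  have cnt: "countable (PiE {1..m} (\<lambda>_. UNIV :: 'b set))" by (intro countable_PiE) auto
  have "distr (data_law \<sigma> n m f) ?C ?T
      = density ?C (\<lambda>y. \<Prod>i\<in>{1..m}. ennreal (msg_prob \<sigma> n m f (Y i) (y i)))"
  proof (rule measure_eqI_countable[where A = "PiE {1..m} (\<lambda>_. UNIV)"])
    fix y :: "nat \<Rightarrow> 'b" assume y: "y \<in> PiE {1..m} (\<lambda>_. UNIV)"
    have pre: "?T -` {y} \<inter> space (data_law \<sigma> n m f) = PiE {1..m} (\<lambda>i. Y i -` {y i} \<inter> space ?Q)"
    proof (intro set_eqI iffI)
      fix \<omega> assume "\<omega> \<in> ?T -` {y} \<inter> space (data_law \<sigma> n m f)"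
      then have "?T \<omega> = y" "\<omega> \<in> PiE {1..m} (\<lambda>_. space ?Q)" by (auto simp: data_law_def space_PiM)
      then show "\<omega> \<in> PiE {1..m} (\<lambda>i. Y i -` {y i} \<inter> space ?Q)" by (auto simp: PiE_iff)
    next
      fix \<omega> assume "\<omega> \<in> PiE {1..m} (\<lambda>i. Y i -` {y i} \<inter> space ?Q)"
      then show "\<omega> \<in> ?T -` {y} \<inter> space (data_law \<sigma> n m f)"
        using y by (auto simp: data_law_def space_PiM PiE_iff extensional_def restrict_def fun_eq_iff)
    qed
    have "emeasure (distr (data_law \<sigma> n m f) ?C ?T) {y}
        = emeasure (PiM {1..m} (\<lambda>_. ?Q)) (PiE {1..m} (\<lambda>i. Y i -` {y i} \<inter> space ?Q))"
      using y T by (subst emeasure_distr) (auto simp: pre[unfolded data_law_def] data_law_def)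
    also have "\<dots> = (\<Prod>i\<in>{1..m}. emeasure ?Q (Y i -` {y i} \<inter> space ?Q))"
      by (rule PQ.emeasure_PiM) auto
    also have "\<dots> = (\<Prod>i\<in>{1..m}. ennreal (msg_prob \<sigma> n m f (Y i) (y i)))"
      by (simp add: msg_prob_def Q.emeasure_eq_measure)
    also have "\<dots> = emeasure (density ?C (\<lambda>y. \<Prod>i\<in>{1..m}. ennreal (msg_prob \<sigma> n m f (Y i) (y i)))) {y}"
      using y by (subst emeasure_density) auto
    finally show "emeasure (distr (data_law \<sigma> n m f) ?C ?T) {y}
      = emeasure (density ?C (\<lambda>y. \<Prod>i\<in>{1..m}. ennreal (msg_prob \<sigma> n m f (Y i) (y i)))) {y}" .
  qed (use cnt in auto)
  note distr = this
  have "(\<integral>\<^sup>+\<omega>. G (?T \<omega>) \<partial>data_law \<sigma> n m f) = (\<integral>\<^sup>+y. G y \<partial>distr (data_law \<sigma> n m f) ?C ?T)"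
    by (rule nn_integral_distr[OF T, symmetric]) simp
  also have "\<dots> = (\<integral>\<^sup>+y. (\<Prod>i\<in>{1..m}. ennreal (msg_prob \<sigma> n m f (Y i) (y i))) * G y \<partial>?C)"
    unfolding distr by (rule nn_integral_density) auto
  finally show ?thesis by (simp only: mult.commute)
qed

lemma prob_space_data_law:
  assumes "f \<in> borel_measurable borel"
  shows "prob_space (data_law \<sigma> n m f)"
  unfolding data_law_def by (intro prob_space_PiM prob_space_local_law assms)

text \<open>With \<open>a / b\<close> read as a likelihood ratio: if it is above
  \<open>\<alpha>\<close>, then its square divided by \<open>\<alpha>\<close> is larger
  still.\<close>

lemma le_change_of_measure: "a \<le> \<alpha> * b + a\<^sup>2 / b / \<alpha>" if "a \<ge> 0" "b \<ge> 0" "\<alpha> > 0" "b = 0 \<Longrightarrow> a = 0" for a b \<alpha> :: real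
proof (cases "b = 0")
  case False
  then have b: "b > 0" using that by simp
  show ?thesis
  proof (cases "a \<le> \<alpha> * b")
    case True
    then show ?thesis using that b by (simp add: add_increasing2)
  next
    case False
    then have "a * (\<alpha> * b) \<le> a * a" using that by (intro mult_left_mono) auto
    then have "a \<le> a\<^sup>2 / b / \<alpha>" using b that by (simp add: field_simps power2_eq_square)
    then show ?thesis using that b by (simp add: add_increasing)
  qed
qed (use that in simp)

text \<open>On each event the likelihood ratio \<open>\<Lambda>\<close> of the messages is at most
  \<open>\<alpha> + \<Lambda>\<^sup>2 / \<alpha>\<close>; the first term is summed over disjoint events.\<close>

lemma exists_hard_hypothesis:
  fixes Y :: "nat \<Rightarrow> (nat \<Rightarrow> real \<times> real) \<Rightarrow> 'b :: countable" and f :: "'k \<Rightarrow> real \<Rightarrow> real"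
  assumes \<sigma>: "\<sigma> > 0" and f: "\<And>k. k \<in> S \<Longrightarrow> f k \<in> borel_measurable borel"
    and Y: "\<And>i. i \<in> {1..m} \<Longrightarrow> Y i \<in> PiM {1..n div m} (\<lambda>_. borel) \<rightarrow>\<^sub>M count_space UNIV"
    and fin: "finite S" and ne: "S \<noteq> {}" and M0: "M \<ge> 0"
    and disj: "\<And>k k' y. k \<in> S \<Longrightarrow> k' \<in> S \<Longrightarrow> y \<in> E k \<Longrightarrow> y \<in> E k' \<Longrightarrow> k = k'"
    and M: "\<And>k. k \<in> S \<Longrightarrow> (\<Prod>i\<in>{1..m}. 1 + msg_chi \<sigma> n m (f k) (Y i)) \<le> ennreal M"
    and card: "16 * M \<le> real (card S)"
  shows "\<exists>k\<in>S. (\<integral>\<^sup>+\<omega>. indicator (E k) (\<lambda>i\<in>{1..m}. Y i (\<omega> i)) \<partial>data_law \<sigma> n m (f k)) \<le> ennreal (1 / 2)"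
proof (rule ccontr)
  assume neg: "\<not> ?thesis"
  let ?C = "count_space (PiE {1..m} (\<lambda>_. UNIV :: 'b set))"
  let ?p = "\<lambda>k y. \<Prod>i\<in>{1..m}. msg_prob \<sigma> n m (f k) (Y i) (y i)"
  let ?q = "\<lambda>y. \<Prod>i\<in>{1..m}. msg_prob \<sigma> n m (\<lambda>_. 0) (Y i) (y i)"
  define J where "J k = (\<integral>\<^sup>+\<omega>. indicator (E k) (\<lambda>i\<in>{1..m}. Y i (\<omega> i)) \<partial>data_law \<sigma> n m (f k))" for k
  define J0 where "J0 k = (\<integral>\<^sup>+\<omega>. indicator (E k) (\<lambda>i\<in>{1..m}. Y i (\<omega> i)) \<partial>data_law \<sigma> n m (\<lambda>_. 0))" for k
  \<comment> \<open>A quarter of the number of hypotheses: the disjoint events have total null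
    probability at most 1 and contribute at most \<open>\<alpha>\<close>; the second moments
    contribute at most \<open>card S * M / \<alpha> = 4 * M \<le> \<alpha>\<close>. The sum is at
    most half of \<open>card S\<close>, so not every probability exceeds 1/2.\<close>
  define \<alpha> where "\<alpha> = real (card S) / 4"
  have cS: "card S > 0" using fin ne by (simp add: card_gt_0_iff)
  then have \<alpha>: "\<alpha> > 0" by (simp add: \<alpha>_def)
  have nn: "?p k y \<ge> 0" "?q y \<ge> 0" for k y by (auto intro!: prod_nonneg simp: msg_prob_def)
  interpret PC: product_sigma_finite "\<lambda>_::nat. count_space (UNIV :: 'b set)"
    by (intro product_sigma_finite.intro sigma_finite_measure_count_space)
  have C: "PiM {1..m} (\<lambda>_. count_space (UNIV :: 'b set)) = ?C"
    by (rule count_space_PiM_finite) auto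
  have split: "ennreal (\<alpha> * b + 1 / \<alpha> * c) = ennreal \<alpha> * ennreal b + ennreal (1 / \<alpha>) * ennreal c"
    if "b \<ge> 0" "c \<ge> 0" for b c
    using that \<alpha> by (simp only: ennreal_plus ennreal_mult mult_nonneg_nonneg zero_le_divide_1_iff less_imp_le)
  have step: "J k \<le> ennreal \<alpha> * J0 k + ennreal (M / \<alpha>)" if k: "k \<in> S" for k
  proof -
    have "J k = (\<integral>\<^sup>+y. indicator (E k) y * ennreal (?p k y) \<partial>?C)"
      unfolding J_def by (subst nn_integral_data_law_messages[OF f[OF k] Y])
        (auto simp: prod_ennreal msg_prob_def)
    also have "\<dots> \<le> (\<integral>\<^sup>+y. ennreal \<alpha> * (indicator (E k) y * ennreal (?q y)) + ennreal (1 / \<alpha>) * ennreal ((?p k y)\<^sup>2 / ?q y) \<partial>?C)"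
    proof (rule nn_integral_mono)
      fix y
      have "?p k y = 0" if "?q y = 0"
      proof -
        from that obtain i where i: "i \<in> {1..m}" "msg_prob \<sigma> n m (\<lambda>_. 0) (Y i) (y i) = 0" by auto
        then have "msg_prob \<sigma> n m (f k) (Y i) (y i) = 0"
          using msg_prob_absolutely_continuous[OF \<sigma> Y f[OF k]] by blast
        then show ?thesis using i(1) by (auto intro!: prod_zero)
      qed
      then have "?p k y \<le> \<alpha> * ?q y + (?p k y)\<^sup>2 / ?q y / \<alpha>"
        using nn \<alpha> by (intro le_change_of_measure) auto
      then have "ennreal (?p k y) \<le> ennreal (\<alpha> * ?q y + 1 / \<alpha> * ((?p k y)\<^sup>2 / ?q y))"
        by (intro ennreal_leI) (simp add: mult.commute)
      also have "\<dots> = ennreal \<alpha> * ennreal (?q y) + ennreal (1 / \<alpha>) * ennreal ((?p k y)\<^sup>2 / ?q y)"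
        using nn by (intro split) auto
      finally show "indicator (E k) y * ennreal (?p k y)
          \<le> ennreal \<alpha> * (indicator (E k) y * ennreal (?q y)) + ennreal (1 / \<alpha>) * ennreal ((?p k y)\<^sup>2 / ?q y)"
        by (auto simp: indicator_def)
    qed
    also have "\<dots> = ennreal \<alpha> * (\<integral>\<^sup>+y. indicator (E k) y * ennreal (?q y) \<partial>?C)
        + ennreal (1 / \<alpha>) * (\<integral>\<^sup>+y. ennreal ((?p k y)\<^sup>2 / ?q y) \<partial>?C)"
      by (simp add: nn_integral_add nn_integral_cmult)
    also have "(\<integral>\<^sup>+y. indicator (E k) y * ennreal (?q y) \<partial>?C) = J0 k"
      unfolding J0_def by (subst nn_integral_data_law_messages[OF _ Y])
        (auto simp: prod_ennreal msg_prob_def)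
    also have "(\<integral>\<^sup>+y. ennreal ((?p k y)\<^sup>2 / ?q y) \<partial>?C) \<le> ennreal M"
    proof -
      have "(?p k y)\<^sup>2 / ?q y
          = (\<Prod>i\<in>{1..m}. (msg_prob \<sigma> n m (f k) (Y i) (y i))\<^sup>2 / msg_prob \<sigma> n m (\<lambda>_. 0) (Y i) (y i))" for y
        by (simp add: prod_dividef prod_power_distrib)
      then have "(\<integral>\<^sup>+y. ennreal ((?p k y)\<^sup>2 / ?q y) \<partial>?C)
        = (\<integral>\<^sup>+y. (\<Prod>i\<in>{1..m}. ennreal ((msg_prob \<sigma> n m (f k) (Y i) (y i))\<^sup>2 / msg_prob \<sigma> n m (\<lambda>_. 0) (Y i) (y i))) \<partial>?C)"
        by (simp add: prod_ennreal msg_prob_def)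
      also have "\<dots> = (\<Prod>i\<in>{1..m}. \<integral>\<^sup>+z. ennreal ((msg_prob \<sigma> n m (f k) (Y i) z)\<^sup>2 / msg_prob \<sigma> n m (\<lambda>_. 0) (Y i) z) \<partial>count_space UNIV)"
        unfolding C[symmetric] by (rule PC.product_nn_integral_prod) auto
      also have "\<dots> = (\<Prod>i\<in>{1..m}. 1 + msg_chi \<sigma> n m (f k) (Y i))"
        by (intro prod.cong refl msg_second_moment[OF \<sigma> Y f[OF k]])
      also have "\<dots> \<le> ennreal M" by (rule M[OF k])
      finally show ?thesis .
    qed
    also have "ennreal (1 / \<alpha>) * ennreal M = ennreal (M / \<alpha>)"
      using \<alpha> M0 by (simp add: ennreal_mult[symmetric])
    finally show ?thesis by (simp add: add_left_mono mult_left_mono)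
  qed
  interpret D0: prob_space "data_law \<sigma> n m (\<lambda>_. 0)" by (rule prob_space_data_law) measurable
  have J0: "(\<Sum>k\<in>S. J0 k) \<le> 1"
  proof -
    have J0': "J0 k = (\<integral>\<^sup>+y. indicator (E k) y * ennreal (?q y) \<partial>?C)" for k
      unfolding J0_def by (subst nn_integral_data_law_messages[OF _ Y])
        (auto simp: prod_ennreal msg_prob_def)
    have "(\<Sum>k\<in>S. J0 k) = (\<integral>\<^sup>+y. (\<Sum>k\<in>S. indicator (E k) y * ennreal (?q y)) \<partial>?C)"
      unfolding J0' by (rule nn_integral_sum[symmetric]) simp
    also have "\<dots> \<le> (\<integral>\<^sup>+y. 1 * ennreal (?q y) \<partial>?C)"
    proof (rule nn_integral_mono)
      fix y
      have "(\<Sum>k\<in>S. indicator (E k) y :: ennreal) \<le> 1"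
      proof (cases "\<exists>k\<in>S. y \<in> E k")
        case True
        then obtain k where k: "k \<in> S" "y \<in> E k" by auto
        have "(\<Sum>k\<in>S. indicator (E k) y :: ennreal) = (\<Sum>k'\<in>{k}. indicator (E k') y)"
          using k disj fin by (intro sum.mono_neutral_right) (auto simp: indicator_def)
        then show ?thesis using k by simp
      qed (simp add: indicator_def)
      then show "(\<Sum>k\<in>S. indicator (E k) y * ennreal (?q y)) \<le> 1 * ennreal (?q y)"
        unfolding sum_distrib_right[symmetric] by (rule mult_right_mono) simp
    qed
    also have "\<dots> = (\<integral>\<^sup>+y. 1 * (\<Prod>i\<in>{1..m}. ennreal (msg_prob \<sigma> n m (\<lambda>_. 0) (Y i) (y i))) \<partial>?C)"
      by (simp add: prod_ennreal msg_prob_def)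
    also have "\<dots> = (\<integral>\<^sup>+\<omega>. 1 \<partial>data_law \<sigma> n m (\<lambda>_. 0))"
      by (rule nn_integral_data_law_messages[OF _ Y, symmetric]) auto
    finally show ?thesis by (simp add: D0.emeasure_space_1)
  qed
  have "(\<Sum>k\<in>S. J k) \<le> (\<Sum>k\<in>S. ennreal \<alpha> * J0 k + ennreal (M / \<alpha>))" by (rule sum_mono) (rule step)
  also have "\<dots> = ennreal \<alpha> * (\<Sum>k\<in>S. J0 k) + (\<Sum>k\<in>S. ennreal (M / \<alpha>))"
    by (simp add: sum.distrib sum_distrib_left)
  also have "(\<Sum>k\<in>S. ennreal (M / \<alpha>)) = ennreal (real (card S) * (M / \<alpha>))"
    using M0 \<alpha> by (simp add: ennreal_mult[of "real (card S)"] ennreal_of_nat_eq_real_of_nat del: times_divide_eq_right)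
  also have "ennreal \<alpha> * (\<Sum>k\<in>S. J0 k) + ennreal (real (card S) * (M / \<alpha>))
      \<le> ennreal \<alpha> * 1 + ennreal \<alpha>"
  proof (intro add_mono mult_left_mono J0 ennreal_leI)
    have "real (card S) * (M / \<alpha>) = 4 * M" using cS by (simp add: \<alpha>_def)
    then show "real (card S) * (M / \<alpha>) \<le> \<alpha>" using card by (simp add: \<alpha>_def)
  qed simp
  also have "\<dots> = ennreal (real (card S) / 2)"
    using \<alpha> by (simp add: \<alpha>_def ennreal_plus[symmetric] del: ennreal_plus)
  finally have upper: "(\<Sum>k\<in>S. J k) \<le> ennreal (real (card S) / 2)" .
  have lower: "J k > ennreal (1 / 2)" if "k \<in> S" for k
    using neg that by (auto simp: J_def not_le)
  have "J k < top" if "k \<in> S" for k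
  proof -
    interpret Dk: prob_space "data_law \<sigma> n m (f k)" by (rule prob_space_data_law[OF f[OF that]])
    have "J k \<le> (\<integral>\<^sup>+\<omega>. 1 \<partial>data_law \<sigma> n m (f k))"
      unfolding J_def by (rule nn_integral_mono) (simp add: indicator_def)
    then show ?thesis by (simp add: Dk.emeasure_space_1 le_less_trans)
  qed
  then have r: "J k = ennreal (enn2real (J k))" if "k \<in> S" for k using that by simp
  have "1 / 2 < enn2real (J k)" if "k \<in> S" for k
  proof -
    have "ennreal (1 / 2) < ennreal (enn2real (J k))" using lower[OF that] r[OF that] by (rule subst[rotated])
    then show ?thesis by (subst (asm) ennreal_less_iff) simp_all
  qed
  then have "(\<Sum>k\<in>S. 1 / 2) < (\<Sum>k\<in>S. enn2real (J k))" using fin ne by (intro sum_strict_mono) auto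
  moreover have "(\<Sum>k\<in>S. J k) = ennreal (\<Sum>k\<in>S. enn2real (J k))"
    using r by (subst sum_ennreal[symmetric]) (auto intro: sum.cong)
  ultimately show False using upper cS by (simp add: ennreal_le_iff)
qed

lemma sup_norm_triangle:
  assumes [measurable]: "f \<in> borel_measurable borel" "g \<in> borel_measurable borel" "h \<in> borel_measurable borel"
  shows "sup_norm (\<lambda>x. f x - g x) \<le> sup_norm (\<lambda>x. h x - f x) + sup_norm (\<lambda>x. h x - g x)"
proof -
  let ?M = "restrict_space lborel {0..1::real}"
  have "AE x in ?M. ennreal \<bar>h x - f x\<bar> \<le> sup_norm (\<lambda>x. h x - f x)"
    unfolding sup_norm_def by (rule esssup_AE)
  moreover have "AE x in ?M. ennreal \<bar>h x - g x\<bar> \<le> sup_norm (\<lambda>x. h x - g x)"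
    unfolding sup_norm_def by (rule esssup_AE)
  ultimately have "AE x in ?M. ennreal \<bar>f x - g x\<bar> \<le> sup_norm (\<lambda>x. h x - f x) + sup_norm (\<lambda>x. h x - g x)"
  proof eventually_elim
    case (elim x)
    have "ennreal \<bar>f x - g x\<bar> \<le> ennreal (\<bar>h x - f x\<bar> + \<bar>h x - g x\<bar>)" by (intro ennreal_leI) simp
    also have "\<dots> = ennreal \<bar>h x - f x\<bar> + ennreal \<bar>h x - g x\<bar>" by simp
    also have "\<dots> \<le> sup_norm (\<lambda>x. h x - f x) + sup_norm (\<lambda>x. h x - g x)" using elim by (rule add_mono)
    finally show ?case .
  qed
  then show ?thesis
    unfolding sup_norm_def by (intro esssup_I measurable_restrict_space1) measurable
qed

text \<open>An estimate closer than \<open>\<rho> / 2\<close> to \<open>f k\<close> identifies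
  \<open>k\<close>. Some \<open>k\<close> is missed with probability at least 1/2, at a loss of
  \<open>\<rho> / 2\<close>; hence \<open>\<rho> / 4\<close>. The set \<open>G\<close> may depend on
  the encoders, because a protocol can spend its bits on a few favoured hypotheses.\<close>

lemma minimax_risk_ge:
  fixes f :: "'k \<Rightarrow> real \<Rightarrow> real"
  assumes \<sigma>: "\<sigma> > 0" and F: "\<And>g. g \<in> F \<Longrightarrow> g \<in> borel_measurable borel" and F0: "(\<lambda>_. 0) \<in> F"
    and fF: "\<And>k. k \<in> S \<Longrightarrow> f k \<in> F" and fin: "finite S" and \<rho>: "\<rho> > 0"
    and sep: "\<And>k k'. k \<in> S \<Longrightarrow> k' \<in> S \<Longrightarrow> k \<noteq> k' \<Longrightarrow> ennreal \<rho> \<le> sup_norm (\<lambda>x. f k x - f k' x)"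
    and good: "\<And>Y :: nat \<Rightarrow> (nat \<Rightarrow> real \<times> real) \<Rightarrow> bool list.
        (\<And>i. i \<in> {1..m} \<Longrightarrow> Y i \<in> PiM {1..n div m} (\<lambda>_. borel) \<rightarrow>\<^sub>M count_space UNIV) \<Longrightarrow>
        (\<And>i. i \<in> {1..m} \<Longrightarrow> (\<integral>\<^sup>+x. ennreal (real (length (Y i x))) \<partial>local_law \<sigma> n m (\<lambda>_. 0)) \<le> ennreal (B i)) \<Longrightarrow>
        \<exists>G M. G \<subseteq> S \<and> G \<noteq> {} \<and> 0 \<le> M \<and> 16 * M \<le> real (card G) \<and>
          (\<forall>k\<in>G. (\<Prod>i\<in>{1..m}. 1 + msg_chi \<sigma> n m (f k) (Y i)) \<le> ennreal M)"
  shows "ennreal (\<rho> / 4) \<le> minimax_risk \<sigma> n m B F"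
  unfolding minimax_risk_def
proof (rule INF_greatest)
  fix fhat assume "fhat \<in> dist_estimators \<sigma> n m B F"
  then obtain Y :: "nat \<Rightarrow> (nat \<Rightarrow> real \<times> real) \<Rightarrow> bool list" and g where
    Y: "\<And>i. i \<in> {1..m} \<Longrightarrow> Y i \<in> PiM {1..n div m} (\<lambda>_. borel) \<rightarrow>\<^sub>M count_space UNIV"
    and len: "\<And>f i. f \<in> F \<Longrightarrow> i \<in> {1..m} \<Longrightarrow>
       (\<integral>\<^sup>+ \<omega>. ennreal (real (length (Y i (\<omega> i)))) \<partial>data_law \<sigma> n m f) \<le> ennreal (B i)"
    and g: "\<And>y. g y \<in> L2_unit" and fhat: "fhat = (\<lambda>\<omega>. g (\<lambda>i\<in>{1..m}. Y i (\<omega> i)))"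
    unfolding dist_estimators_def by blast
  have gm [measurable]: "g y \<in> borel_measurable borel" for y using g[of y] by (simp add: L2_unit_def)
  \<comment> \<open>The budget is used at the null function, through the marginal law of machine
    \<open>i\<close>.\<close>
  have "(\<integral>\<^sup>+x. ennreal (real (length (Y i x))) \<partial>local_law \<sigma> n m (\<lambda>_. 0)) \<le> ennreal (B i)" if i: "i \<in> {1..m}" for i
  proof -
    have "(\<integral>\<^sup>+x. ennreal (real (length (Y i x))) \<partial>local_law \<sigma> n m (\<lambda>_. 0))
       = (\<integral>\<^sup>+x. ennreal (real (length (Y i x))) \<partial>distr (data_law \<sigma> n m (\<lambda>_. 0)) (local_law \<sigma> n m (\<lambda>_. 0)) (\<lambda>\<omega>. \<omega> i))"
      unfolding data_law_def
      by (subst distr_PiM_component[where M = "\<lambda>_. local_law \<sigma> n m (\<lambda>_. 0)"]) (use i in \<open>auto intro!: prob_space_local_law\<close>)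
    also have "\<dots> = (\<integral>\<^sup>+ \<omega>. ennreal (real (length (Y i (\<omega> i)))) \<partial>data_law \<sigma> n m (\<lambda>_. 0))"
    proof -
      have "(\<lambda>\<omega>. \<omega> i) \<in> data_law \<sigma> n m (\<lambda>_. 0) \<rightarrow>\<^sub>M local_law \<sigma> n m (\<lambda>_. 0)"
        unfolding data_law_def using i by measurable
      moreover have "(\<lambda>x. ennreal (real (length (Y i x)))) \<in> borel_measurable (local_law \<sigma> n m (\<lambda>_. 0))"
        using measurable_compose[OF Y[OF i], of "\<lambda>z. ennreal (real (length z))" borel]
        by (simp cong: measurable_cong_sets add: sets_local_law)
      ultimately show ?thesis by (intro nn_integral_distr) auto
    qed
    finally show ?thesis using len[OF F0 i] by simp
  qed
  from good[OF Y this] obtain G M where G: "G \<subseteq> S" "G \<noteq> {}" and M: "0 \<le> M" "16 * M \<le> real (card G)"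
    "\<And>k. k \<in> G \<Longrightarrow> (\<Prod>i\<in>{1..m}. 1 + msg_chi \<sigma> n m (f k) (Y i)) \<le> ennreal M"
    by blast
  \<comment> \<open>A set of message tuples instead of an event in the data, so that measurability
    of the sup-norm is not at stake.\<close>
  define E where "E k = {y. sup_norm (\<lambda>x. g y x - f k x) < ennreal (\<rho> / 2)}" for k
  have fm: "f k \<in> borel_measurable borel" if "k \<in> S" for k using F[OF fF[OF that]] .
  have disj: "k = k'" if k: "k \<in> G" "k' \<in> G" and y: "y \<in> E k" "y \<in> E k'" for k k' y
  proof (rule ccontr)
    assume "k \<noteq> k'"
    then have "ennreal \<rho> \<le> sup_norm (\<lambda>x. f k x - f k' x)" using k G by (intro sep) auto
    also have "\<dots> \<le> sup_norm (\<lambda>x. g y x - f k x) + sup_norm (\<lambda>x. g y x - f k' x)"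
      by (rule sup_norm_triangle) (use k G fm in auto)
    also have "\<dots> < ennreal (\<rho> / 2) + ennreal (\<rho> / 2)"
      using y by (intro add_strict_mono) (auto simp: E_def)
    also have "\<dots> = ennreal \<rho>" using \<rho> by (simp add: ennreal_plus[symmetric] del: ennreal_plus)
    finally show False by simp
  qed
  have "\<exists>k\<in>G. (\<integral>\<^sup>+\<omega>. indicator (E k) (\<lambda>i\<in>{1..m}. Y i (\<omega> i)) \<partial>data_law \<sigma> n m (f k)) \<le> ennreal (1 / 2)"
  proof (rule exists_hard_hypothesis[OF \<sigma> _ Y _ G(2) M(1) disj M(3,2)])
    show "f k \<in> borel_measurable borel" if "k \<in> G" for k using fm G(1) that by auto
    show "finite G" using G(1) fin by (rule finite_subset)
  qed
  then obtain k where k: "k \<in> G"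
    and le: "(\<integral>\<^sup>+\<omega>. indicator (E k) (\<lambda>i\<in>{1..m}. Y i (\<omega> i)) \<partial>data_law \<sigma> n m (f k)) \<le> ennreal (1 / 2)" by blast
  have kS: "k \<in> S" using k G by auto
  interpret Dk: prob_space "data_law \<sigma> n m (f k)" by (rule prob_space_data_law[OF fm[OF kS]])
  let ?T = "\<lambda>\<omega>. \<lambda>i\<in>{1..m}. Y i (\<omega> i)"
  let ?C = "count_space (PiE {1..m} (\<lambda>_. UNIV :: bool list set))"
  let ?I = "\<lambda>A. \<integral>\<^sup>+\<omega>. indicator A (?T \<omega>) \<partial>data_law \<sigma> n m (f k)"
  have law: "?I A = (\<integral>\<^sup>+y. indicator A y * (\<Prod>i\<in>{1..m}. ennreal (msg_prob \<sigma> n m (f k) (Y i) (y i))) \<partial>?C)" for A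
    by (rule nn_integral_data_law_messages[OF fm[OF kS] Y])
  have compl: "?I (E k) + ?I (- E k) = 1"
  proof -
    have "?I (E k) + ?I (- E k) = ?I UNIV"
      unfolding law by (subst nn_integral_add[symmetric]) (auto intro!: nn_integral_cong simp: indicator_def)
    then show ?thesis by (simp add: Dk.emeasure_space_1)
  qed
  have half: "ennreal (1 / 2) \<le> ?I (- E k)"
  proof (rule ccontr)
    assume "\<not> ?thesis"
    then have "?I (- E k) < ennreal (1 / 2)" by simp
    then have "ennreal (1 / 2) + ?I (- E k) < ennreal (1 / 2) + ennreal (1 / 2)"
      by (subst ennreal_add_left_cancel_less) simp
    with add_right_mono[OF le] have "?I (E k) + ?I (- E k) < ennreal (1 / 2) + ennreal (1 / 2)"
      by (rule le_less_trans)
    also have "ennreal (1 / 2) + ennreal (1 / 2) = 1"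
      by (subst ennreal_plus[symmetric]) (simp_all del: ennreal_plus)
    finally show False unfolding compl by simp
  qed
  have "ennreal (\<rho> / 4) = ennreal (\<rho> / 2) * ennreal (1 / 2)"
    using \<rho> by (subst ennreal_mult[symmetric]) auto
  also have "\<dots> \<le> ennreal (\<rho> / 2) * ?I (- E k)" using half by (rule mult_left_mono) simp
  also have "\<dots> = (\<integral>\<^sup>+\<omega>. ennreal (\<rho> / 2) * indicator (- E k) (?T \<omega>) \<partial>data_law \<sigma> n m (f k))"
  proof -
    have "(\<integral>\<^sup>+\<omega>. ennreal (\<rho> / 2) * indicator (- E k) (?T \<omega>) \<partial>data_law \<sigma> n m (f k))
      = (\<integral>\<^sup>+y. ennreal (\<rho> / 2) * indicator (- E k) y
          * (\<Prod>i\<in>{1..m}. ennreal (msg_prob \<sigma> n m (f k) (Y i) (y i))) \<partial>?C)"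
      by (rule nn_integral_data_law_messages[OF fm[OF kS] Y])
    then show ?thesis unfolding law by (simp add: nn_integral_cmult[symmetric] mult.assoc)
  qed
  also have "\<dots> \<le> (\<integral>\<^sup>+\<omega>. sup_norm (\<lambda>x. fhat \<omega> x - f k x) \<partial>data_law \<sigma> n m (f k))"
    by (rule nn_integral_mono) (auto simp: E_def fhat indicator_def not_less)
  also have "\<dots> \<le> (SUP f\<in>F. \<integral>\<^sup>+\<omega>. sup_norm (\<lambda>x. fhat \<omega> x - f x) \<partial>data_law \<sigma> n m f)"
    using fF[OF kS] by (rule SUP_upper)
  finally show "ennreal (\<rho> / 4) \<le> (SUP f\<in>F. \<integral>\<^sup>+\<omega>. sup_norm (\<lambda>x. fhat \<omega> x - f x) \<partial>data_law \<sigma> n m f)" .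
qed

section \<open>Interior wavelets\<close>

lemma nn_integral_unif_le: "(\<integral>\<^sup>+x. g x \<partial>unif) \<le> (\<integral>\<^sup>+x. g x * indicator {0..1} x \<partial>lborel)"
  if [measurable]: "g \<in> borel_measurable borel"
proof -
  have "(\<integral>\<^sup>+x. g x \<partial>unif) = (\<integral>\<^sup>+x. g x * indicator {0<..<1} x \<partial>lborel)"
    unfolding unif_def by (subst nn_integral_uniform_measure) (auto simp: divide_ennreal_def)
  also have "\<dots> \<le> (\<integral>\<^sup>+x. g x * indicator {0..1} x \<partial>lborel)"
    by (intro nn_integral_mono) (auto simp: indicator_def)
  finally show ?thesis .
qed

lemma bounded_set_integrable_unit:
  assumes [measurable]: "g \<in> borel_measurable borel" and "\<And>x. \<bar>g x\<bar> \<le> b"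
  shows "set_integrable lborel {0..1} (g :: real \<Rightarrow> real)"
  unfolding set_integrable_def
proof (rule Bochner_Integration.integrable_bound[where f = "\<lambda>x. b * indicator {0..1} x"])
  show "AE x in lborel. norm (indicat_real {0..1} x *\<^sub>R g x) \<le> norm (b * indicator {0..1} x :: real)"
    using assms(2) by (auto simp: indicator_def intro: order_trans[OF _ abs_ge_self])
qed auto

text \<open>The interior wavelets in the form used below: dilated translates of one bounded function
  that is supported in an interval of length \<open>2 * N - 1\<close>.\<close>

locale cdv_interior =
  fixes N j0 :: nat and w :: "cdv_index \<Rightarrow> real \<Rightarrow> real" and \<psi> :: "real \<Rightarrow> real" and \<Psi> :: real
  assumes basis: "cdv_basis N j0 w" and N: "N \<ge> 1" and \<psi>_meas [measurable]: "\<psi> \<in> borel_measurable borel"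
    and \<Psi>: "\<Psi> > 0" and \<psi>_bound: "\<And>x. \<bar>\<psi> x\<bar> \<le> \<Psi>"
    and \<psi>_supp: "\<And>x. x \<notin> {1 - real N..real N} \<Longrightarrow> \<psi> x = 0"
    and w_eq: "\<And>j k x. j0 \<le> j \<Longrightarrow> N \<le> k \<Longrightarrow> k + N < 2 ^ j \<Longrightarrow>
      w (Wavelet j k) x = sqrt (2 ^ j) * \<psi> (2 ^ j * x - real k)"

text \<open>\<open>\<psi>\<close> is a finite combination of the functions
  \<open>\<phi> (2 * x - l)\<close>, which makes it bounded. The support interval is preserved: for
  \<open>x\<close> outside of \<open>[1 - N, N]\<close> and \<open>l\<close> inside,
  \<open>2 * x - l\<close> is outside again.\<close>

lemma cdv_basis_interior:
  assumes basis: "cdv_basis N j0 w"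
  shows "\<exists>\<psi> \<Psi>. cdv_interior N j0 w \<psi> \<Psi>"
proof -
  from basis obtain h \<phi> \<psi> \<phi>L \<psi>L \<phi>R \<psi>R where pair: "daubechies_pair N h \<phi> \<psi>"
    and w: "\<forall>j\<ge>j0. \<forall>k<2 ^ j. w (Wavelet j k) = interval_level N \<psi> \<psi>L \<psi>R j k"
    unfolding cdv_basis_def by blast
  have N: "N \<ge> 1" and [measurable]: "\<phi> \<in> borel_measurable borel" and bd: "bounded (range \<phi>)"
    and supp: "\<And>x. x \<notin> {1 - real N..real N} \<Longrightarrow> \<phi> x = 0"
    and \<psi>: "\<And>x. \<psi> x = sqrt 2 *
        (\<Sum>l\<in>{1 - int N..int N}. (if even l then 1 else - 1) * h (1 - l) * \<phi> (2 * x - of_int l))"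
    using pair unfolding daubechies_pair_def by blast+
  obtain b where b: "\<And>x. \<bar>\<phi> x\<bar> \<le> b" using bd by (auto simp: bounded_iff)
  define \<Psi> where "\<Psi> = sqrt 2 * (\<Sum>l\<in>{1 - int N..int N}. \<bar>h (1 - l)\<bar> * b) + 1"
  have b0: "b \<ge> 0" using b[of 0] by linarith
  have bound: "\<bar>\<psi> x\<bar> \<le> \<Psi>" for x
  proof -
    have "\<bar>\<Sum>l\<in>{1 - int N..int N}. (if even l then 1 else - 1) * h (1 - l) * \<phi> (2 * x - of_int l)\<bar>
      \<le> (\<Sum>l\<in>{1 - int N..int N}. \<bar>(if even l then 1 else - 1) * h (1 - l) * \<phi> (2 * x - of_int l)\<bar>)"
      by (rule sum_abs)
    also have "\<dots> \<le> (\<Sum>l\<in>{1 - int N..int N}. \<bar>h (1 - l)\<bar> * b)"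
      by (intro sum_mono) (auto simp: abs_mult b mult_left_mono)
    finally have "sqrt 2 * \<bar>\<Sum>l\<in>{1 - int N..int N}. (if even l then 1 else - 1) * h (1 - l) * \<phi> (2 * x - of_int l)\<bar>
      \<le> sqrt 2 * (\<Sum>l\<in>{1 - int N..int N}. \<bar>h (1 - l)\<bar> * b)" by (rule mult_left_mono) simp
    moreover have "\<bar>\<psi> x\<bar> = sqrt 2 * \<bar>\<Sum>l\<in>{1 - int N..int N}. (if even l then 1 else - 1) * h (1 - l) * \<phi> (2 * x - of_int l)\<bar>"
      unfolding \<psi> by (simp add: abs_mult)
    ultimately show ?thesis unfolding \<Psi>_def by linarith
  qed
  have zero: "\<psi> x = 0" if x: "x \<notin> {1 - real N..real N}" for x
  proof -
    have "\<phi> (2 * x - of_int l) = 0" if l: "l \<in> {1 - int N..int N}" for l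
    proof (rule supp)
      have "real_of_int (1 - int N) \<le> of_int l" "real_of_int l \<le> of_int (int N)"
        using l unfolding of_int_le_iff by auto
      then show "2 * x - of_int l \<notin> {1 - real N..real N}" using x by auto
    qed
    then show ?thesis by (simp add: \<psi>)
  qed
  have meas: "\<psi> \<in> borel_measurable borel"
    unfolding \<psi>[abs_def] by measurable
  have interior: "w (Wavelet j k) x = sqrt (2 ^ j) * \<psi> (2 ^ j * x - real k)"
    if "j0 \<le> j" "N \<le> k" "k + N < 2 ^ j" for j k x
    using w that by (simp add: interval_level_def less_diff_conv)
  have pos: "\<Psi> > 0" unfolding \<Psi>_def using b0
    by (intro add_nonneg_pos mult_nonneg_nonneg sum_nonneg) auto
  show ?thesis
    by (intro exI cdv_interior.intro) (fact basis N meas pos bound zero interior)+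
qed

context cdv_interior
begin

lemma wavelet_orthonormal:
  "a \<in> cdv_indices j0 \<Longrightarrow> b \<in> cdv_indices j0 \<Longrightarrow> inner_on {0..1} (w a) (w b) = (if a = b then 1 else 0)"
  using basis unfolding cdv_basis_def by blast

context
  fixes j k :: nat
  assumes j: "j0 \<le> j" and k: "N \<le> k" "k + N < 2 ^ j"
begin

lemma wavelet_measurable: "w (Wavelet j k) \<in> borel_measurable borel"
  unfolding w_eq[OF j k, abs_def] by measurable

lemma wavelet_bound: "\<bar>w (Wavelet j k) x\<bar> \<le> sqrt (2 ^ j) * \<Psi>"
  by (simp add: w_eq[OF j k] abs_mult \<psi>_bound mult_left_mono)

lemma wavelet_supp: "2 ^ j * x - real k \<notin> {1 - real N..real N} \<Longrightarrow> w (Wavelet j k) x = 0"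
  by (simp add: w_eq[OF j k] \<psi>_supp del: atLeastAtMost_iff)

lemma wavelet_index: "Wavelet j k \<in> cdv_indices j0"
  using j k by (auto simp: cdv_indices_def)

lemma wavelet_square_integrable: "set_integrable lborel {0..1} (\<lambda>x. (w (Wavelet j k) x)\<^sup>2)"
proof (rule bounded_set_integrable_unit)
  show "(\<lambda>x. (w (Wavelet j k) x)\<^sup>2) \<in> borel_measurable borel" using wavelet_measurable by measurable
  show "\<bar>(w (Wavelet j k) x)\<^sup>2\<bar> \<le> (sqrt (2 ^ j) * \<Psi>)\<^sup>2" for x
    using power_mono[OF wavelet_bound[of x], of 2] by simp
qed

lemma wavelet_norm: "(LINT x:{0..1}|lborel. (w (Wavelet j k) x)\<^sup>2) = 1"
  using wavelet_orthonormal[OF wavelet_index wavelet_index] by (simp add: inner_on_def power2_eq_square)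

lemma wavelet_energy: "(\<integral>\<^sup>+x. ennreal ((c * w (Wavelet j k) x)\<^sup>2) \<partial>unif) \<le> ennreal (c\<^sup>2)"
proof -
  note [measurable] = wavelet_measurable
  have "(\<integral>\<^sup>+x. ennreal ((c * w (Wavelet j k) x)\<^sup>2) \<partial>unif)
      \<le> (\<integral>\<^sup>+x. ennreal ((c * w (Wavelet j k) x)\<^sup>2) * indicator {0..1} x \<partial>lborel)"
    by (rule nn_integral_unif_le) measurable
  also have "\<dots> = (\<integral>\<^sup>+x. ennreal (c\<^sup>2) * ennreal (indicat_real {0..1} x *\<^sub>R (w (Wavelet j k) x)\<^sup>2) \<partial>lborel)"
    by (intro nn_integral_cong) (auto simp: indicator_def power_mult_distrib ennreal_mult)
  also have "\<dots> = ennreal (c\<^sup>2) * (\<integral>\<^sup>+x. ennreal (indicat_real {0..1} x *\<^sub>R (w (Wavelet j k) x)\<^sup>2) \<partial>lborel)"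
    by (rule nn_integral_cmult) measurable
  also have "(\<integral>\<^sup>+x. ennreal (indicat_real {0..1} x *\<^sub>R (w (Wavelet j k) x)\<^sup>2) \<partial>lborel) = ennreal 1"
    using wavelet_norm wavelet_square_integrable
    unfolding set_lebesgue_integral_def set_integrable_def
    by (subst nn_integral_eq_integral) auto
  finally show ?thesis by simp
qed

text \<open>By orthonormality a single coefficient survives, and the amplitude makes its weighted
  size exactly \<open>c\<close>. The ball is open, hence \<open>c < L\<close>.\<close>

lemma wavelet_in_besov_ball:
  assumes "0 \<le> c" "c < L"
  shows "(\<lambda>x. c * 2 powr (- (real j * (s + 1 / 2))) * w (Wavelet j k) x) \<in> besov_ball j0 w s L"
proof -
  define a where "a = c * 2 powr (- (real j * (s + 1 / 2)))"
  have a0: "a \<ge> 0" using assms by (simp add: a_def)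
  note [measurable] = wavelet_measurable
  have "(\<lambda>x. a * w (Wavelet j k) x) \<in> L2_unit"
    unfolding L2_unit_def using wavelet_square_integrable
    by (auto simp: power_mult_distrib intro!: set_integrable_mult_right)
  moreover have "besov_norm j0 w s (\<lambda>x. a * w (Wavelet j k) x) \<le> ennreal c"
    unfolding besov_norm_def
  proof (rule SUP_least)
    fix b assume b: "b \<in> cdv_indices j0"
    have "inner_on {0..1} (\<lambda>x. a * w (Wavelet j k) x) (w b) = a * (if Wavelet j k = b then 1 else 0)"
      using wavelet_orthonormal[OF wavelet_index b]
      by (simp add: inner_on_def mult.assoc set_integral_mult_right)
    moreover have "2 powr (real j * (s + 1 / 2)) * a = c"
      by (simp add: a_def powr_minus field_simps)
    ultimately show "ennreal (2 powr (real (level j0 b) * (s + 1 / 2)) * \<bar>inner_on {0..1} (\<lambda>x. a * w (Wavelet j k) x) (w b)\<bar>) \<le> ennreal c"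
      using a0 assms by (intro ennreal_leI) auto
  qed
  then have "besov_norm j0 w s (\<lambda>x. a * w (Wavelet j k) x) < ennreal L"
    using assms by (auto intro: le_less_trans simp: ennreal_less_iff)
  ultimately show ?thesis by (simp add: besov_ball_def a_def)
qed

end

text \<open>Each wavelet lives on an interval of length \<open>(2 * N - 1) / 2 ^ j\<close>, which is
  less than the shift by at least \<open>2 * N / 2 ^ j\<close>.\<close>

lemma wavelet_disjoint_supports:
  assumes j: "j0 \<le> j" and k: "N \<le> k" "k + N < 2 ^ j" and k': "N \<le> k'" "k' + N < 2 ^ j"
    and far: "k + 2 * N \<le> k' \<or> k' + 2 * N \<le> k"
  shows "w (Wavelet j k) x = 0 \<or> w (Wavelet j k') x = 0"
proof (rule ccontr)
  assume "\<not> ?thesis"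
  then have "2 ^ j * x - real k \<in> {1 - real N..real N}" "2 ^ j * x - real k' \<in> {1 - real N..real N}"
    using wavelet_supp[OF j k] wavelet_supp[OF j k'] by blast+
  then have "real k' < real k + 2 * real N" "real k < real k' + 2 * real N" by auto
  then have "real k' < real (k + 2 * N)" "real k < real (k' + 2 * N)" by simp_all
  then show False using far unfolding of_nat_less_iff by linarith
qed

text \<open>No peak of \<open>\<psi>\<close> has to be located: a function of unit L2 norm that
  lives on an interval shorter than \<open>2 * N / 2 ^ j\<close> has essential supremum at least
  \<open>sqrt (2 ^ j / (2 * N))\<close>, and where the first wavelet is nonzero the second one
  vanishes.\<close>

lemma wavelet_separation:
  assumes j: "j0 \<le> j" and k: "N \<le> k" "k + N < 2 ^ j" and k': "N \<le> k'" "k' + N < 2 ^ j"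
    and far: "k + 2 * N \<le> k' \<or> k' + 2 * N \<le> k" and a: "a > 0"
  shows "ennreal (a * sqrt (2 ^ j / (2 * real N)))
    \<le> sup_norm (\<lambda>x. a * w (Wavelet j k) x - a * w (Wavelet j k') x)"
proof (rule ccontr)
  let ?W = "w (Wavelet j k)" and ?W' = "w (Wavelet j k')"
  define \<rho> where "\<rho> = a * sqrt (2 ^ j / (2 * real N))"
  let ?s = "sup_norm (\<lambda>x. a * ?W x - a * ?W' x)"
  assume "\<not> ?thesis"
  then have s: "?s < ennreal \<rho>" by (simp add: \<rho>_def not_le)
  define r where "r = enn2real ?s"
  have r: "?s = ennreal r" "r \<ge> 0" using less_trans[OF s ennreal_less_top] by (simp_all add: r_def)
  have \<rho>0: "\<rho> > 0" using a N by (simp add: \<rho>_def)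
  have r\<rho>: "r < \<rho>" using s unfolding r(1) using r(2) by (simp add: ennreal_less_iff)
  have "AE x in restrict_space lborel {0..1}. ennreal \<bar>a * ?W x - a * ?W' x\<bar> \<le> ennreal r"
    unfolding r(1)[symmetric] sup_norm_def by (rule esssup_AE)
  then have AE1: "AE x in lborel. x \<in> {0..1} \<longrightarrow> ennreal \<bar>a * ?W x - a * ?W' x\<bar> \<le> ennreal r"
    by (subst (asm) AE_restrict_space_iff) auto
  define I where "I = {(1 - real N + real k) / 2 ^ j..(real N + real k) / 2 ^ j}"
  have supp: "?W x = 0" if "x \<notin> I" for x
  proof (rule wavelet_supp[OF j k])
    show "2 ^ j * x - real k \<notin> {1 - real N..real N}"
      using that by (auto simp: I_def field_simps)
  qed
  have AE2: "AE x in lborel. indicat_real {0..1} x *\<^sub>R (a\<^sup>2 * (?W x)\<^sup>2) \<le> r\<^sup>2 * indicator I x"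
    using AE1
  proof eventually_elim
    case (elim x)
    show ?case
    proof (cases "x \<in> {0..1} \<and> ?W x \<noteq> 0")
      case True
      then have "?W' x = 0" using wavelet_disjoint_supports[OF j k k' far, of x] by simp
      then have "\<bar>a * ?W x\<bar> \<le> r" using elim True r(2) by simp
      then have "(a * ?W x)\<^sup>2 \<le> r\<^sup>2" using power_mono[of "\<bar>a * ?W x\<bar>" r 2] by simp
      moreover have "x \<in> I" using True supp by blast
      ultimately show ?thesis using True by (simp add: power_mult_distrib)
    qed (auto simp: indicator_def)
  qed
  have iW: "integrable lborel (\<lambda>x. indicat_real {0..1} x *\<^sub>R (a\<^sup>2 * (?W x)\<^sup>2))"
    using set_integrable_mult_right[OF wavelet_square_integrable[OF j k], of "a\<^sup>2"]
    by (simp add: set_integrable_def)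
  have "a\<^sup>2 = (LINT x:{0..1}|lborel. a\<^sup>2 * (?W x)\<^sup>2)"
    using wavelet_norm[OF j k] by (simp add: set_integral_mult_right)
  also have "\<dots> \<le> (\<integral>x. r\<^sup>2 * indicator I x \<partial>lborel)"
    unfolding set_lebesgue_integral_def
    by (rule integral_mono_AE[OF iW _ AE2])
      (auto simp: I_def emeasure_lborel_Icc_eq intro!: integrable_real_indicator)
  also have "\<dots> = r\<^sup>2 * ((2 * real N - 1) / 2 ^ j)"
  proof -
    have "(1 - real N + real k) / 2 ^ j \<le> (real N + real k) / 2 ^ j"
      using N by (intro divide_right_mono) auto
    then have "measure lborel I = (real N + real k) / 2 ^ j - (1 - real N + real k) / 2 ^ j"
      unfolding I_def by simp
    also have "\<dots> = (2 * real N - 1) / 2 ^ j" by (simp add: diff_divide_distrib[symmetric])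
    finally show ?thesis by simp
  qed
  also have "\<dots> \<le> r\<^sup>2 * (2 * real N / 2 ^ j)" by (intro mult_left_mono divide_right_mono) auto
  also have "\<dots> < \<rho>\<^sup>2 * (2 * real N / 2 ^ j)"
    using r r\<rho> N by (intro mult_strict_right_mono power_strict_mono) auto
  also have "\<dots> = a\<^sup>2" using N by (simp add: \<rho>_def power_mult_distrib)
  finally show False by simp
qed

end

section \<open>Disjoint bumps as hypotheses\<close>

lemma exists_dyadic_level:
  assumes "\<kappa> \<ge> (1 :: real)"
  obtains j :: nat where "2 ^ j \<le> \<kappa>" "\<kappa> < 2 * 2 ^ j"
proof -
  define j where "j = nat \<lfloor>log 2 \<kappa>\<rfloor>"
  have l: "log 2 \<kappa> \<ge> 0" using assms by simp
  then have "real j \<le> log 2 \<kappa>" "log 2 \<kappa> < real j + 1" unfolding j_def by linarith+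
  then have "2 powr real j \<le> \<kappa>" "\<kappa> < 2 powr (real j + 1)"
    using assms by (simp_all add: le_log_iff log_less_iff)
  then show ?thesis by (intro that[of j]) (simp_all add: powr_realpow powr_add)
qed

text \<open>This is \<open>1 + x \<le> exp x\<close> in each factor; the finite sum first brings the
  terms back to real numbers.\<close>

lemma prod_one_plus_le_exp_sum:
  fixes x :: "'i \<Rightarrow> ennreal"
  assumes "finite I" and "(\<Sum>i\<in>I. x i) \<le> ennreal c" and "c \<ge> 0"
  shows "(\<Prod>i\<in>I. 1 + x i) \<le> ennreal (exp c)"
proof -
  have fin: "x i < top" if "i \<in> I" for i
  proof -
    have "x i \<le> (\<Sum>i\<in>I. x i)" using assms(1) that by (intro member_le_sum) auto
    then show ?thesis using assms(2) by (meson ennreal_less_top le_less_trans)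
  qed
  then have r: "x i = ennreal (enn2real (x i))" if "i \<in> I" for i using that by simp
  have "(\<Sum>i\<in>I. x i) = ennreal (\<Sum>i\<in>I. enn2real (x i))"
    using r by (subst sum_ennreal[symmetric]) (auto intro: sum.cong)
  then have c: "(\<Sum>i\<in>I. enn2real (x i)) \<le> c" using assms(2,3) by (simp add: ennreal_le_iff)
  have "(\<Prod>i\<in>I. 1 + x i) = (\<Prod>i\<in>I. ennreal (1 + enn2real (x i)))"
    using fin by (intro prod.cong refl) simp
  also have "\<dots> = ennreal (\<Prod>i\<in>I. 1 + enn2real (x i))" by (rule prod_ennreal) simp
  also have "\<dots> \<le> ennreal (\<Prod>i\<in>I. exp (enn2real (x i)))"
    by (intro ennreal_leI prod_mono) auto
  also have "\<dots> = ennreal (exp (\<Sum>i\<in>I. enn2real (x i)))" using assms(1) by (simp add: exp_sum)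
  also have "\<dots> \<le> ennreal (exp c)" using c by (simp add: ennreal_leI)
  finally show ?thesis .
qed

text \<open>Every discarded element carries more than \<open>2 * C\<close>, twice the bound
  \<open>C\<close> for the average, so at most half of them can be discarded.\<close>

lemma markov_card:
  fixes T :: "'k \<Rightarrow> ennreal"
  assumes "finite S" and "(\<Sum>q\<in>S. T q) \<le> ennreal (real (card S) * C)" and "C > 0"
  shows "real (card S) / 2 \<le> real (card {q \<in> S. T q \<le> ennreal (2 * C)})"
proof -
  let ?G = "{q \<in> S. T q \<le> ennreal (2 * C)}"
  have "ennreal (real (card (S - ?G)) * (2 * C)) = (\<Sum>q\<in>S - ?G. ennreal (2 * C))"
    using \<open>C > 0\<close> by (simp add: ennreal_mult ennreal_of_nat_eq_real_of_nat)
  also have "\<dots> \<le> (\<Sum>q\<in>S - ?G. T q)" by (rule sum_mono) auto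
  also have "\<dots> \<le> (\<Sum>q\<in>S. T q)" using assms(1) by (intro sum_mono2) auto
  also have "\<dots> \<le> ennreal (real (card S) * C)" by fact
  finally have "real (card (S - ?G)) * 2 \<le> real (card S)"
    using \<open>C > 0\<close> by (simp add: ennreal_le_iff)
  moreover have "card S = card ?G + card (S - ?G)"
    using assms(1) by (subst card_Un_disjoint[symmetric]) (auto intro!: arg_cong[where f = card])
  ultimately show ?thesis by simp
qed

context cdv_interior
begin

text \<open>The positions \<open>N + 2 * N * q\<close> are spaced by \<open>2 * N\<close> to keep
  the supports disjoint; the \<open>- 1\<close> leaves room for the boundary functions, whose
  positions are below \<open>N\<close> and from \<open>2 ^ j - N\<close> on.\<close>

definition bump_count :: "nat \<Rightarrow> nat" where
  "bump_count j = 2 ^ j div (2 * N) - 1"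

definition bump :: "real \<Rightarrow> real \<Rightarrow> nat \<Rightarrow> nat \<Rightarrow> real \<Rightarrow> real" where
  "bump c s j q x = c * 2 powr (- (real j * (s + 1 / 2))) * w (Wavelet j (N + 2 * N * q)) x"

lemma bump_position:
  assumes "q < bump_count j"
  shows "N \<le> N + 2 * N * q" "N + 2 * N * q + N < 2 ^ j"
proof -
  have "q + 2 \<le> 2 ^ j div (2 * N)" using assms by (simp add: bump_count_def)
  then have "2 * N * (q + 2) \<le> 2 * N * (2 ^ j div (2 * N))" by (rule mult_le_mono2)
  also have "\<dots> \<le> 2 ^ j" by simp
  finally show "N + 2 * N * q + N < 2 ^ j" using N by (simp add: algebra_simps)
qed simp

lemma bump_far:
  assumes "q \<noteq> q'"
  shows "N + 2 * N * q + 2 * N \<le> N + 2 * N * q' \<or> N + 2 * N * q' + 2 * N \<le> N + 2 * N * q"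
proof -
  have *: "2 * N * q + 2 * N \<le> 2 * N * q'" if "q < q'" for q q' :: nat
    using mult_le_mono2[of "q + 1" q' "2 * N"] that by (simp add: algebra_simps)
  consider "q < q'" | "q' < q" using assms by linarith
  then show ?thesis by cases (use *[of q q'] *[of q' q] in linarith)+
qed

context
  fixes s c L \<sigma> :: real and j :: nat
  assumes \<sigma>: "\<sigma> > 0" and c: "0 < c" "c < L" and j: "j0 \<le> j"
begin

private abbreviation (input) "amp \<equiv> c * 2 powr (- (real j * (s + 1 / 2)))"
private abbreviation "S \<equiv> {..<bump_count j}"

lemma bump_in_besov_ball: "q < bump_count j \<Longrightarrow> bump c s j q \<in> besov_ball j0 w s L"
  unfolding bump_def[abs_def] using c by (intro wavelet_in_besov_ball[OF j bump_position]) auto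

lemma bump_measurable: "q < bump_count j \<Longrightarrow> bump c s j q \<in> borel_measurable borel"
  using bump_in_besov_ball by (simp add: besov_ball_def L2_unit_def)

lemma bump_energy:
  assumes "q < bump_count j"
  shows "(\<integral>\<^sup>+x. ennreal ((bump c s j q x / \<sigma>)\<^sup>2) \<partial>unif) \<le> ennreal ((amp / \<sigma>)\<^sup>2)"
  using wavelet_energy[OF j bump_position[OF assms], of "amp / \<sigma>"] by (simp add: bump_def)

lemma bump_bound:
  assumes "q < bump_count j"
  shows "(bump c s j q x / \<sigma>)\<^sup>2 \<le> (amp * (sqrt (2 ^ j) * \<Psi>) / \<sigma>)\<^sup>2"
proof -
  have "\<bar>bump c s j q x / \<sigma>\<bar> \<le> amp * (sqrt (2 ^ j) * \<Psi>) / \<sigma>"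
    unfolding bump_def using wavelet_bound[OF j bump_position[OF assms], of x] c \<sigma>
    by (simp add: abs_mult divide_right_mono mult_left_mono)
  then show ?thesis using power_mono[of "\<bar>bump c s j q x / \<sigma>\<bar>" _ 2] by (simp only: power2_abs abs_ge_zero)
qed

lemma bump_disjoint:
  "q < bump_count j \<Longrightarrow> q' < bump_count j \<Longrightarrow> q \<noteq> q' \<Longrightarrow> bump c s j q x = 0 \<or> bump c s j q' x = 0"
proof -
  assume q: "q < bump_count j" "q' < bump_count j" "q \<noteq> q'"
  have "w (Wavelet j (N + 2 * N * q)) x = 0 \<or> w (Wavelet j (N + 2 * N * q')) x = 0"
    by (rule wavelet_disjoint_supports[OF j bump_position bump_position bump_far]) (use q in auto)
  then show "bump c s j q x = 0 \<or> bump c s j q' x = 0" by (auto simp: bump_def)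
qed

lemma bump_separation:
  "q < bump_count j \<Longrightarrow> q' < bump_count j \<Longrightarrow> q \<noteq> q' \<Longrightarrow>
    ennreal (amp * sqrt (2 ^ j / (2 * real N))) \<le> sup_norm (\<lambda>x. bump c s j q x - bump c s j q' x)"
  unfolding bump_def using c by (intro wavelet_separation[OF j bump_position bump_position bump_far]) auto

lemma minimax_risk_bumps:
  assumes "\<And>Y :: nat \<Rightarrow> (nat \<Rightarrow> real \<times> real) \<Rightarrow> bool list.
        (\<And>i. i \<in> {1..m} \<Longrightarrow> Y i \<in> PiM {1..n div m} (\<lambda>_. borel) \<rightarrow>\<^sub>M count_space UNIV) \<Longrightarrow>
        (\<And>i. i \<in> {1..m} \<Longrightarrow> (\<integral>\<^sup>+x. ennreal (real (length (Y i x))) \<partial>local_law \<sigma> n m (\<lambda>_. 0)) \<le> ennreal (B i)) \<Longrightarrow>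
        \<exists>G M. G \<subseteq> S \<and> G \<noteq> {} \<and> 0 \<le> M \<and> 16 * M \<le> real (card G) \<and>
          (\<forall>q\<in>G. (\<Prod>i\<in>{1..m}. 1 + msg_chi \<sigma> n m (bump c s j q) (Y i)) \<le> ennreal M)"
  shows "ennreal (amp * sqrt (2 ^ j / (2 * real N)) / 4) \<le> minimax_risk \<sigma> n m B (besov_ball j0 w s L)"
proof (rule minimax_risk_ge[where S = S and f = "bump c s j"])
  show "g \<in> borel_measurable borel" if "g \<in> besov_ball j0 w s L" for g
    using that by (simp add: besov_ball_def L2_unit_def)
  have "besov_norm j0 w s (\<lambda>_. 0) \<le> 0"
    unfolding besov_norm_def by (rule SUP_least) (simp add: inner_on_def)
  moreover have "0 < ennreal L" using c by simp
  ultimately have "besov_norm j0 w s (\<lambda>_. 0) < ennreal L" by (rule le_less_trans)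
  then show "(\<lambda>_. 0) \<in> besov_ball j0 w s L" by (simp add: besov_ball_def L2_unit_def set_integrable_def)
  show "0 < amp * sqrt (2 ^ j / (2 * real N))" using c N by simp
qed (use \<sigma> bump_in_besov_ball bump_separation assms in auto)

text \<open>Each machine is bounded as if it forwarded its whole sample, so \<open>B\<close>
  disappears; \<open>m * (n div m) = n\<close> turns the product into
  \<open>exp (2 * n * v)\<close>, and every hypothesis is good.\<close>

lemma minimax_risk_full_data:
  assumes u: "(amp * (sqrt (2 ^ j) * \<Psi>) / \<sigma>)\<^sup>2 \<le> 1" and v: "(amp / \<sigma>)\<^sup>2 \<le> v" and dvd: "m dvd n"
    and count: "16 * exp (2 * real n * v) \<le> real (bump_count j)"
  shows "ennreal (amp * sqrt (2 ^ j / (2 * real N)) / 4) \<le> minimax_risk \<sigma> n m B (besov_ball j0 w s L)"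
proof (rule minimax_risk_bumps)
  fix Y :: "nat \<Rightarrow> (nat \<Rightarrow> real \<times> real) \<Rightarrow> bool list"
  assume Y: "\<And>i. i \<in> {1..m} \<Longrightarrow> Y i \<in> PiM {1..n div m} (\<lambda>_. borel) \<rightarrow>\<^sub>M count_space UNIV"
  have v0: "v \<ge> 0" using v zero_le_power2 order_trans by blast
  have "(\<Prod>i\<in>{1..m}. 1 + msg_chi \<sigma> n m (bump c s j q) (Y i)) \<le> ennreal (exp (2 * real n * v))"
    if q: "q \<in> S" for q
  proof -
    have "(\<Prod>i\<in>{1..m}. 1 + msg_chi \<sigma> n m (bump c s j q) (Y i)) \<le> (\<Prod>i\<in>{1..m}. ennreal (exp (2 * real (n div m) * v)))"
    proof (rule prod_mono_ennreal)
      fix i assume i: "i \<in> {1..m}"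
      have "msg_chi \<sigma> n m (bump c s j q) (Y i) \<le> ennreal (exp (2 * real (n div m) * v) - 1)"
        using q bump_bound[of q] u bump_energy[of q] v v0
        by (intro msg_chi_le_energy[OF \<sigma> Y[OF i] bump_measurable]) (auto intro: order_trans ennreal_leI)
      then have "1 + msg_chi \<sigma> n m (bump c s j q) (Y i) \<le> 1 + ennreal (exp (2 * real (n div m) * v) - 1)"
        by (rule add_left_mono)
      also have "\<dots> = ennreal (1 + (exp (2 * real (n div m) * v) - 1))"
        using v0 by (subst ennreal_plus) auto
      finally show "1 + msg_chi \<sigma> n m (bump c s j q) (Y i) \<le> ennreal (exp (2 * real (n div m) * v))" by simp
    qed
    also have "\<dots> = ennreal (exp (real m * (2 * real (n div m) * v)))"
      by (simp add: ennreal_power exp_of_nat_mult)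
    also have "real m * (2 * real (n div m) * v) = 2 * (real m * real (n div m)) * v" by simp
    also have "real m * real (n div m) = real n" using dvd by (simp flip: of_nat_mult)
    finally show ?thesis .
  qed
  moreover have "S \<noteq> {}"
  proof -
    have "0 < 16 * exp (2 * real n * v)" by simp
    with count have "0 < real (bump_count j)" by linarith
    then show ?thesis by (auto simp: lessThan_empty_iff)
  qed
  ultimately show "\<exists>G M. G \<subseteq> S \<and> G \<noteq> {} \<and> 0 \<le> M \<and> 16 * M \<le> real (card G) \<and>
      (\<forall>q\<in>G. (\<Prod>i\<in>{1..m}. 1 + msg_chi \<sigma> n m (bump c s j q) (Y i)) \<le> ennreal M)"
    using count by (intro exI[of _ S] exI[of _ "exp (2 * real n * v)"]) auto
qed

text \<open>Each machine gets the better of two bounds, the full-sample divergence or the entropy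
  bound. If they amount to at most \<open>C\<close> per hypothesis on average, half of the
  hypotheses have total divergence at most \<open>2 * C\<close> and thus a product of at most
  \<open>exp (2 * C)\<close>. The 32 is 16 times the 2 lost by halving.\<close>

lemma minimax_risk_messages:
  fixes B :: "nat \<Rightarrow> real"
  assumes r': "r' \<ge> 1" and u: "r' * (amp * (sqrt (2 ^ j) * \<Psi>) / \<sigma>)\<^sup>2 \<le> 1" and v: "(amp / \<sigma>)\<^sup>2 \<le> v"
    and \<tau>: "\<tau> > 0" and r: "r \<ge> 0" and \<nu>: "\<nu> \<ge> 1" and B: "\<And>i. i \<in> {1..m} \<Longrightarrow> B i > 0"
    and \<epsilon>: "exp ((2 + r) * (1 + r) * \<tau> / 2 - r) + exp (2 * r' * real (n div m) * v - (r' - 1) * \<tau>) \<le> \<epsilon>"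
    and budget: "(\<Sum>i\<in>{1..m}. min (real (bump_count j) * (exp (2 * real (n div m) * v) - 1))
        (8 * ((exp 1)\<^sup>2 * \<tau>) * ((3 + ln \<nu>) * B i + 1 / \<nu>) + 2 * real (bump_count j) * \<epsilon>))
      \<le> real (bump_count j) * C"
    and C: "C > 0" and count: "32 * exp (2 * C) \<le> real (bump_count j)"
  shows "ennreal (amp * sqrt (2 ^ j / (2 * real N)) / 4) \<le> minimax_risk \<sigma> n m B (besov_ball j0 w s L)"
proof (rule minimax_risk_bumps)
  let ?d = "n div m" and ?Q = "real (bump_count j)"
  let ?e = "exp ((2 + r) * (1 + r) * \<tau> / 2 - r) + exp (2 * r' * real ?d * v - (r' - 1) * \<tau>)"
  fix Y :: "nat \<Rightarrow> (nat \<Rightarrow> real \<times> real) \<Rightarrow> bool list"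
  assume Y: "\<And>i. i \<in> {1..m} \<Longrightarrow> Y i \<in> PiM {1..n div m} (\<lambda>_. borel) \<rightarrow>\<^sub>M count_space UNIV"
    and len: "\<And>i. i \<in> {1..m} \<Longrightarrow> (\<integral>\<^sup>+x. ennreal (real (length (Y i x))) \<partial>local_law \<sigma> n m (\<lambda>_. 0)) \<le> ennreal (B i)"
  have v0: "v \<ge> 0" using v zero_le_power2 order_trans by blast
  define chi_sum where "chi_sum q = (\<Sum>i\<in>{1..m}. msg_chi \<sigma> n m (bump c s j q) (Y i))" for q
  have ub: "r' * (bump c s j q x / \<sigma>)\<^sup>2 \<le> 1" if "q \<in> S" for q x
    using that bump_bound[of q x] u r' by (auto intro: order_trans[OF mult_left_mono])
  have ub1: "(bump c s j q x / \<sigma>)\<^sup>2 \<le> 1" if "q \<in> S" for q x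
    using mult_right_mono[OF r' zero_le_power2[of "bump c s j q x / \<sigma>"]] ub[OF that, of x] by linarith
  have vb: "(\<integral>\<^sup>+x. ennreal ((bump c s j q x / \<sigma>)\<^sup>2) \<partial>unif) \<le> ennreal v" if "q \<in> S" for q
    using bump_energy[of q] that ennreal_leI[OF v] by (auto intro: order_trans)
  have machine: "(\<Sum>q\<in>S. msg_chi \<sigma> n m (bump c s j q) (Y i)) \<le> ennreal (min (?Q * (exp (2 * real ?d * v) - 1))
        (8 * ((exp 1)\<^sup>2 * \<tau>) * ((3 + ln \<nu>) * B i + 1 / \<nu>) + 2 * ?Q * \<epsilon>))" if i: "i \<in> {1..m}" for i
  proof -
    have "(\<Sum>q\<in>S. msg_chi \<sigma> n m (bump c s j q) (Y i)) \<le> (\<Sum>q\<in>S. ennreal (exp (2 * real ?d * v) - 1))"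
      by (intro sum_mono msg_chi_le_energy[OF \<sigma> Y[OF i] bump_measurable ub1 vb v0]) auto
    also have "\<dots> = ennreal (?Q * (exp (2 * real ?d * v) - 1))"
      using v0 by (simp add: ennreal_mult ennreal_of_nat_eq_real_of_nat)
    finally have 1: "(\<Sum>q\<in>S. msg_chi \<sigma> n m (bump c s j q) (Y i)) \<le> ennreal (?Q * (exp (2 * real ?d * v) - 1))" .
    have "(\<Sum>q\<in>S. msg_chi \<sigma> n m (bump c s j q) (Y i))
       \<le> ennreal (8 * ((exp 1)\<^sup>2 * \<tau>) * ((3 + ln \<nu>) * B i + 1 / \<nu>) + 2 * real (card S) * ?e)"
      using B[OF i]
      by (intro sum_msg_chi_le[OF \<sigma> Y[OF i] _ bump_measurable bump_disjoint \<tau> r r' v0 ub vb len[OF i] _ \<nu>]) auto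
    also have "\<dots> \<le> ennreal (8 * ((exp 1)\<^sup>2 * \<tau>) * ((3 + ln \<nu>) * B i + 1 / \<nu>) + 2 * ?Q * \<epsilon>)"
      by (intro ennreal_leI add_left_mono) (use \<epsilon> in \<open>auto intro!: mult_left_mono\<close>)
    finally show ?thesis using 1 by (simp add: min_def)
  qed
  have "(\<Sum>q\<in>S. chi_sum q) = (\<Sum>i\<in>{1..m}. \<Sum>q\<in>S. msg_chi \<sigma> n m (bump c s j q) (Y i))"
    unfolding chi_sum_def by (rule sum.swap)
  also have "\<dots> \<le> (\<Sum>i\<in>{1..m}. ennreal (min (?Q * (exp (2 * real ?d * v) - 1))
        (8 * ((exp 1)\<^sup>2 * \<tau>) * ((3 + ln \<nu>) * B i + 1 / \<nu>) + 2 * ?Q * \<epsilon>)))"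
    by (rule sum_mono) (rule machine)
  also have "\<dots> = ennreal (\<Sum>i\<in>{1..m}. min (?Q * (exp (2 * real ?d * v) - 1))
        (8 * ((exp 1)\<^sup>2 * \<tau>) * ((3 + ln \<nu>) * B i + 1 / \<nu>) + 2 * ?Q * \<epsilon>))"
  proof (rule sum_ennreal)
    fix i assume i: "i \<in> {1..m}"
    have "0 \<le> ?e" by simp
    then have "0 \<le> \<epsilon>" using \<epsilon> by (rule order_trans)
    then show "0 \<le> min (?Q * (exp (2 * real ?d * v) - 1))
        (8 * ((exp 1)\<^sup>2 * \<tau>) * ((3 + ln \<nu>) * B i + 1 / \<nu>) + 2 * ?Q * \<epsilon>)"
      using v0 \<tau> \<nu> B[OF i] by (simp add: less_imp_le)
  qed
  also have "\<dots> \<le> ennreal (real (card S) * C)" using budget by (intro ennreal_leI) simp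
  finally have "real (card S) / 2 \<le> real (card {q \<in> S. chi_sum q \<le> ennreal (2 * C)})"
    by (intro markov_card C) auto
  then have G: "16 * exp (2 * C) \<le> real (card {q \<in> S. chi_sum q \<le> ennreal (2 * C)})" (is "_ \<le> real (card ?G)")
    using count by simp
  moreover have "?G \<noteq> {}"
  proof
    assume "?G = {}"
    then have "16 * exp (2 * C) \<le> 0" using G by (simp only: card.empty of_nat_0)
    then show False by (simp add: not_le[symmetric])
  qed
  moreover have "(\<Prod>i\<in>{1..m}. 1 + msg_chi \<sigma> n m (bump c s j q) (Y i)) \<le> ennreal (exp (2 * C))" if "q \<in> ?G" for q
    using that C by (intro prod_one_plus_le_exp_sum) (auto simp: chi_sum_def)
  ultimately show "\<exists>G M. G \<subseteq> S \<and> G \<noteq> {} \<and> 0 \<le> M \<and> 16 * M \<le> real (card G) \<and>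
      (\<forall>q\<in>G. (\<Prod>i\<in>{1..m}. 1 + msg_chi \<sigma> n m (bump c s j q) (Y i)) \<le> ennreal M)"
    by (intro exI[of _ ?G] exI[of _ "exp (2 * C)"]) auto
qed

end

end

section \<open>Choice of the level\<close>

context cdv_interior
begin

text \<open>\<open>\<kappa>\<close> is the desired real value of \<open>2 ^ j\<close>, rounded down
  to a power of two. The bounds on squared norm and squared sup-norm then lose powers of 2, while
  the separation only gains.\<close>

lemma exists_bump_level:
  assumes \<sigma>: "\<sigma> > 0" and c: "c > 0" and s: "s > 0"
    and \<kappa>: "\<kappa> \<ge> 16 * real N" "\<kappa> \<ge> 2 * 2 ^ j0"
  obtains j where "j0 \<le> j"
    "(c * 2 powr (- (real j * (s + 1 / 2))) / \<sigma>)\<^sup>2 \<le> c\<^sup>2 * 2 powr (1 + 2 * s) / \<sigma>\<^sup>2 * \<kappa> powr (- (1 + 2 * s))"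
    "(c * 2 powr (- (real j * (s + 1 / 2))) * (sqrt (2 ^ j) * \<Psi>) / \<sigma>)\<^sup>2
      \<le> c\<^sup>2 * \<Psi>\<^sup>2 * 2 powr (2 * s) / \<sigma>\<^sup>2 * \<kappa> powr (- (2 * s))"
    "\<kappa> / (8 * real N) \<le> real (bump_count j)"
    "c / sqrt (2 * real N) * \<kappa> powr (- s) \<le> c * 2 powr (- (real j * (s + 1 / 2))) * sqrt (2 ^ j / (2 * real N))"
proof -
  have "\<kappa> \<ge> 1" using \<kappa>(1) N by (simp add: order_trans[of 1 "16 * real N"])
  then obtain j where j: "2 ^ j \<le> \<kappa>" "\<kappa> < 2 * 2 ^ j" by (rule exists_dyadic_level)
  define X :: real where "X = 2 ^ j"
  have X: "X > 0" "X \<le> \<kappa>" "\<kappa> / 2 < X" using j by (auto simp: X_def)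
  have \<kappa>0: "\<kappa> > 0" using X by linarith
  have amp: "c * 2 powr (- (real j * (s + 1 / 2))) = c * X powr (- (s + 1 / 2))"
  proof -
    have "X powr a = 2 powr (real j * a)" for a
      by (simp add: X_def powr_realpow[symmetric] powr_powr)
    then show ?thesis by (simp only: mult_minus_right)
  qed
  have dbl: "X powr (- a) \<le> 2 powr a * \<kappa> powr (- a)" if "a > 0" for a
  proof -
    have "X powr (- a) \<le> (\<kappa> / 2) powr (- a)" using X \<kappa>0 that by (intro powr_mono2') auto
    also have "\<dots> = 2 powr a * \<kappa> powr (- a)" using \<kappa>0 by (simp add: powr_divide powr_minus field_simps)
    finally show ?thesis .
  qed
  have sq: "(X powr a)\<^sup>2 = X powr (2 * a)" for a
    by (simp add: power2_eq_square powr_add[symmetric])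
  have sqrtX: "sqrt X = X powr (1 / 2)" using X by (simp add: powr_half_sqrt)
  have "(2::real) ^ j0 < 2 ^ j" using \<kappa>(2) j(2) by linarith
  then have "j0 \<le> j" by simp
  moreover have "(c * 2 powr (- (real j * (s + 1 / 2))) / \<sigma>)\<^sup>2 \<le> c\<^sup>2 * 2 powr (1 + 2 * s) / \<sigma>\<^sup>2 * \<kappa> powr (- (1 + 2 * s))"
  proof -
    have "(c * X powr (- (s + 1 / 2)) / \<sigma>)\<^sup>2 = c\<^sup>2 / \<sigma>\<^sup>2 * X powr (- (1 + 2 * s))"
    proof -
      have "2 * (- (s + 1 / 2)) = - (1 + 2 * s)" by simp
      then have "(X powr (- (s + 1 / 2)))\<^sup>2 = X powr (- (1 + 2 * s))" by (simp only: sq)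
      then show ?thesis by (simp only: power_divide power_mult_distrib times_divide_eq_left)
    qed
    also have "\<dots> \<le> c\<^sup>2 / \<sigma>\<^sup>2 * (2 powr (1 + 2 * s) * \<kappa> powr (- (1 + 2 * s)))"
      using s by (intro mult_left_mono dbl) auto
    finally show ?thesis by (simp add: amp)
  qed
  moreover have "(c * 2 powr (- (real j * (s + 1 / 2))) * (sqrt (2 ^ j) * \<Psi>) / \<sigma>)\<^sup>2
      \<le> c\<^sup>2 * \<Psi>\<^sup>2 * 2 powr (2 * s) / \<sigma>\<^sup>2 * \<kappa> powr (- (2 * s))"
  proof -
    have "X powr (- (s + 1 / 2)) * sqrt X = X powr (- s)"
      by (simp add: sqrtX powr_add[symmetric])
    then have "(c * X powr (- (s + 1 / 2)) * (sqrt X * \<Psi>) / \<sigma>)\<^sup>2 = (c * \<Psi> / \<sigma> * X powr (- s))\<^sup>2"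
      by (simp add: mult_ac)
    also have "\<dots> = c\<^sup>2 * \<Psi>\<^sup>2 / \<sigma>\<^sup>2 * X powr (- (2 * s))"
      by (simp add: power_divide power_mult_distrib sq)
    also have "\<dots> \<le> c\<^sup>2 * \<Psi>\<^sup>2 / \<sigma>\<^sup>2 * (2 powr (2 * s) * \<kappa> powr (- (2 * s)))"
      using s by (intro mult_left_mono dbl) auto
    finally show ?thesis by (simp add: amp X_def)
  qed
  moreover have "\<kappa> / (8 * real N) \<le> real (bump_count j)"
  proof -
    have N0: "real N > 0" using N by simp
    have "X / (2 * real N) - 1 \<le> real (2 ^ j div (2 * N))"
    proof -
      have "2 ^ j < (2 ^ j div (2 * N) + 1) * (2 * N)"
        using N dividend_less_times_div[of "2 * N" "2 ^ j"] by (simp add: algebra_simps)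
      then have "real (2 ^ j) < real ((2 ^ j div (2 * N) + 1) * (2 * N))" by (simp only: of_nat_less_iff)
      then show ?thesis using N0 by (simp add: X_def field_simps)
    qed
    moreover have "real (2 ^ j div (2 * N)) - 1 \<le> real (bump_count j)" by (simp add: bump_count_def)
    \<comment> \<open>The integer division and the \<open>- 1\<close> in \<open>bump_count\<close>
      cost at most 2, and one half of \<open>X / (2 * real N)\<close> pays for them.\<close>
    moreover have "2 \<le> X / (4 * real N)" using \<kappa>(1) X N0 by (simp add: field_simps)
    moreover have "\<kappa> / (8 * real N) \<le> X / (4 * real N)" using X N0 by (simp add: field_simps)
    moreover have "X / (2 * real N) = X / (4 * real N) + X / (4 * real N)" by simp
    ultimately show ?thesis by linarith
  qed
  moreover have "c / sqrt (2 * real N) * \<kappa> powr (- s) \<le> c * 2 powr (- (real j * (s + 1 / 2))) * sqrt (2 ^ j / (2 * real N))"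
  proof -
    have "X powr (- (s + 1 / 2)) * sqrt X = X powr (- s)"
      by (simp add: sqrtX powr_add[symmetric])
    then have "c * X powr (- (s + 1 / 2)) * sqrt (X / (2 * real N)) = c / sqrt (2 * real N) * X powr (- s)"
      by (simp add: real_sqrt_divide)
    moreover have "\<kappa> powr (- s) \<le> X powr (- s)" using X s by (intro powr_mono2') auto
    ultimately show ?thesis using c by (simp add: amp X_def mult_left_mono divide_right_mono)
  qed
  ultimately show ?thesis by (rule that)
qed

end

section \<open>Elementary growth estimates\<close>

lemma eventually_powr_ge:
  assumes "a > 0"
  shows "eventually (\<lambda>n::nat. C \<le> real n powr a) sequentially"
  using assms by real_asymp

lemma eventually_ln_ge: "eventually (\<lambda>n::nat. C \<le> ln (real n)) sequentially"
  by real_asymp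

lemma eventually_ln_le_sqrt: "eventually (\<lambda>n::nat. ln (real n) \<le> real n powr (1 / 2)) sequentially"
  by real_asymp

lemma ln_le_log_2: "ln x \<le> log 2 x" if "x \<ge> 1" for x :: real
proof -
  have "ln 2 \<le> (1::real)" using ln_le_minus_one[of 2] by simp
  moreover have "ln (2::real) > 0" by simp
  ultimately show ?thesis using that by (simp add: log_def pos_le_divide_eq mult_left_le)
qed

lemma mult_powr_minus_le_1:
  fixes y \<kappa> a :: real
  assumes "y > 0" and "a > 0" and "\<kappa> \<ge> y powr (1 / a)"
  shows "y * \<kappa> powr (- a) \<le> 1"
proof -
  have pos: "y powr (1 / a) > 0" using assms by simp
  then have \<kappa>: "\<kappa> > 0" using assms(3) by linarith
  have "y = (y powr (1 / a)) powr a" using assms by (simp add: powr_powr)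
  also have "\<dots> \<le> \<kappa> powr a" using assms pos by (intro powr_mono2) auto
  finally show ?thesis using \<kappa> by (simp add: powr_minus field_simps)
qed

section \<open>The two rates for large sample sizes\<close>

context cdv_interior
begin

text \<open>\<open>c1\<close> and \<open>c2\<close> are the constants in the bounds on the squared
  norm and squared sup-norm of a bump over \<open>\<sigma>\<close>; \<open>c3\<close> is a quarter
  of the separation constant. A small \<open>c1\<close> serves both rates: it makes the full-data
  second moment a small power of \<open>n\<close>, and the energy threshold of a machine small
  against \<open>1 / log 2 n\<close>.\<close>

context
  fixes s c L \<sigma> p c1 c2 c3 :: real
  assumes s: "s > 0" and \<sigma>: "\<sigma> > 0" and c: "0 < c" "c < L"
    and p_eq: "p = 1 + 2 * s"
    and c1_eq: "c1 = c\<^sup>2 * 2 powr (1 + 2 * s) / \<sigma>\<^sup>2"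
    and c2_eq: "c2 = c\<^sup>2 * \<Psi>\<^sup>2 * 2 powr (2 * s) / \<sigma>\<^sup>2"
    and c3_eq: "c3 = c / sqrt (2 * real N) / 4"
    and c_small: "c1 \<le> 1 / (24 * p)"
begin

lemma c2_pos: "c2 > 0" using c \<sigma> \<Psi> by (simp add: c2_eq)

text \<open>With \<open>\<kappa> = (n / ln n) powr (1 / p)\<close> the exponent
  \<open>2 * n * v\<close> becomes \<open>2 * c1 * ln n\<close>, so the second moment is at most
  \<open>n powr (1 / (4 * p))\<close>. The number of bumps is at least of order
  \<open>n powr (1 / (2 * p))\<close>, and the surplus absorbs the factor \<open>128 * N\<close>,
  where 128 = 16 * 8.\<close>

lemma minimax_lower_full_data:
  "eventually (\<lambda>n. \<forall>m B. m dvd n \<longrightarrow>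
     ennreal (c3 * (real n / ln (real n)) powr (- (s / p))) \<le> minimax_risk \<sigma> n m B (besov_ball j0 w s L)) sequentially"
proof -
  define C where "C = max (max (16 * real N) (2 * 2 ^ j0)) (c2 powr (1 / (2 * s)))"
  have ev: "eventually (\<lambda>n::nat. C \<le> real n powr (1 / (2 * p))) sequentially"
    "eventually (\<lambda>n::nat. 128 * real N \<le> real n powr (1 / (4 * p))) sequentially"
    using s by (auto intro!: eventually_powr_ge simp: p_eq)
  show ?thesis
    using ev eventually_ln_ge[of 1] eventually_ln_le_sqrt eventually_ge_at_top[of 2]
  proof eventually_elim
    case (elim n)
    show ?case
    proof (intro allI impI)
      fix m and B :: "nat \<Rightarrow> real" assume dvd: "m dvd n"
      have n: "real n > 0" using elim(5) by simp
      have p: "p > 0" using s by (simp add: p_eq)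
      have ln0: "ln (real n) > 0" using elim(3) by linarith
      define \<kappa> where "\<kappa> = (real n / ln (real n)) powr (1 / p)"
      \<comment> \<open>The crude bound of \<open>ln n\<close> by the square root of
        \<open>n\<close> suffices, since \<open>\<kappa>\<close> only has to exceed a fixed power of
        \<open>n\<close>.\<close>
      have "real n powr (1 / 2) \<le> real n / ln (real n)"
      proof -
        have "real n powr (1 / 2) * ln (real n) \<le> real n powr (1 / 2) * real n powr (1 / 2)"
          by (rule mult_left_mono[OF elim(4)]) simp
        also have "\<dots> = real n" using n by (simp add: powr_add[symmetric])
        finally show ?thesis using ln0 by (simp add: pos_le_divide_eq)
      qed
      then have "(real n powr (1 / 2)) powr (1 / p) \<le> \<kappa>" unfolding \<kappa>_def using p n by (intro powr_mono2) auto
      then have \<kappa>_ge: "real n powr (1 / (2 * p)) \<le> \<kappa>" by (simp add: powr_powr)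
      then have "C \<le> \<kappa>" using elim(1) by linarith
      then have \<kappa>: "\<kappa> \<ge> 16 * real N" "\<kappa> \<ge> 2 * 2 ^ j0" "\<kappa> \<ge> c2 powr (1 / (2 * s))" by (auto simp: C_def)
      have \<kappa>p: "\<kappa> powr (- p) = ln (real n) / real n"
      proof -
        have "1 / p * (- p) = - 1" using p by (simp add: field_simps)
        then have "\<kappa> powr (- p) = (real n / ln (real n)) powr (- 1)" unfolding \<kappa>_def powr_powr by (simp only:)
        then show ?thesis using n ln0 by (simp add: powr_minus_divide)
      qed
      obtain j where j: "j0 \<le> j"
        "(c * 2 powr (- (real j * (s + 1 / 2))) / \<sigma>)\<^sup>2 \<le> c1 * \<kappa> powr (- p)"
        "(c * 2 powr (- (real j * (s + 1 / 2))) * (sqrt (2 ^ j) * \<Psi>) / \<sigma>)\<^sup>2 \<le> c2 * \<kappa> powr (- (2 * s))"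
        "\<kappa> / (8 * real N) \<le> real (bump_count j)"
        "c / sqrt (2 * real N) * \<kappa> powr (- s) \<le> c * 2 powr (- (real j * (s + 1 / 2))) * sqrt (2 ^ j / (2 * real N))"
        using \<sigma> c(1) s \<kappa>(1,2) unfolding p_eq c1_eq c2_eq by (rule exists_bump_level)
      have "ennreal (c * 2 powr (- (real j * (s + 1 / 2))) * sqrt (2 ^ j / (2 * real N)) / 4)
          \<le> minimax_risk \<sigma> n m B (besov_ball j0 w s L)"
      proof (rule minimax_risk_full_data[OF \<sigma> c j(1) _ j(2) dvd])
        show "(c * 2 powr (- (real j * (s + 1 / 2))) * (sqrt (2 ^ j) * \<Psi>) / \<sigma>)\<^sup>2 \<le> 1"
          using j(3) mult_powr_minus_le_1[OF c2_pos _ \<kappa>(3)] s by linarith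
        have N0: "real N > 0" using N by simp
        have "2 * real n * (c1 * \<kappa> powr (- p)) = 2 * c1 * ln (real n)"
          unfolding \<kappa>p using n by simp
        also have "\<dots> \<le> 2 * (1 / (24 * p)) * ln (real n)"
          using c_small ln0 by (intro mult_right_mono mult_left_mono) auto
        also have "\<dots> \<le> 1 / (4 * p) * ln (real n)" using p ln0 by (intro mult_right_mono) (auto simp: field_simps)
        finally have "exp (2 * real n * (c1 * \<kappa> powr (- p))) \<le> real n powr (1 / (4 * p))"
          using n by (simp add: powr_def)
        then have "16 * exp (2 * real n * (c1 * \<kappa> powr (- p))) \<le> 16 * real n powr (1 / (4 * p))" by simp
        also have "\<dots> \<le> \<kappa> / (8 * real N)"
        proof -
          have half: "1 / (4 * p) + 1 / (4 * p) = 1 / (2 * p)" by simp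
          have "128 * real N * real n powr (1 / (4 * p)) \<le> real n powr (1 / (4 * p)) * real n powr (1 / (4 * p))"
            by (rule mult_right_mono[OF elim(2)]) simp
          also have "\<dots> = real n powr (1 / (2 * p))" by (simp only: powr_add[symmetric] half)
          also have "\<dots> \<le> \<kappa>" by (rule \<kappa>_ge)
          finally show ?thesis using N0 by (simp add: field_simps)
        qed
        also have "\<dots> \<le> real (bump_count j)" by (rule j(4))
        finally show "16 * exp (2 * real n * (c1 * \<kappa> powr (- p))) \<le> real (bump_count j)" .
      qed
      moreover have "c3 * (real n / ln (real n)) powr (- (s / p))
          \<le> c * 2 powr (- (real j * (s + 1 / 2))) * sqrt (2 ^ j / (2 * real N)) / 4"
      proof -
        have "\<kappa> powr (- s) = (real n / ln (real n)) powr (- (s / p))" unfolding \<kappa>_def by (simp add: powr_powr)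
        then show ?thesis using j(5) by (simp add: c3_eq)
      qed
      ultimately show "ennreal (c3 * (real n / ln (real n)) powr (- (s / p))) \<le> minimax_risk \<sigma> n m B (besov_ball j0 w s L)"
        by (meson ennreal_leI order_trans)
    qed
  qed
qed

text \<open>The lower bound on \<open>m\<close> gives \<open>\<delta> \<ge> 1 / n\<close>, hence
  \<open>\<kappa> \<le> n powr (1 / p)\<close>. The upper bound then gives
  \<open>d / \<kappa>\<close>, the mean number of design points per bump up to constants, an order
  of at least \<open>(ln n)\<^sup>2\<close>, which makes overfull bumps improbable. With both parts
  of the remainder below \<open>1 / n\<close>, the budget comes down to
  \<open>D * \<Sigma> \<le> 1\<close>.\<close>

lemma minimax_lower_messages:
  assumes K: "K > 0"
  shows "eventually (\<lambda>n. \<forall>m B \<delta>. m dvd n \<longrightarrow> log 2 (real n) \<le> real m \<longrightarrow>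
     real m \<le> K * (real n powr (2 * s / p) / (ln (real n))\<^sup>2) \<longrightarrow> (\<forall>i\<in>{1..m}. B i > 0) \<longrightarrow>
     delta_solution s n m B \<delta> \<longrightarrow>
     ennreal (c3 * \<delta> powr (s / p)) \<le> minimax_risk \<sigma> n m B (besov_ball j0 w s L)) sequentially"
proof -
  have p: "p > 1" using s by (simp add: p_eq)
  have N0: "real N \<ge> 1" using N by simp
  have c1: "c1 > 0" "c1 \<le> 1 / 24"
  proof -
    show "c1 > 0" using c \<sigma> by (simp add: c1_eq)
    have "1 / (24 * p) \<le> 1 / 24" using p by (intro divide_left_mono) auto
    then show "c1 \<le> 1 / 24" using c_small by linarith
  qed
  define e2 :: real where "e2 = (exp 1)\<^sup>2"
  have e2: "e2 \<ge> 1" unfolding e2_def by (simp add: one_le_power)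
  \<comment> \<open>1024 = 8 * 4 * 4 * 8: the entropy bound, \<open>\<tau> = 4 * c1 * D\<close>,
    \<open>3 + ln n \<le> 4 * lg\<close>, and \<open>\<kappa> \<le> 8 * N * Q\<close>.
    \<open>C5\<close> collects the terms that are divided by \<open>n\<close>.\<close>
  define C4 where "C4 = 1024 * real N * e2 * c1"
  define C5 where "C5 = 32 * e2 * c1 + 4"
  define C where "C = C4 + C5"
  have C45: "C4 > 0" "C5 > 0" "C > 0" using e2 c1 N0 by (simp_all add: C4_def C5_def C_def add_pos_pos)
  \<comment> \<open>The thresholds ensure, in this order, that enough bumps fit, that the level is
    at least \<open>j0\<close>, that \<open>r' \<ge> 1\<close>, and that there are at least
    \<open>32 * exp (2 * C)\<close> bumps (256 = 8 * 32).\<close>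
  define \<kappa>1 where "\<kappa>1 = Max {16 * real N, 2 * 2 ^ j0, c2 powr (1 / (2 * s)), 256 * real N * exp (2 * C)}"
  have ev: "eventually (\<lambda>n::nat. K * \<kappa>1 powr p \<le> real n powr (1 / p)) sequentially"
    using p by (auto intro!: eventually_powr_ge)
  show ?thesis
    using ev eventually_ln_ge[of 1] eventually_ln_ge[of "c2 * K / c1"] eventually_ge_at_top[of 2]
  proof eventually_elim
    case (elim n)
    show ?case
    proof (intro allI impI)
      fix m \<delta> and B :: "nat \<Rightarrow> real"
      assume dvd: "m dvd n" and mlog: "log 2 (real n) \<le> real m"
        and mK: "real m \<le> K * (real n powr (2 * s / p) / (ln (real n))\<^sup>2)"
        and B: "\<forall>i\<in>{1..m}. B i > 0" and sol: "delta_solution s n m B \<delta>"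
      define lg where "lg = log 2 (real n)"
      define lnn where "lnn = ln (real n)"
      have n: "real n \<ge> 2" using elim(4) by simp
      have lnn: "lnn \<ge> 1" "lnn \<le> lg" using elim(2) n by (simp_all add: lnn_def lg_def ln_le_log_2)
      have lg: "lg \<ge> 1" using lnn by linarith
      have m: "real m \<ge> 1" using mlog lg by (simp add: lg_def)
      define d where "d = n div m"
      have dm: "real m * real d = real n" using dvd by (simp add: d_def flip: of_nat_mult)
      have d: "real d > 0" using dm n m by (metis mult_zero_right not_numeral_le_zero of_nat_0_le_iff order_less_le)
      have d_eq: "real d = real n / real m" using dm m by (simp add: field_simps)
      define \<mu> where "\<mu> i = min (lg * \<delta> powr (1 / p) * B i) 1" for i
      define \<Sigma> where "\<Sigma> = (\<Sum>i\<in>{1..m}. \<mu> i)"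
      have \<delta>: "\<delta> > 0" "\<delta> = min (real m / (real n * lg)) (real m / (real n * \<Sigma>))"
        using sol unfolding delta_solution_def \<Sigma>_def \<mu>_def lg_def p_eq by auto
      have \<mu>: "0 < \<mu> i" "\<mu> i \<le> 1" if "i \<in> {1..m}" for i
        using B that lg \<delta>(1) by (auto simp: \<mu>_def)
      have \<Sigma>: "0 < \<Sigma>" "\<Sigma> \<le> real m"
      proof -
        show "0 < \<Sigma>" unfolding \<Sigma>_def using \<mu>(1) m by (intro sum_pos) auto
        have "\<Sigma> \<le> (\<Sum>i\<in>{1..m}. 1)" unfolding \<Sigma>_def using \<mu>(2) by (intro sum_mono) auto
        then show "\<Sigma> \<le> real m" by simp
      qed
      \<comment> \<open>Up to the factor \<open>c1\<close>, a bound for the mean energy of one bump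
        in a local sample.\<close>
      define D where "D = real d * \<delta>"
      have D0: "D > 0" using d \<delta>(1) by (simp add: D_def)
      have Dlg: "D \<le> 1 / lg"
      proof -
        have "D \<le> real d * (real m / (real n * lg))" unfolding D_def using d \<delta>(2) by (intro mult_left_mono) auto
        also have "\<dots> = 1 / lg" using m n by (simp add: d_eq)
        finally show ?thesis .
      qed
      have D\<Sigma>: "D * \<Sigma> \<le> 1"
      proof -
        have "D \<le> real d * (real m / (real n * \<Sigma>))" unfolding D_def using d \<delta>(2) by (intro mult_left_mono) auto
        also have "\<dots> = 1 / \<Sigma>" using m n by (simp add: d_eq)
        finally show ?thesis using \<Sigma>(1) by (simp add: field_simps)
      qed
      have D1: "D \<le> 1" using Dlg lg by (meson divide_le_eq_1_pos less_le_trans order_trans zero_less_one)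
      have \<delta>_lower: "1 / real n \<le> \<delta>"
      proof -
        have "1 / real n \<le> real m / (real n * lg)" using mlog lg n by (simp add: lg_def field_simps)
        moreover have "1 / real n \<le> real m / (real n * \<Sigma>)" using \<Sigma> n by (simp add: field_simps)
        ultimately show ?thesis using \<delta>(2) by simp
      qed
      define \<kappa> where "\<kappa> = \<delta> powr (- (1 / p))"
      have \<kappa>0: "\<kappa> > 0" using \<delta>(1) by (simp add: \<kappa>_def)
      have \<kappa>p: "\<kappa> powr (- p) = \<delta>"
      proof -
        have "- (1 / p) * (- p) = 1" using p by (simp add: field_simps)
        then have "\<kappa> powr (- p) = \<delta> powr 1" unfolding \<kappa>_def powr_powr by (simp only:)
        then show ?thesis using \<delta>(1) by simp
      qed
      have \<kappa>s: "\<kappa> powr (- s) = \<delta> powr (s / p)" by (simp add: \<kappa>_def powr_powr)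
      have \<delta>_inv: "\<delta> powr (1 / p) = 1 / \<kappa>" unfolding \<kappa>_def using \<delta>(1) by (simp add: powr_minus field_simps)
      have np: "real n = real n powr (1 / p) * real n powr (2 * s / p)"
      proof -
        have "1 / p + 2 * s / p = 1" using p by (simp add: add_divide_distrib[symmetric] p_eq)
        then show ?thesis unfolding powr_add[symmetric] using n by simp
      qed
      have npos: "real n powr a > 0" for a using n by simp
      have d_lower: "real n powr (1 / p) * lnn\<^sup>2 / K \<le> real d"
      proof -
        have "real n / (K * (real n powr (2 * s / p) / lnn\<^sup>2)) \<le> real n / real m"
        proof (intro divide_left_mono mult_pos_pos)
          show "real m \<le> K * (real n powr (2 * s / p) / lnn\<^sup>2)" using mK by (simp add: lnn_def)
        qed (use K npos[of "2 * s / p"] lnn m n in auto)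
        moreover have "real n / (K * (real n powr (2 * s / p) / lnn\<^sup>2)) = real n powr (1 / p) * lnn\<^sup>2 / K"
          using npos[of "2 * s / p"] K lnn by (subst np) (simp add: field_simps)
        ultimately show ?thesis by (simp add: d_eq)
      qed
      have \<kappa>_upper: "\<kappa> \<le> real n powr (1 / p)"
      proof -
        have "\<kappa> \<le> (1 / real n) powr (- (1 / p))"
          unfolding \<kappa>_def using \<delta>_lower n p by (intro powr_mono2') auto
        also have "\<dots> = real n powr (1 / p)" using n by (simp add: powr_divide powr_minus field_simps)
        finally show ?thesis .
      qed
      \<comment> \<open>\<open>\<kappa>\<close> is large because \<open>D \<le> 1\<close> means
        \<open>\<delta> \<le> 1 / d\<close>, and \<open>d\<close> is at least of order
        \<open>n powr (1 / p)\<close>.\<close>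
      have \<kappa>_lower: "\<kappa>1 \<le> \<kappa>"
      proof -
        have "\<delta> \<le> D / real d" using d by (simp add: D_def)
        also have "\<dots> \<le> 1 / (real n powr (1 / p) * lnn\<^sup>2 / K)"
          using D1 D0 d_lower K lnn n by (intro frac_le) auto
        also have "\<dots> \<le> K / real n powr (1 / p)"
        proof -
          have "1 \<le> lnn\<^sup>2" using lnn by (simp add: one_le_power)
          then have "K / lnn\<^sup>2 \<le> K / 1" using K by (intro divide_left_mono) auto
          then have "K / lnn\<^sup>2 / real n powr (1 / p) \<le> K / real n powr (1 / p)"
            by (intro divide_right_mono) auto
          then show ?thesis by (simp add: mult.commute)
        qed
        also have "\<dots> \<le> \<kappa>1 powr (- p)"
        proof -
          have "\<kappa>1 > 0" using N0 by (auto simp: \<kappa>1_def less_max_iff_disj)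
          then show ?thesis using elim(1) npos[of "1 / p"] by (simp add: powr_minus field_simps)
        qed
        finally have "\<kappa> \<ge> (\<kappa>1 powr (- p)) powr (- (1 / p))"
          unfolding \<kappa>_def using \<delta>(1) p by (intro powr_mono2') auto
        moreover have "- p * (- (1 / p)) = 1" using p by (simp add: field_simps)
        moreover have "\<kappa>1 > 0" using N0 by (auto simp: \<kappa>1_def less_max_iff_disj)
        ultimately show ?thesis unfolding powr_powr by simp
      qed
      have \<kappa>: "16 * real N \<le> \<kappa>" "2 * 2 ^ j0 \<le> \<kappa>" "c2 powr (1 / (2 * s)) \<le> \<kappa>" "256 * real N * exp (2 * C) \<le> \<kappa>"
        using \<kappa>_lower unfolding \<kappa>1_def by (auto simp: Max_le_iff)
      obtain j where j: "j0 \<le> j"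
        "(c * 2 powr (- (real j * (s + 1 / 2))) / \<sigma>)\<^sup>2 \<le> c1 * \<kappa> powr (- p)"
        "(c * 2 powr (- (real j * (s + 1 / 2))) * (sqrt (2 ^ j) * \<Psi>) / \<sigma>)\<^sup>2 \<le> c2 * \<kappa> powr (- (2 * s))"
        "\<kappa> / (8 * real N) \<le> real (bump_count j)"
        "c / sqrt (2 * real N) * \<kappa> powr (- s) \<le> c * 2 powr (- (real j * (s + 1 / 2))) * sqrt (2 ^ j / (2 * real N))"
        using \<sigma> c(1) s \<kappa>(1,2) unfolding p_eq c1_eq c2_eq by (rule exists_bump_level)
      define Q where "Q = real (bump_count j)"
      have Q\<kappa>: "\<kappa> \<le> 8 * real N * Q" using j(4) N0 by (simp add: Q_def field_simps)
      have Q1: "Q \<ge> 1"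
      proof -
        have "16 * real N \<le> 8 * real N * Q" using Q\<kappa> \<kappa>(1) by linarith
        then show ?thesis using N0 by simp
      qed
      \<comment> \<open>The largest exponent that the sup-norm bound
        \<open>c2 * \<kappa> powr (- (2 * s))\<close> allows.\<close>
      define r' where "r' = \<kappa> powr (2 * s) / c2"
      \<comment> \<open>Four times the mean-energy bound \<open>c1 * D\<close>: against the growth
        \<open>2 * c1 * r' * D\<close> of the exponential moment this leaves the exponent
        \<open>\<tau> - 2 * c1 * r' * D\<close>.\<close>
      define \<tau> where "\<tau> = 4 * c1 * D"
      \<comment> \<open>The minimiser of \<open>3 / 2 * r\<^sup>2 * \<tau> - r\<close>, which
        dominates the truncation exponent for \<open>r \<ge> 2\<close>; the minimum is
        \<open>- 1 / (6 * \<tau>)\<close>.\<close>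
      define r where "r = 1 / (3 * \<tau>)"
      have c2\<kappa>: "c2 * \<kappa> powr (- (2 * s)) \<le> 1" using mult_powr_minus_le_1[OF c2_pos _ \<kappa>(3)] s by simp
      have r'1: "r' \<ge> 1" using c2\<kappa> c2_pos \<kappa>0 unfolding r'_def by (simp add: powr_minus field_simps)
      have \<tau>0: "\<tau> > 0" using c1 D0 by (simp add: \<tau>_def)
      have \<tau>6: "\<tau> \<le> 1 / 6" using mult_mono[of c1 "1 / 24" D 1] c1 D0 D1 by (simp add: \<tau>_def)
      have \<tau>lg: "\<tau> \<le> 1 / (6 * lg)" using mult_mono[of c1 "1 / 24" D "1 / lg"] c1 D0 Dlg lg by (simp add: \<tau>_def)
      have \<epsilon>1: "exp ((2 + r) * (1 + r) * \<tau> / 2 - r) \<le> 1 / real n"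
      proof -
        have r2: "r \<ge> 2" using \<tau>6 \<tau>0 by (simp add: r_def field_simps)
        have "(2 + r) * (1 + r) \<le> (2 * r) * (3 / 2 * r)" using r2 by (intro mult_mono) auto
        then have "(2 + r) * (1 + r) * \<tau> / 2 - r \<le> (2 * r) * (3 / 2 * r) * \<tau> / 2 - r"
          using \<tau>0 by (intro diff_right_mono divide_right_mono mult_right_mono) auto
        also have "\<dots> = - (1 / (6 * \<tau>))" using \<tau>0 by (simp add: r_def field_simps)
        also have "\<dots> \<le> - lg" using \<tau>lg \<tau>0 lg by (simp add: field_simps)
        also have "\<dots> \<le> - lnn" using lnn by simp
        finally have "exp ((2 + r) * (1 + r) * \<tau> / 2 - r) \<le> exp (- lnn)" by simp
        then show ?thesis using n by (simp add: lnn_def exp_minus field_simps)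
      qed
      have \<epsilon>2: "exp (2 * r' * real d * (c1 * \<delta>) - (r' - 1) * \<tau>) \<le> 1 / real n"
      proof -
        \<comment> \<open>\<open>r' * D\<close> is a multiple of the number of design points per
          bump. Of the two factors \<open>ln n\<close> that bound it from below, one beats the
          constants and the other gives the power of \<open>n\<close>.\<close>
        have "r' * D = real d / (c2 * \<kappa>)"
        proof -
          have "\<kappa> powr (2 * s) * \<delta> = 1 / \<kappa>"
          proof -
            have e: "2 * s + - p = - 1" by (simp add: p_eq)
            show ?thesis unfolding \<kappa>p[symmetric] powr_add[symmetric] e using \<kappa>0 by (simp add: powr_minus_divide)
          qed
          then have "real d / c2 * (\<kappa> powr (2 * s) * \<delta>) = real d / c2 * (1 / \<kappa>)" by (simp only:)
          then show ?thesis unfolding r'_def D_def by (simp add: mult_ac)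
        qed
        moreover have "lnn\<^sup>2 / (c2 * K) \<le> real d / (c2 * \<kappa>)"
        proof -
          have "lnn\<^sup>2 / K * \<kappa> \<le> lnn\<^sup>2 / K * real n powr (1 / p)"
            using K by (intro mult_left_mono \<kappa>_upper) auto
          also have "\<dots> \<le> real d" using d_lower by (simp add: mult.commute)
          finally have "lnn\<^sup>2 / K \<le> real d / \<kappa>" using \<kappa>0 by (simp add: pos_le_divide_eq)
          then have "lnn\<^sup>2 / K / c2 \<le> real d / \<kappa> / c2" using c2_pos by (intro divide_right_mono) auto
          then show ?thesis by (simp add: mult.commute)
        qed
        ultimately have "c1 * (lnn\<^sup>2 / (c2 * K)) \<le> c1 * (r' * D)" using c1 by (intro mult_left_mono) auto
        moreover have "lnn \<le> c1 * (lnn\<^sup>2 / (c2 * K))"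
        proof -
          have "c2 * K \<le> lnn * c1" using elim(3) c1 by (simp add: lnn_def pos_divide_le_eq)
          then have "lnn * (c2 * K) \<le> lnn * (lnn * c1)" using lnn by (intro mult_left_mono) auto
          then have "lnn \<le> lnn * (lnn * c1) / (c2 * K)"
            using mult_pos_pos[OF c2_pos K] by (simp only: pos_le_divide_eq)
          also have "\<dots> = c1 * (lnn\<^sup>2 / (c2 * K))" by (simp add: power2_eq_square)
          finally show ?thesis .
        qed
        moreover have "2 * r' * real d * (c1 * \<delta>) - (r' - 1) * \<tau> = \<tau> - 2 * (c1 * (r' * D))"
          by (simp add: \<tau>_def D_def algebra_simps)
        ultimately have "2 * r' * real d * (c1 * \<delta>) - (r' - 1) * \<tau> \<le> - lnn"
          using \<tau>6 lnn(1) by linarith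
        then have "exp (2 * r' * real d * (c1 * \<delta>) - (r' - 1) * \<tau>) \<le> exp (- lnn)" by simp
        then show ?thesis using n by (simp add: lnn_def exp_minus field_simps)
      qed
      \<comment> \<open>Machines whose summand in the equation for \<open>\<delta>\<close> is capped
        at 1 get the full-sample bound, the others the entropy bound.\<close>
      have term_le: "min (Q * (exp (2 * real d * (c1 * \<delta>)) - 1))
          (8 * ((exp 1)\<^sup>2 * \<tau>) * ((3 + ln (real n)) * B i + 1 / real n) + 2 * Q * (2 / real n))
        \<le> Q * (C4 * D * \<mu> i + C5 / real n)" if i: "i \<in> {1..m}" for i
      proof (cases "1 \<le> lg * \<delta> powr (1 / p) * B i")
        case True
        have x: "0 \<le> 2 * c1 * D" "2 * c1 * D \<le> 1" using c1 D0 D1 \<tau>6 by (simp_all add: \<tau>_def)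
        have "exp (2 * c1 * D) \<le> 1 + 2 * c1 * D + (2 * c1 * D)\<^sup>2" using x by (rule exp_bound)
        also have "(2 * c1 * D)\<^sup>2 \<le> 2 * c1 * D" using x by (simp only: power2_eq_square mult_left_le)
        finally have "exp (2 * c1 * D) - 1 \<le> 4 * c1 * D" by linarith
        also have "\<dots> \<le> C4 * D"
        proof -
          have "1 * 1 \<le> real N * e2" using N0 e2 by (intro mult_mono) auto
          then have "4 * 1 \<le> 1024 * (real N * e2)" by linarith
          then have "4 * 1 * (c1 * D) \<le> 1024 * (real N * e2) * (c1 * D)" using c1 D0 by (intro mult_right_mono) auto
          then show ?thesis by (simp add: C4_def mult_ac)
        qed
        also have "\<dots> \<le> C4 * D * \<mu> i + C5 / real n" using True C45 n by (simp add: \<mu>_def)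
        finally have le: "Q * (exp (2 * c1 * D) - 1) \<le> Q * (C4 * D * \<mu> i + C5 / real n)"
          using Q1 by (intro mult_left_mono) auto
        have eq: "2 * real d * (c1 * \<delta>) = 2 * c1 * D" by (simp add: D_def)
        show ?thesis unfolding eq using le by (rule min.coboundedI1)
      next
        case False
        have Bi: "B i > 0" using B i by simp
        have "3 + ln (real n) \<le> 4 * lg" using lnn lg by (simp add: lnn_def)
        then have "(3 + ln (real n)) * B i \<le> 4 * lg * B i" using Bi by (intro mult_right_mono) auto
        \<comment> \<open>Brings in the factor \<open>1 / \<kappa> = \<delta> powr (1 / p)\<close>
          of \<open>\<mu> i\<close>, at the price of \<open>Q\<close>, which the average over the
          hypotheses removes again.\<close>
        also have "\<dots> \<le> 4 * lg * B i * (8 * real N * Q / \<kappa>)"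
        proof -
          have "1 \<le> 8 * real N * Q / \<kappa>" using Q\<kappa> \<kappa>0 by (simp only: pos_le_divide_eq mult_1)
          then have "4 * lg * B i * 1 \<le> 4 * lg * B i * (8 * real N * Q / \<kappa>)"
            using lg Bi by (intro mult_left_mono) auto
          then show ?thesis by simp
        qed
        also have "\<dots> = 32 * real N * Q * \<mu> i"
          using False by (simp add: \<mu>_def \<delta>_inv min_def)
        finally have 1: "(3 + ln (real n)) * B i \<le> 32 * real N * Q * \<mu> i" .
        have 2: "1 / real n \<le> Q / real n" using Q1 n by (intro divide_right_mono) auto
        have "8 * (e2 * \<tau>) * ((3 + ln (real n)) * B i + 1 / real n) + 2 * Q * (2 / real n)
          \<le> 8 * (e2 * \<tau>) * (32 * real N * Q * \<mu> i + Q / real n) + 2 * Q * (2 / real n)"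
          using 1 2 e2 \<tau>0 by (intro add_right_mono mult_left_mono add_mono) auto
        also have "\<dots> = Q * (C4 * D * \<mu> i + (32 * e2 * c1 * D + 4) / real n)"
          by (simp add: \<tau>_def C4_def algebra_simps add_divide_distrib)
        also have "\<dots> \<le> Q * (C4 * D * \<mu> i + C5 / real n)"
        proof -
          have "32 * e2 * c1 * D \<le> 32 * e2 * c1 * 1" using D1 e2 c1 by (intro mult_left_mono) auto
          then show ?thesis using Q1 n by (intro mult_left_mono add_left_mono divide_right_mono) (auto simp: C5_def)
        qed
        finally show ?thesis by (simp add: e2_def min_le_iff_disj)
      qed
      have "ennreal (c * 2 powr (- (real j * (s + 1 / 2))) * sqrt (2 ^ j / (2 * real N)) / 4)
          \<le> minimax_risk \<sigma> n m B (besov_ball j0 w s L)"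
      \<comment> \<open>With \<open>\<nu> = n\<close> the terms \<open>1 / \<nu>\<close> of all
        machines add up to \<open>m / n \<le> 1\<close>, and \<open>ln \<nu>\<close> is, up to its
        base, the logarithm in front of \<open>B i\<close> in the equation for
        \<open>\<delta>\<close>.\<close>
      proof (rule minimax_risk_messages[OF \<sigma> c j(1) r'1 _ j(2)[unfolded \<kappa>p] \<tau>0, of r "real n" m B n "2 / real n" C])
        have "r' * (c * 2 powr (- (real j * (s + 1 / 2))) * (sqrt (2 ^ j) * \<Psi>) / \<sigma>)\<^sup>2 \<le> r' * (c2 * \<kappa> powr (- (2 * s)))"
          using r'1 by (intro mult_left_mono j(3)) auto
        also have "\<dots> = 1"
        proof -
          have "c2 \<noteq> 0" using c2_pos by (rule less_imp_neq[symmetric])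
          moreover have "\<kappa> powr (2 * s) * \<kappa> powr (- (2 * s)) = 1" using \<kappa>0 by (simp add: powr_add[symmetric])
          ultimately show ?thesis unfolding r'_def
            by (metis (no_types, opaque_lifting) mult.commute nonzero_eq_divide_eq times_divide_eq_right)
        qed
        finally show "r' * (c * 2 powr (- (real j * (s + 1 / 2))) * (sqrt (2 ^ j) * \<Psi>) / \<sigma>)\<^sup>2 \<le> 1" .
        show "0 \<le> r" using \<tau>0 by (simp add: r_def)
        show "1 \<le> real n" using n by simp
        show "B i > 0" if "i \<in> {1..m}" for i using B that by simp
        show "exp ((2 + r) * (1 + r) * \<tau> / 2 - r) + exp (2 * r' * real (n div m) * (c1 * \<delta>) - (r' - 1) * \<tau>) \<le> 2 / real n"
          using \<epsilon>1 \<epsilon>2 unfolding d_def by simp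
        show "C > 0" by (rule C45)
        have "32 * exp (2 * C) * (8 * real N) \<le> \<kappa>" using \<kappa>(4) by (simp add: mult_ac)
        then have "32 * exp (2 * C) \<le> \<kappa> / (8 * real N)" using N0 by (simp add: pos_le_divide_eq)
        then show "32 * exp (2 * C) \<le> real (bump_count j)" using j(4) by linarith
        have "(\<Sum>i\<in>{1..m}. min (Q * (exp (2 * real d * (c1 * \<delta>)) - 1))
          (8 * ((exp 1)\<^sup>2 * \<tau>) * ((3 + ln (real n)) * B i + 1 / real n) + 2 * Q * (2 / real n)))
          \<le> (\<Sum>i\<in>{1..m}. Q * (C4 * D * \<mu> i + C5 / real n))"
          by (rule sum_mono) (rule term_le)
        also have "\<dots> = Q * (C4 * (D * \<Sigma>) + C5 * (real m / real n))"
          by (simp add: \<Sigma>_def sum.distrib sum_distrib_left algebra_simps)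
        also have "\<dots> \<le> Q * (C4 * 1 + C5 * 1)"
        proof -
          have "real m \<le> real n" using dvd n by (simp add: dvd_imp_le)
          then have "real m / real n \<le> 1" using n by simp
          then show ?thesis using Q1 C45 D\<Sigma> by (intro mult_left_mono add_mono) auto
        qed
        also have "\<dots> = Q * C" by (simp add: C_def)
        finally show "(\<Sum>i\<in>{1..m}. min (real (bump_count j) * (exp (2 * real (n div m) * (c1 * \<delta>)) - 1))
          (8 * ((exp 1)\<^sup>2 * \<tau>) * ((3 + ln (real n)) * B i + 1 / real n) + 2 * real (bump_count j) * (2 / real n)))
          \<le> real (bump_count j) * C" unfolding Q_def d_def .
      qed
      moreover have "c3 * \<delta> powr (s / p) \<le> c * 2 powr (- (real j * (s + 1 / 2))) * sqrt (2 ^ j / (2 * real N)) / 4"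
        using j(5) unfolding \<kappa>s by (simp add: c3_eq)
      ultimately show "ennreal (c3 * \<delta> powr (s / p)) \<le> minimax_risk \<sigma> n m B (besov_ball j0 w s L)"
        by (meson ennreal_leI order_trans)
    qed
  qed
qed

end

end

text \<open>\<open>K\<close> is the implied constant of the condition on \<open>m\<close>.
  \<open>C\<close> and \<open>n0\<close> are fixed before \<open>m\<close>, \<open>B\<close> and
  \<open>\<delta>\<close>, so the bound is uniform in them.\<close>

theorem theorem2p6:
  fixes s L \<sigma> K :: real and N j0 :: nat and w :: "cdv_index \<Rightarrow> real \<Rightarrow> real"
  assumes "s > 0" and "L > 0" and "\<sigma> > 0" and "K > 0"
    and "real N > s" and "cdv_basis N j0 w"
  shows "\<exists>C>0. \<exists>n0::nat. \<forall>n\<ge>n0. \<forall>(m::nat) (B :: nat \<Rightarrow> real) (\<delta>::real).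
      m dvd n \<and>
      log 2 (real n) \<le> real m \<and>
      real m \<le> K * (real n powr (2 * s / (1 + 2 * s)) / (ln (real n))\<^sup>2) \<and>
      (\<forall>i\<in>{1..m}. B i > 0) \<and>
      delta_solution s n m B \<delta> \<longrightarrow>
      ennreal (max ((real n / ln (real n)) powr (- (s / (1 + 2 * s)))) (\<delta> powr (s / (1 + 2 * s))))
        \<le> ennreal C * minimax_risk \<sigma> n m B (besov_ball j0 w s L)"
proof -
  obtain \<psi> \<Psi> where "cdv_interior N j0 w \<psi> \<Psi>"
    using cdv_basis_interior[OF assms(6)] by blast
  then interpret cdv_interior N j0 w \<psi> \<Psi> .
  define p where "p = 1 + 2 * s"
  have p: "p > 0" using assms(1) by (simp add: p_def)
  define A where "A = 2 powr (1 + 2 * s) / \<sigma>\<^sup>2"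
  have A: "A > 0" using assms(3) by (simp add: A_def)
  \<comment> \<open>\<open>L / 2\<close> keeps the bumps strictly inside the ball, and the second
    value brings \<open>c1\<close> down to at most \<open>1 / (24 * p)\<close>.\<close>
  define c where "c = min (L / 2) (sqrt (1 / (24 * p) / A))"
  have c: "0 < c" "c < L" using assms(2) p A by (auto simp: c_def)
  have c_small: "c\<^sup>2 * 2 powr (1 + 2 * s) / \<sigma>\<^sup>2 \<le> 1 / (24 * p)"
  proof -
    have "c\<^sup>2 \<le> (sqrt (1 / (24 * p) / A))\<^sup>2" using c(1) by (intro power_mono) (auto simp: c_def)
    also have "\<dots> = 1 / (24 * p) / A" using p A by simp
    finally have "c\<^sup>2 * A \<le> 1 / (24 * p)" using A by (simp only: pos_le_divide_eq)
    then show ?thesis by (simp add: A_def)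
  qed
  define c3 where "c3 = c / sqrt (2 * real N) / 4"
  have c3: "c3 > 0" using c N by (simp add: c3_def)
  note constants = assms(1,3) c p_def refl refl c3_def c_small
  have "eventually (\<lambda>n. \<forall>(m::nat) (B :: nat \<Rightarrow> real) (\<delta>::real).
      m dvd n \<and> log 2 (real n) \<le> real m \<and>
      real m \<le> K * (real n powr (2 * s / (1 + 2 * s)) / (ln (real n))\<^sup>2) \<and>
      (\<forall>i\<in>{1..m}. B i > 0) \<and> delta_solution s n m B \<delta> \<longrightarrow>
      ennreal (max ((real n / ln (real n)) powr (- (s / (1 + 2 * s)))) (\<delta> powr (s / (1 + 2 * s))))
        \<le> ennreal (1 / c3) * minimax_risk \<sigma> n m B (besov_ball j0 w s L)) sequentially"
    using minimax_lower_full_data[OF constants] minimax_lower_messages[OF constants assms(4)]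
  proof eventually_elim
    case (elim n)
    show ?case
    proof (intro allI impI)
      fix m \<delta> and B :: "nat \<Rightarrow> real"
      let ?risk = "minimax_risk \<sigma> n m B (besov_ball j0 w s L)"
      let ?a = "(real n / ln (real n)) powr (- (s / (1 + 2 * s)))" and ?b = "\<delta> powr (s / (1 + 2 * s))"
      assume "m dvd n \<and> log 2 (real n) \<le> real m \<and>
        real m \<le> K * (real n powr (2 * s / (1 + 2 * s)) / (ln (real n))\<^sup>2) \<and>
        (\<forall>i\<in>{1..m}. B i > 0) \<and> delta_solution s n m B \<delta>"
      then have "ennreal (c3 * ?a) \<le> ?risk" "ennreal (c3 * ?b) \<le> ?risk"
        using elim unfolding p_def by blast+
      then have "ennreal (c3 * max ?a ?b) \<le> ?risk" by (simp add: max_def)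
      then have "ennreal (1 / c3) * ennreal (c3 * max ?a ?b) \<le> ennreal (1 / c3) * ?risk"
        by (rule mult_left_mono) simp
      moreover have "ennreal (1 / c3) * ennreal (c3 * max ?a ?b) = ennreal (max ?a ?b)"
        using c3 by (subst ennreal_mult[symmetric]) (auto simp: le_max_iff_disj)
      ultimately show "ennreal (max ?a ?b) \<le> ennreal (1 / c3) * ?risk" by simp
    qed
  qed
  then show ?thesis
    using c3 unfolding eventually_sequentially by (intro exI[of _ "1 / c3"]) simp
qed

end
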